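(* Let $\hat S(\hat t)=e^{\hat t\hat A}$, $\hat t\ge0$, be a strongly continuous semigroup with generator $\hat A$ on a complex Hilbert space $\mathcal H$. Let $\hat\omega\in\mathbb R$, assume that $\{\Re z\ge\hat\omega\}$ is contained in the resolvent set of $\hat A$ and that $\|(z-\hat A)^{-1}\|$ is uniformly bounded there, and let $\hat r\in\,]0,+\infty[$ be defined by $\frac1{\hat r}=\sup_{\Re z>\hat\omega}\|(z-\hat A)^{-1}\|$. Let $0<\hat m\in C^1([0,+\infty[)$ satisfy $\|\hat S(\hat t)\|\le\hat m(\hat t)$ for all $\hat t>0$. Let $\hat a^*=\hat a^*(\hat m,\hat\omega,\hat r)\in\,]0,+\infty]$ and $\hat\psi=\hat\psi(\cdot;\hat m,\hat\omega,\hat r)$ be as in the context. (i) If $\hat a,\hat b\in\,]0,+\infty[\,\cap\,]0,\hat a^*]$ and $\hat t>\hat a+\hat b$, then $$\|\hat S(\hat t)\|\le\exp\big((\hat\omega-\hat r)(\hat t-(\hat a+\hat b))\big)\,\hat m(\hat a)\,\hat m(\hat b)\,\hat\psi(\hat a)^{1/2}\,\hat\psi(\hat b)^{1/2}.$$ (ii) When $\hat a^*<+\infty$, the estimate in (i) is optimal for $\hat a=\hat b=\hat a^*$, i.e. for $\hat t>2\hat a^*$ its right-hand side, as a function of $(\hat a,\hat b)\in\,]0,\hat a^*]^2$, is minimal at $\hat a=\hat b=\hat a^*$, and it then reads $$\|\hat S(\hat t)\|\le\exp\big((\hat\omega-\hat r)(\hat t-2\hat a^* )\big)\,\hat m(\hat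 a^* )^2,\qquad\hat t>2\hat a^*.$$ (iii) With $m(s):=e^{-\hat\omega s/\hat r}\,\hat m(s/\hat r)$, $s\ge0$, one has $$\hat a^*=\frac1{\hat r}\,a^*(m),\qquad\hat\psi(\hat s)=\psi_0(\hat r\hat s;m),$$ where $a^*(m)$ and $\psi_0(\cdot;m)$ are defined in the context.
   Context: Definition of $\hat a^*$ and $\hat\psi$: put $\hat n(\hat s)=e^{-\hat\omega\hat s}\hat m(\hat s)$ and let $\hat u:[0,+\infty[\to\mathbb R$ be the solution, unique up to a positive constant factor, of $\frac1{\hat r}\partial_{\hat s}\left(\hat n^2\,\frac1{\hat r}\partial_{\hat s}\hat u\right)+\hat n^2\hat u=0$ with $\hat u(0)=0$, $\hat u'(0)>0$. Then $\hat a^*\in\,]0,+\infty]$ is the largest element such that $0<\hat u<\hat u'/\hat r$ on $]0,\hat a^*[$ (so that $\hat u'(\hat a^* )/\hat r=\hat u(\hat a^* )$ if $\hat a^*<+\infty$), and $\hat\psi=(\hat u'/\hat r)/\hat u$ on $]0,+\infty[\,\cap\,]0,\hat a^*]$. Definition of $a^*(m)$ and $\psi_0(\cdot;m)$ for $0<m\in C^1([0,+\infty[)$: for $a>0$, let $K_{m,a}^{DR}$ be the realization in $L^2(]0,a[;m^2ds)$ of $K_m=-\frac1{m^2}\partial_s\circ m^2\partial_s-1$ with domain $\{u\in H^2(]0,a[);\ u(0)=0,\ u'(a)=u(a)\}$ (self-adjoint, bounded from below, purely discrete spectrum), with lowest eigenvalue $\lambda^{DR}(a,m)$. Then $a^*(m)=\sup\{\tilde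 a\in\,]0,+\infty[\,;\ \lambda^{DR}(a,m)>0\text{ for }0<a<\tilde a\}\in\,]0,+\infty]$. Let $u_0:[0,+\infty[\to\mathbb R$ be the solution, unique up to a positive constant factor, of $(m^2u_0')'+m^2u_0=0$, $u_0(0)=0$, $u_0'(0)>0$; it is positive on $]0,+\infty[\,\cap\,]0,a^*(m)]$, and $\psi_0(\cdot;m)=u_0'/u_0$ there. *)

theory Defs
  imports "HOL-Analysis.Analysis"
begin

class complex_hilbert_space = banach +
  fixes scaleC :: "complex \<Rightarrow> 'a \<Rightarrow> 'a" (infixr "*\<^sub>C" 75)
    and cinner :: "'a \<Rightarrow> 'a \<Rightarrow> complex"
  assumes scaleC_add_right: "c *\<^sub>C (x + y) = c *\<^sub>C x + c *\<^sub>C y"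
    and scaleC_add_left: "(c + d) *\<^sub>C x = c *\<^sub>C x + d *\<^sub>C x"
    and scaleC_scaleC: "c *\<^sub>C (d *\<^sub>C x) = (c * d) *\<^sub>C x"
    and scaleR_scaleC: "scaleR a x = complex_of_real a *\<^sub>C x"
    and cinner_commute: "cinner x y = cnj (cinner y x)"
    and cinner_add_left: "cinner (x + y) z = cinner x z + cinner y z"
    and cinner_scaleC_left: "cinner (c *\<^sub>C x) y = c * cinner x y"
    and cinner_self: "cinner x x = complex_of_real ((norm x)\<^sup>2)"

instantiation complex :: complex_hilbert_space
begin

definition scaleC_complex :: "complex \<Rightarrow> complex \<Rightarrow> complex"
  where "scaleC_complex c x = c * x"

definition cinner_complex :: "complex \<Rightarrow> complex \<Rightarrow> complex"
  where "cinner_complex x y = x * cnj y"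

instance
  by standard
    (auto simp: scaleC_complex_def cinner_complex_def algebra_simps scaleR_conv_of_real
      simp flip: complex_norm_square)

end

definition bounded_clinear :: "('h::complex_hilbert_space \<Rightarrow> 'h) \<Rightarrow> bool"
  where "bounded_clinear T \<longleftrightarrow> bounded_linear T \<and> (\<forall>c x. T (c *\<^sub>C x) = c *\<^sub>C T x)"

definition C0_semigroup :: "(real \<Rightarrow> 'h::complex_hilbert_space \<Rightarrow> 'h) \<Rightarrow> bool"
  where "C0_semigroup S \<longleftrightarrow>
    (\<forall>t\<ge>0. bounded_clinear (S t)) \<and>
    S 0 = id \<and>
    (\<forall>s\<ge>0. \<forall>t\<ge>0. S (s + t) = S s \<circ> S t) \<and>
    (\<forall>x. continuous_on {0..} (\<lambda>t. S t x))"

text \<open>An unbounded operator is given by its domain and a function that is only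
  meaningful on that domain.\<close>

definition generator_dom :: "(real \<Rightarrow> 'h::complex_hilbert_space \<Rightarrow> 'h) \<Rightarrow> 'h set"
  where "generator_dom S =
    {x. \<exists>y. ((\<lambda>h. (S h x - x) /\<^sub>R h) \<longlongrightarrow> y) (at_right 0)}"

definition generator :: "(real \<Rightarrow> 'h::complex_hilbert_space \<Rightarrow> 'h) \<Rightarrow> 'h \<Rightarrow> 'h"
  where "generator S x = Lim (at_right 0) (\<lambda>h. (S h x - x) /\<^sub>R h)"

definition resolvent ::
    "'h::complex_hilbert_space set \<Rightarrow> ('h \<Rightarrow> 'h) \<Rightarrow> complex \<Rightarrow> 'h \<Rightarrow> 'h"
  where "resolvent D A z = inv_into D (\<lambda>x. z *\<^sub>C x - A x)"

definition resolvent_set ::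
    "'h::complex_hilbert_space set \<Rightarrow> ('h \<Rightarrow> 'h) \<Rightarrow> complex set"
  where "resolvent_set D A =
    {z. bij_betw (\<lambda>x. z *\<^sub>C x - A x) D UNIV \<and> bounded_clinear (resolvent D A z)}"

text \<open>The derivative is one-sided at the endpoint 0.\<close>

definition D0 :: "(real \<Rightarrow> real) \<Rightarrow> real \<Rightarrow> real"
  where "D0 f s = vector_derivative f (at s within {0..})"

definition C1_halfline :: "(real \<Rightarrow> real) \<Rightarrow> bool"
  where "C1_halfline f \<longleftrightarrow> f differentiable_on {0..} \<and> continuous_on {0..} (D0 f)"

definition n_hat :: "(real \<Rightarrow> real) \<Rightarrow> real \<Rightarrow> real \<Rightarrow> real"
  where "n_hat m \<omega> s = exp (- \<omega> * s) * m s"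

definition is_u_hat :: "(real \<Rightarrow> real) \<Rightarrow> real \<Rightarrow> real \<Rightarrow> (real \<Rightarrow> real) \<Rightarrow> bool"
  where "is_u_hat m \<omega> r u \<longleftrightarrow>
    u differentiable_on {0..} \<and>
    (\<lambda>s. (n_hat m \<omega> s)\<^sup>2 * (1 / r * D0 u s)) differentiable_on {0..} \<and>
    (\<forall>s\<ge>0. 1 / r * D0 (\<lambda>s. (n_hat m \<omega> s)\<^sup>2 * (1 / r * D0 u s)) s
            + (n_hat m \<omega> s)\<^sup>2 * u s = 0) \<and>
    u 0 = 0 \<and> D0 u 0 > 0"

text \<open>The solution is unique up to a positive factor on the half-line, and everything
  below is invariant under such a factor and looks at the half-line only, so an
  arbitrary choice is harmless.\<close>

definition u_hat :: "(real \<Rightarrow> real) \<Rightarrow> real \<Rightarrow> real \<Rightarrow> real \<Rightarrow> real"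
  where "u_hat m \<omega> r = (SOME u. is_u_hat m \<omega> r u)"

definition a_hat_star :: "(real \<Rightarrow> real) \<Rightarrow> real \<Rightarrow> real \<Rightarrow> ereal"
  where "a_hat_star m \<omega> r = (GREATEST a. 0 < a \<and>
    (\<forall>s>0. ereal s < a \<longrightarrow>
      0 < u_hat m \<omega> r s \<and> u_hat m \<omega> r s < D0 (u_hat m \<omega> r) s / r))"

definition psi_hat :: "(real \<Rightarrow> real) \<Rightarrow> real \<Rightarrow> real \<Rightarrow> real \<Rightarrow> real"
  where "psi_hat m \<omega> r s = (D0 (u_hat m \<omega> r) s / r) / u_hat m \<omega> r s"

definition semigroup_bound ::
    "(real \<Rightarrow> real) \<Rightarrow> real \<Rightarrow> real \<Rightarrow> real \<Rightarrow> real \<Rightarrow> real \<Rightarrow> real"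
  where "semigroup_bound m \<omega> r t a b =
    exp ((\<omega> - r) * (t - (a + b))) * m a * m b * sqrt (psi_hat m \<omega> r a) * sqrt (psi_hat m \<omega> r b)"

text \<open>\<open>f\<close> is absolutely continuous on \<open>[0, a]\<close> with derivative \<open>g\<close> in \<open>L\<^sup>1(]0, a[)\<close>.
  On an interval this says that \<open>g\<close> is the weak derivative of \<open>f\<close> and that \<open>f\<close> is the
  continuous representative of its class.\<close>

definition ac_deriv :: "real \<Rightarrow> (real \<Rightarrow> complex) \<Rightarrow> (real \<Rightarrow> complex) \<Rightarrow> bool"
  where "ac_deriv a f g \<longleftrightarrow>
    set_integrable lebesgue {0..a} g \<and>
    (\<forall>s\<in>{0..a}. f s = f 0 + (LINT t:{0..s}|lebesgue. g t))"

text \<open>\<open>u\<close> is in \<open>H\<^sup>2(]0, a[)\<close>, and \<open>u\<close>, \<open>u'\<close> are the continuous representatives of the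
  function and of its derivative, so that the boundary values \<open>u 0\<close>, \<open>u a\<close>, \<open>u' a\<close> are the traces.
  Only the second derivative needs a square integrability condition,
  \<open>u\<close> and \<open>u'\<close> being continuous on \<open>[0, a]\<close>.\<close>

definition sobolev_H2 :: "real \<Rightarrow> (real \<Rightarrow> complex) \<Rightarrow> (real \<Rightarrow> complex) \<Rightarrow> bool"
  where "sobolev_H2 a u u' \<longleftrightarrow>
    ac_deriv a u u' \<and>
    (\<exists>u''. ac_deriv a u' u'' \<and> set_integrable lebesgue {0..a} (\<lambda>s. (norm (u'' s))\<^sup>2))"

text \<open>The graph of the realization: \<open>u\<close> is in its domain and is mapped to (the class of)
  \<open>f\<close>; here \<open>w\<close> is \<open>(m\<^sup>2 u')'\<close>.\<close>

definition K_DR :: "(real \<Rightarrow> real) \<Rightarrow> real \<Rightarrow> (real \<Rightarrow> complex) \<Rightarrow> (real \<Rightarrow> complex) \<Rightarrow> bool"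
  where "K_DR m a u f \<longleftrightarrow> (\<exists>u' w.
    sobolev_H2 a u u' \<and> u 0 = 0 \<and> u' a = u a \<and>
    ac_deriv a (\<lambda>s. complex_of_real ((m s)\<^sup>2) * u' s) w \<and>
    (AE s in lebesgue. s \<in> {0<..<a} \<longrightarrow>
      f s = - (1 / complex_of_real ((m s)\<^sup>2)) * w s - u s))"

text \<open>The operator is self-adjoint, so its eigenvalues are real.\<close>

definition eigenvalue_DR :: "(real \<Rightarrow> real) \<Rightarrow> real \<Rightarrow> real \<Rightarrow> bool"
  where "eigenvalue_DR m a l \<longleftrightarrow> (\<exists>u.
    K_DR m a u (\<lambda>s. complex_of_real l * u s) \<and>
    \<not> (AE s in lebesgue. s \<in> {0<..<a} \<longrightarrow> u s = 0))"

definition lambda_DR :: "real \<Rightarrow> (real \<Rightarrow> real) \<Rightarrow> real"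
  where "lambda_DR a m = (LEAST l. eigenvalue_DR m a l)"

definition a_star :: "(real \<Rightarrow> real) \<Rightarrow> ereal"
  where "a_star m =
    Sup {ereal a' |a'. 0 < a' \<and> (\<forall>a. 0 < a \<and> a < a' \<longrightarrow> lambda_DR a m > 0)}"

definition is_u0 :: "(real \<Rightarrow> real) \<Rightarrow> (real \<Rightarrow> real) \<Rightarrow> bool"
  where "is_u0 m u \<longleftrightarrow>
    u differentiable_on {0..} \<and>
    (\<lambda>s. (m s)\<^sup>2 * D0 u s) differentiable_on {0..} \<and>
    (\<forall>s\<ge>0. D0 (\<lambda>s. (m s)\<^sup>2 * D0 u s) s + (m s)\<^sup>2 * u s = 0) \<and>
    u 0 = 0 \<and> D0 u 0 > 0"

definition u0 :: "(real \<Rightarrow> real) \<Rightarrow> real \<Rightarrow> real"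
  where "u0 m = (SOME u. is_u0 m u)"

definition psi0 :: "(real \<Rightarrow> real) \<Rightarrow> real \<Rightarrow> real"
  where "psi0 m s = D0 (u0 m) s / u0 m s"

end

theory Submission
  imports Defs
begin

text \<open>
  Multiplying an orbit \<open>S t v\<close> by a compactly supported \<open>\<phi>\<close> with \<open>\<phi> 0 = 0\<close>, taking the Laplace transform and
  applying the resolvent bound and Parseval's theorem on vertical lines gives
  \<open>\<integral> exp (- 2 \<omega> t) \<phi>\<^sup>2 |S t v|\<^sup>2 \<le> 1/r\<^sup>2 \<integral> exp (- 2 \<omega> t) \<phi>'\<^sup>2 |S t v|\<^sup>2\<close>. On an initial
  interval of length \<open>a\<close> the norm \<open>|S s v|\<close> is at most \<open>m s |v|\<close>, on a final interval of length \<open>b\<close> it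
  is at least \<open>|S t v| / m (t - s)\<close>; minimizing, respectively maximizing, the resulting quadratic
  functionals of \<open>\<phi>\<close> leads to the same Sturm-Liouville equation, and between the two intervals
  \<open>\<phi>' = r \<phi>\<close> costs nothing. The quantity \<open>exp (2 r a) p a / u a\<close>, \<open>p = n\<^sup>2 u' / r\<close>, whose square roots
  are the two factors of the bound, is nonincreasing in \<open>a\<close>, which is the optimality. A
  Wronskian argument shows that no eigenvalue of the Dirichlet-Robin problem is negative up to the first
  point where \<open>u' = r u\<close>, and that 0 is one exactly there.
\<close>

section \<open>Elementary facts about complex Hilbert spaces\<close>

text \<open>Three obstacles stand behind this outline. The resolvent bound is used only for Re z >
  \<omega>, so the line Re z = \<omega> is reached by a limit; since \<phi> has compact support,
  Parseval is needed only for Fourier series on a bounded interval and only as an inequality, with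
  Bessel on the side of \<phi>' and Fejer means on the side of \<phi>. The optimal test function
  does not vanish at time t. It has to be cut off beyond t, which costs nothing in the limit only if
  exp (- 2 \<omega> s) |S s v|^2 has finite integral over the half-line; that is extracted from the
  energy inequality itself, starting from a large exponent. The lowest eigenvalue is a
  \<open>LEAST\<close>, so its positivity requires that eigenvalues exist and that there is a
  smallest one. This comes from a sign change of P - m^2 U in the spectral parameter, and is why the
  solutions are built as power series in that parameter, jointly continuous in it and in s.\<close>

lemma scaleC_zero_left [simp]: "0 *\<^sub>C (x::'h::complex_hilbert_space) = 0"
  by (metis add_cancel_right_right scaleC_add_left)

lemma scaleC_zero_right [simp]: "c *\<^sub>C (0::'h::complex_hilbert_space) = 0"
  by (metis add_cancel_right_right scaleC_add_right)

lemma scaleC_one [simp]: "1 *\<^sub>C (x::'h::complex_hilbert_space) = x"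
  by (metis of_real_1 scaleR_one scaleR_scaleC)

lemma cinner_add_right: "cinner x (y + z :: 'h::complex_hilbert_space) = cinner x y + cinner x z"
  by (metis cinner_add_left cinner_commute complex_cnj_add)

lemma cinner_scaleC_right: "cinner x (c *\<^sub>C y :: 'h::complex_hilbert_space) = cnj c * cinner x y"
  by (metis cinner_scaleC_left cinner_commute complex_cnj_mult)

lemma norm_scaleC: "norm (c *\<^sub>C (x::'h::complex_hilbert_space)) = cmod c * norm x"
proof -
  have "complex_of_real ((norm (c *\<^sub>C x))\<^sup>2) = complex_of_real ((cmod c * norm x)\<^sup>2)"
    unfolding cinner_self[symmetric] cinner_scaleC_left cinner_scaleC_right
    by (simp add: cinner_self power_mult_distrib complex_norm_square algebra_simps
        del: of_real_power) 
  then have "(norm (c *\<^sub>C x))\<^sup>2 = (cmod c * norm x)\<^sup>2"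
    by (simp only: of_real_eq_iff)
  then show ?thesis by (simp add: power2_eq_iff_nonneg)
qed

lemma cinner_scaleR_left: "cinner (a *\<^sub>R x) (y::'h::complex_hilbert_space) = complex_of_real a * cinner x y"
  by (simp add: scaleR_scaleC cinner_scaleC_left)

lemma cinner_scaleR_right: "cinner x (a *\<^sub>R y::'h::complex_hilbert_space) = complex_of_real a * cinner x y"
  by (simp add: scaleR_scaleC cinner_scaleC_right)

lemma cmod_cinner_le: "cmod (cinner x (y::'h::complex_hilbert_space)) \<le> norm x * norm y"
proof (cases "norm y = 0")
  case True
  then have "y = 0" by simp
  then have "cinner x y = 0" using cinner_add_right[of x 0 0] by simp
  then show ?thesis by simp
next
  case False
  \<comment> \<open>Makes \<open>c *\<^sub>C y\<close> the orthogonal projection of \<open>x\<close>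
    onto the line of \<open>y\<close>; the squared norm of the remainder is the Cauchy-Schwarz
    defect.\<close>
  define c where "c = cinner x y / complex_of_real ((norm y)\<^sup>2)"
  have *: "cinner x y = c * complex_of_real ((norm y)\<^sup>2)"
    using False by (simp add: c_def)
  have "complex_of_real ((norm (x + (-c) *\<^sub>C y))\<^sup>2) =
      cinner x x - cnj c * cinner x y - c * cinner y x + c * cnj c * cinner y y"
    unfolding cinner_self[symmetric]
    by (simp add: cinner_add_left cinner_add_right cinner_scaleC_left cinner_scaleC_right algebra_simps)
  also have "cinner y x = cnj c * complex_of_real ((norm y)\<^sup>2)"
    by (subst cinner_commute) (simp add: *)
  also have "cinner x x - cnj c * cinner x y - c * (cnj c * complex_of_real ((norm y)\<^sup>2))
      + c * cnj c * cinner y y = complex_of_real ((norm x)\<^sup>2 - (cmod c)\<^sup>2 * (norm y)\<^sup>2)"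
    using complex_norm_square[of c] by (simp add: * cinner_self algebra_simps)
  finally have "(norm (x + (-c) *\<^sub>C y))\<^sup>2 = (norm x)\<^sup>2 - (cmod c)\<^sup>2 * (norm y)\<^sup>2"
    by (simp only: of_real_eq_iff)
  then have "(cmod c * norm y)\<^sup>2 \<le> (norm x)\<^sup>2"
    by (metis diff_ge_0_iff_ge power_mult_distrib zero_le_power2)
  then have "cmod c * norm y \<le> norm x"
    by (simp add: power2_le_iff_abs_le)
  then have "cmod c * norm y * norm y \<le> norm x * norm y"
    by (simp add: mult_right_mono)
  then show ?thesis
    by (simp add: * norm_mult norm_power power2_eq_square mult.assoc)
qed

lemma bounded_bilinear_scaleC:
  "bounded_bilinear (\<lambda>c (x::'h::complex_hilbert_space). c *\<^sub>C x)"
proof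
  show "\<exists>K. \<forall>a (b::'h). norm (a *\<^sub>C b) \<le> norm a * norm b * K"
    by (rule exI[of _ 1]) (simp add: norm_scaleC)
  show "(r *\<^sub>R a) *\<^sub>C b = r *\<^sub>R (a *\<^sub>C (b::'h))" for r a b
    by (simp add: scaleR_scaleC[where 'a='h] scaleC_scaleC scaleR_conv_of_real)
  show "a *\<^sub>C (r *\<^sub>R b) = r *\<^sub>R (a *\<^sub>C (b::'h))" for r a b
    by (simp add: scaleR_scaleC[where 'a='h] scaleC_scaleC mult.commute)
qed (simp_all add: scaleC_add_left scaleC_add_right)

lemma bounded_bilinear_cinner:
  "bounded_bilinear (\<lambda>x (y::'h::complex_hilbert_space). cinner x y)"
proof
  show "\<exists>K. \<forall>a (b::'h). norm (cinner a b) \<le> norm a * norm b * K"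
    by (rule exI[of _ 1]) (simp add: cmod_cinner_le)
qed (simp_all add: cinner_add_left cinner_add_right cinner_scaleR_left cinner_scaleR_right
      scaleR_conv_of_real)

lemmas scaleC_intros [continuous_intros] =
  bounded_bilinear.continuous_on[OF bounded_bilinear_scaleC]
  bounded_bilinear.continuous_on[OF bounded_bilinear_cinner]

lemmas bounded_linear_scaleC_right = bounded_bilinear.bounded_linear_right[OF bounded_bilinear_scaleC]
lemmas bounded_linear_scaleC_left = bounded_bilinear.bounded_linear_left[OF bounded_bilinear_scaleC]
lemmas bounded_linear_cinner_left = bounded_bilinear.bounded_linear_left[OF bounded_bilinear_cinner]

lemma bounded_on_Icc:
  fixes f :: "real \<Rightarrow> 'a::real_normed_vector"
  assumes "continuous_on {a..b} f"
  obtains M where "\<And>t. t \<in> {a..b} \<Longrightarrow> norm (f t) \<le> M"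
  using compact_imp_bounded[OF compact_continuous_image[OF assms compact_Icc]]
  unfolding bounded_iff by blast

lemmas integral_combine_Icc = Henstock_Kurzweil_Integration.integral_combine

section \<open>Bessel's inequality and Fejer summation for Hilbert-space valued functions\<close>

abbreviation fourier_exp :: "real \<Rightarrow> int \<Rightarrow> real \<Rightarrow> complex"
  where "fourier_exp T k t \<equiv> cis (2 * pi * real_of_int k * t / T)"

text \<open>Not divided by \<open>T\<close>: in this normalization a coefficient is exactly a
  Laplace integral at a point of a vertical line, and Parseval carries a factor \<open>T\<close> on
  the side of the integral.\<close>

definition fourier_coeff :: "real \<Rightarrow> (real \<Rightarrow> 'h::complex_hilbert_space) \<Rightarrow> int \<Rightarrow> 'h"
  where "fourier_coeff T w k = integral {0..T} (\<lambda>t. fourier_exp T (- k) t *\<^sub>C w t)"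

lemma fourier_exp_mult: "fourier_exp T k t * fourier_exp T l t = fourier_exp T (k + l) t"
  by (simp add: cis_mult algebra_simps add_divide_distrib)

lemma continuous_on_fourier_exp [continuous_intros]:
  "continuous_on A f \<Longrightarrow> continuous_on A (\<lambda>t. fourier_exp T k (f t))"
  unfolding cis_conv_exp divide_inverse by (intro continuous_intros)

lemma has_integral_fourier_coeff:
  assumes "continuous_on {0..T} w"
  shows "((\<lambda>t. fourier_exp T (- k) t *\<^sub>C w t) has_integral fourier_coeff T w k) {0..T}"
  unfolding fourier_coeff_def
  by (intro integrable_integral integrable_continuous_real continuous_intros assms)

lemma has_integral_fourier_exp:
  assumes "0 < T"
  shows "(fourier_exp T k has_integral (if k = 0 then complex_of_real T else 0)) {0..T}"
proof (cases "k = 0")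
  case True
  then show ?thesis
    using has_integral_const_real[of "1::complex" 0 T] assms by (simp add: scaleR_conv_of_real)
next
  case False
  define a where "a = 2 * pi * real_of_int k / T"
  have a: "a \<noteq> 0" using False assms by (simp add: a_def)
  have "((\<lambda>t. cis (a * t)) has_integral
      cis (a * T) / (\<i> * a) - cis (a * 0) / (\<i> * a)) {0..T}"
  proof (rule fundamental_theorem_of_calculus)
    fix t assume "t \<in> {0..T}"
    have "((\<lambda>t. exp (\<i> * complex_of_real a * of_real t) / (\<i> * a)) has_vector_derivative
       exp (\<i> * complex_of_real a * of_real t)) (at t within {0..T})"
      using a by (auto intro!: derivative_eq_intros has_vector_derivative_real_field)
    then show "((\<lambda>t. cis (a * t) / (\<i> * a)) has_vector_derivative cis (a * t)) (at t within {0..T})"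
      by (simp add: cis_conv_exp mult.assoc)
  qed (use assms in simp)
  moreover have "cis (a * T) = 1"
    using assms cis_multiple_2pi[of "of_int k"] by (simp add: a_def)
  ultimately show ?thesis
    using False by (simp add: a_def mult.assoc times_divide_eq_left)
qed

lemma has_integral_cinner_fourier:
  assumes "continuous_on {0..T} (w :: real \<Rightarrow> 'h::complex_hilbert_space)"
  shows "((\<lambda>t. cinner (w t) (fourier_exp T k t *\<^sub>C x)) has_integral cinner (fourier_coeff T w k) x) {0..T}"
proof -
  have "((\<lambda>t. cinner (fourier_exp T (- k) t *\<^sub>C w t) x) has_integral cinner (fourier_coeff T w k) x) {0..T}"
    using has_integral_linear[OF has_integral_fourier_coeff[OF assms] bounded_linear_cinner_left]
    by (simp add: o_def)
  then show ?thesis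
    by (simp add: cinner_scaleC_left cinner_scaleC_right cis_cnj)
qed

lemma has_integral_cinner_trig_poly:
  assumes "continuous_on {0..T} (w :: real \<Rightarrow> 'h::complex_hilbert_space)" "finite K"
  shows "((\<lambda>t. cinner (w t) (\<Sum>k\<in>K. fourier_exp T (f k) t *\<^sub>C x k)) has_integral
    (\<Sum>k\<in>K. cinner (fourier_coeff T w (f k)) (x k))) {0..T}"
  unfolding bounded_bilinear.sum_right[OF bounded_bilinear_cinner]
  by (intro has_integral_sum assms has_integral_cinner_fourier)

lemma fourier_coeff_trig_poly:
  assumes "0 < T" "finite K" "l \<in> K"
  shows "fourier_coeff T (\<lambda>t. \<Sum>k\<in>K. fourier_exp T k t *\<^sub>C (x k :: 'h::complex_hilbert_space)) l = T *\<^sub>R x l"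
proof -
  have "((\<lambda>t. \<Sum>k\<in>K. fourier_exp T (k - l) t *\<^sub>C x k) has_integral
     (\<Sum>k\<in>K. (if k - l = 0 then complex_of_real T else 0) *\<^sub>C x k)) {0..T}"
    using has_integral_linear[OF has_integral_fourier_exp[OF assms(1)] bounded_linear_scaleC_left]
    unfolding o_def by (intro has_integral_sum assms)
  also have "(\<Sum>k\<in>K. (if k - l = 0 then complex_of_real T else 0) *\<^sub>C x k) =
      (\<Sum>k\<in>K. if k = l then complex_of_real T *\<^sub>C x k else 0)"
    by (intro sum.cong) auto
  also have "\<dots> = T *\<^sub>R x l"
    using assms by (simp add: scaleR_scaleC)
  also have "(\<lambda>t. \<Sum>k\<in>K. fourier_exp T (k - l) t *\<^sub>C x k) =
      (\<lambda>t. fourier_exp T (- l) t *\<^sub>C (\<Sum>k\<in>K. fourier_exp T k t *\<^sub>C x k))"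
    unfolding bounded_bilinear.sum_right[OF bounded_bilinear_scaleC] scaleC_scaleC fourier_exp_mult
    by simp
  finally show ?thesis
    unfolding fourier_coeff_def by (rule integral_unique)
qed

lemma bessel_inequality:
  assumes T: "0 < T" and w: "continuous_on {0..T} (w :: real \<Rightarrow> 'h::complex_hilbert_space)" and K: "finite K"
  shows "(\<Sum>k\<in>K. (norm (fourier_coeff T w k))\<^sup>2) \<le> T * integral {0..T} (\<lambda>t. (norm (w t))\<^sup>2)"
proof -
  \<comment> \<open>\<open>p\<close> below is the orthogonal projection of \<open>w\<close> onto the
    frequencies in \<open>K\<close>, so the integrals of \<open>cinner (w t) (p t)\<close> and
    \<open>cinner (p t) (p t)\<close> agree, and the nonnegative integral of |w - p|^2 is the
    claim.\<close>
  define x where "x k = (1 / T) *\<^sub>R fourier_coeff T w k" for k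
  define p where "p = (\<lambda>t. \<Sum>k\<in>K. fourier_exp T k t *\<^sub>C x k)"
  define s where "s = (\<Sum>k\<in>K. (norm (fourier_coeff T w k))\<^sup>2)"
  have pc: "continuous_on {0..T} p"
    unfolding p_def by (intro continuous_intros)
  have "((\<lambda>t. cinner (w t) (p t)) has_integral (\<Sum>k\<in>K. cinner (fourier_coeff T w k) (x k))) {0..T}"
    unfolding p_def by (rule has_integral_cinner_trig_poly[OF w K])
  also have "(\<Sum>k\<in>K. cinner (fourier_coeff T w k) (x k)) = complex_of_real (s / T)"
    by (simp add: x_def cinner_scaleR_right cinner_self s_def sum_divide_distrib)
  finally have wp: "((\<lambda>t. cinner (w t) (p t)) has_integral complex_of_real (s / T)) {0..T}" .
  have "((\<lambda>t. cinner (p t) (p t)) has_integral (\<Sum>k\<in>K. cinner (fourier_coeff T p k) (x k))) {0..T}"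
    using has_integral_cinner_trig_poly[OF pc K, of "\<lambda>k. k" x] unfolding p_def by simp
  also have "(\<Sum>k\<in>K. cinner (fourier_coeff T p k) (x k)) = (\<Sum>k\<in>K. cinner (T *\<^sub>R x k) (x k))"
    unfolding p_def by (intro sum.cong refl) (simp only: fourier_coeff_trig_poly[OF T K])
  also have "\<dots> = complex_of_real (s / T)"
    using T by (simp add: x_def cinner_scaleR_left cinner_scaleR_right cinner_self s_def sum_divide_distrib)
  finally have pp: "((\<lambda>t. cinner (p t) (p t)) has_integral complex_of_real (s / T)) {0..T}" .
  have ww: "((\<lambda>t. (norm (w t))\<^sup>2) has_integral integral {0..T} (\<lambda>t. (norm (w t))\<^sup>2)) {0..T}"
    by (intro integrable_integral integrable_continuous_real continuous_intros w)
  have "((\<lambda>t. (norm (w t))\<^sup>2 - 2 * Re (cinner (w t) (p t)) + Re (cinner (p t) (p t))) has_integral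
     integral {0..T} (\<lambda>t. (norm (w t))\<^sup>2) - 2 * (s / T) + s / T) {0..T}"
    using has_integral_linear[OF wp bounded_linear_Re] has_integral_linear[OF pp bounded_linear_Re]
    by (intro has_integral_add has_integral_diff ww has_integral_mult_right) (simp_all add: o_def)
  moreover have "0 \<le> (norm (w t))\<^sup>2 - 2 * Re (cinner (w t) (p t)) + Re (cinner (p t) (p t))" for t
  proof -
    have "complex_of_real ((norm (w t + (- 1) *\<^sub>C p t))\<^sup>2) =
        cinner (w t) (w t) - cinner (w t) (p t) - cnj (cinner (w t) (p t)) + cinner (p t) (p t)"
      unfolding cinner_self[symmetric]
      by (simp add: cinner_add_left cinner_add_right cinner_scaleC_left cinner_scaleC_right
          cinner_commute[of "p t" "w t"])
    then have "(norm (w t + (- 1) *\<^sub>C p t))\<^sup>2 =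
        Re (cinner (w t) (w t) - cinner (w t) (p t) - cnj (cinner (w t) (p t)) + cinner (p t) (p t))"
      by (metis Re_complex_of_real)
    then show ?thesis
      by (smt (verit) zero_le_power2 cinner_self Re_complex_of_real complex_cnj cnj.sel(1) minus_complex.sel(1) plus_complex.sel(1))
  qed
  ultimately have "0 \<le> integral {0..T} (\<lambda>t. (norm (w t))\<^sup>2) - 2 * (s / T) + s / T"
    by (rule has_integral_nonneg)
  then show ?thesis
    using T by (simp add: s_def field_simps)
qed

section \<open>Fejer means and the converse of Bessel's inequality\<close>

lemma periodic_modulus:
  fixes w :: "real \<Rightarrow> 'h::real_normed_vector"
  assumes T: "0 < T" and w: "continuous_on {0..T} w" and per: "w 0 = w T" and e: "0 < e"
  obtains C where "0 \<le> C"
    "\<And>s t. s \<in> {0..T} \<Longrightarrow> t \<in> {0..T} \<Longrightarrow>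
      norm (w s - w t) \<le> e + C * (cmod (1 - fourier_exp T 1 (t - s)))\<^sup>2"
proof -
  \<comment> \<open>The pairs at which \<open>w\<close> varies too much form a compact set.
    \<open>D\<close> has no zero on it: \<open>D z = 0\<close> forces equal points or the two
    endpoints, which periodicity identifies. So \<open>D\<close> has a positive minimum
    \<open>d\<close> there, and \<open>2 * M / d\<close> times \<open>D\<close> dominates the
    oscillation.\<close>
  define K where "K = {z \<in> {0..T} \<times> {0..T}. e \<le> norm (w (fst z) - w (snd z))}"
  define D where "D z = (cmod (1 - fourier_exp T 1 (snd z - fst z)))\<^sup>2" for z :: "real \<times> real"
  have c1: "continuous_on ({0..T} \<times> {0..T}) (\<lambda>z. w (fst z))"
    by (rule continuous_on_compose2[OF w]) (auto intro!: continuous_intros)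
  have c2: "continuous_on ({0..T} \<times> {0..T}) (\<lambda>z. w (snd z))"
    by (rule continuous_on_compose2[OF w]) (auto intro!: continuous_intros)
  have "closed K" unfolding K_def
    by (intro continuous_closed_preimage_constant continuous_on_closed_Collect_le continuous_intros c1 c2
        closed_Times closed_atLeastAtMost)
  have "compact K"
  proof -
    have "K = ({0..T} \<times> {0..T}) \<inter> K" by (auto simp: K_def)
    then show ?thesis using \<open>closed K\<close>
      by (metis compact_Int_closed compact_Times compact_Icc)
  qed
  obtain M where M: "\<And>t. t \<in> {0..T} \<Longrightarrow> norm (w t) \<le> M"
    using bounded_on_Icc[OF w] by blast
  have M0: "0 \<le> M" using M[of 0] T by (smt (verit) atLeastAtMost_iff norm_ge_zero)
  have Dpos: "0 < D z" if "z \<in> K" for z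
  proof (rule ccontr)
    assume "\<not> 0 < D z"
    then have "cis (2 * pi * (snd z - fst z) / T) = 1" by (simp add: D_def)
    then have "cos (2 * pi * (snd z - fst z) / T) = 1" by (metis cis.sel(1) one_complex.sel(1))
    then obtain n :: int where "2 * pi * (snd z - fst z) / T = of_int n * 2 * pi"
      using cos_one_2pi_int by auto
    then have "2 * pi * (snd z - fst z) = 2 * pi * (of_int n * T)" using T by (simp add: field_simps)
    then have n: "snd z - fst z = of_int n * T" by (subst (asm) mult_cancel_left) simp
    have z: "fst z \<in> {0..T}" "snd z \<in> {0..T}" using that by (auto simp: K_def)
    then have "\<bar>of_int n * T\<bar> \<le> T" using n by auto
    then have "\<bar>real_of_int n\<bar> \<le> 1" using T by (simp add: abs_mult)
    then have "n = 0 \<or> n = 1 \<or> n = -1" by linarith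
    then have "fst z = snd z \<or> fst z = 0 \<and> snd z = T \<or> fst z = T \<and> snd z = 0"
      using n z by auto
    then have "w (fst z) = w (snd z)" using per by auto
    then show False using that e by (simp add: K_def)
  qed
  obtain d where d: "0 < d" "\<And>z. z \<in> K \<Longrightarrow> d \<le> D z"
  proof (cases "K = {}")
    case False
    have "continuous_on K D" unfolding D_def by (intro continuous_intros)
    then obtain z where "z \<in> K" "\<forall>y\<in>K. D z \<le> D y"
      using continuous_attains_inf[OF \<open>compact K\<close> False] by blast
    then show ?thesis using that[of "D z"] Dpos by auto
  qed (use that[of 1] in auto)
  show ?thesis
  proof (rule that[of "2 * M / d"])
    fix s t assume st: "s \<in> {0..T}" "t \<in> {0..T}"
    show "norm (w s - w t) \<le> e + 2 * M / d * (cmod (1 - fourier_exp T 1 (t - s)))\<^sup>2"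
    proof (cases "(s, t) \<in> K")
      case True
      have "norm (w s - w t) \<le> 2 * M" using M[OF st(1)] M[OF st(2)] by (smt (verit) norm_triangle_ineq4)
      also have "\<dots> \<le> 2 * M / d * D (s, t)"
        using d(1) d(2)[OF True] M0 by (simp add: field_simps mult_left_mono)
      finally show ?thesis using e by (simp add: D_def)
    next
      case False
      then have "norm (w s - w t) \<le> e" using st by (auto simp: K_def)
      moreover have "0 \<le> 2 * M / d * (cmod (1 - fourier_exp T 1 (t - s)))\<^sup>2" using M0 d(1) by simp
      ultimately show ?thesis by linarith
    qed
  qed (use M0 d in simp)
qed

lemma fejer_kernel:
  "(\<Sum>j\<le>N. \<Sum>l\<le>N. fourier_exp T (int j - int l) t) =
    complex_of_real ((cmod (\<Sum>j\<le>N. fourier_exp T (int j) t))\<^sup>2)"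
proof -
  have "(\<Sum>j\<le>N. \<Sum>l\<le>N. fourier_exp T (int j - int l) t) =
      (\<Sum>j\<le>N. \<Sum>l\<le>N. fourier_exp T (int j) t * cnj (fourier_exp T (int l) t))"
    by (simp add: cis_cnj cis_mult diff_divide_distrib algebra_simps)
  also have "\<dots> = (\<Sum>j\<le>N. fourier_exp T (int j) t) * cnj (\<Sum>j\<le>N. fourier_exp T (int j) t)"
    by (simp add: sum_product cnj_sum)
  finally show ?thesis by (simp only: complex_norm_square)
qed

lemma dirichlet_kernel_bound:
  "cmod (\<Sum>j\<le>N. fourier_exp T (int j) t) * cmod (1 - fourier_exp T 1 t) \<le> 2"
proof -
  have "fourier_exp T (int j) t = fourier_exp T 1 t ^ j" for j
    by (simp add: Complex.DeMoivre algebra_simps)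
  then have "(\<Sum>j\<le>N. fourier_exp T (int j) t) * (1 - fourier_exp T 1 t) = 1 - fourier_exp T 1 t ^ Suc N"
    using one_diff_power_eq'[of "fourier_exp T 1 t" "Suc N"]
    by (simp only: lessThan_Suc_atMost) (metis mult.commute one_diff_power_eq lessThan_Suc_atMost)
  moreover have "cmod (1 - fourier_exp T 1 t ^ Suc N) \<le> 2"
    using norm_triangle_ineq4[of 1 "fourier_exp T 1 t ^ Suc N"] by (simp add: norm_power norm_mult)
  ultimately show ?thesis by (metis norm_mult)
qed

text \<open>The Cesaro mean of the Fourier series: frequency k occurs N + 1 - |k| times in the
  double sum. The double form makes the kernel a squared modulus and lets
  \<open>parseval_upper\<close> treat one block of frequencies per index.\<close>

definition fejer_sum :: "real \<Rightarrow> (real \<Rightarrow> 'h::complex_hilbert_space) \<Rightarrow> nat \<Rightarrow> real \<Rightarrow> 'h"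
  where "fejer_sum T w N t =
    (1 / ((real N + 1) * T)) *\<^sub>R (\<Sum>j\<le>N. \<Sum>l\<le>N. fourier_exp T (int j - int l) t *\<^sub>C fourier_coeff T w (int j - int l))"

text \<open>The estimate of \<open>periodic_modulus\<close> is quadratic in \<open>1 - e\<^sub>1(t - s)\<close> because this factor,
  multiplied with the Fejer kernel, leaves a quantity bounded by 4 independently of \<open>N\<close>.\<close>

lemma fejer_sum_error:
  assumes T: "0 < T" and w: "continuous_on {0..T} (w :: real \<Rightarrow> 'h::complex_hilbert_space)"
    and C: "0 \<le> C" and t: "t \<in> {0..T}"
    and mod: "\<And>s. s \<in> {0..T} \<Longrightarrow> norm (w s - w t) \<le> e + C * (cmod (1 - fourier_exp T 1 (t - s)))\<^sup>2"
  shows "norm (fejer_sum T w N t - w t) \<le> e + 4 * C / (real N + 1)"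
proof -
  \<comment> \<open>\<open>G\<close> is the convolution kernel of \<open>fejer_sum\<close>:
    nonnegative, with integral \<open>(real N + 1) * T\<close>, so the error is an average of
    \<open>w s - w t\<close>.\<close>
  define G where "G s = (\<Sum>j\<le>N. \<Sum>l\<le>N. fourier_exp T (int j - int l) (t - s))" for s
  define D where "D s = cmod (\<Sum>j\<le>N. fourier_exp T (int j) (t - s))" for s
  have GD: "G s = complex_of_real ((D s)\<^sup>2)" for s
    unfolding G_def D_def by (rule fejer_kernel)
  have split: "fourier_exp T k (t - s) = fourier_exp T k t * fourier_exp T (- k) s" for k s
    by (simp add: cis_mult algebra_simps diff_divide_distrib)
  have Gw: "((\<lambda>s. G s *\<^sub>C w s) has_integral
     (\<Sum>j\<le>N. \<Sum>l\<le>N. fourier_exp T (int j - int l) t *\<^sub>C fourier_coeff T w (int j - int l))) {0..T}"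
    unfolding G_def bounded_bilinear.sum_left[OF bounded_bilinear_scaleC] split scaleC_scaleC[symmetric]
    using has_integral_linear[OF has_integral_fourier_coeff[OF w] bounded_linear_scaleC_right]
    unfolding o_def by (intro has_integral_sum finite_atMost)
  have "(G has_integral (\<Sum>j\<le>N. \<Sum>l\<le>N. fourier_exp T (int j - int l) t *
      (if - (int j - int l) = 0 then complex_of_real T else 0))) {0..T}"
    unfolding G_def split
    by (intro has_integral_sum has_integral_mult_right has_integral_fourier_exp T finite_atMost)
  also have "(\<Sum>j\<le>N. \<Sum>l\<le>N. fourier_exp T (int j - int l) t *
      (if - (int j - int l) = 0 then complex_of_real T else 0)) =
     (\<Sum>j\<le>N. \<Sum>l\<le>N. if l = j then complex_of_real T else 0)"
    by (intro sum.cong refl) auto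
  also have "\<dots> = complex_of_real ((real N + 1) * T)" by simp
  finally have G: "(G has_integral complex_of_real ((real N + 1) * T)) {0..T}" .
  have D2: "((\<lambda>s. (D s)\<^sup>2) has_integral (real N + 1) * T) {0..T}"
    using has_integral_linear[OF G bounded_linear_Re] by (simp add: o_def GD flip: of_real_power)
  have "((\<lambda>s. G s *\<^sub>C w t) has_integral complex_of_real ((real N + 1) * T) *\<^sub>C w t) {0..T}"
    using has_integral_linear[OF G bounded_linear_scaleC_left] by (simp add: o_def)
  from has_integral_diff[OF Gw this]
  have "((\<lambda>s. G s *\<^sub>C (w s - w t)) has_integral
      (\<Sum>j\<le>N. \<Sum>l\<le>N. fourier_exp T (int j - int l) t *\<^sub>C fourier_coeff T w (int j - int l))
      - ((real N + 1) * T) *\<^sub>R w t) {0..T}"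
    unfolding scaleR_scaleC[where 'a='h] bounded_bilinear.diff_right[OF bounded_bilinear_scaleC] .
  also have "(\<Sum>j\<le>N. \<Sum>l\<le>N. fourier_exp T (int j - int l) t *\<^sub>C fourier_coeff T w (int j - int l))
      = ((real N + 1) * T) *\<^sub>R fejer_sum T w N t"
    using T by (simp add: fejer_sum_def)
  finally have diff: "((\<lambda>s. G s *\<^sub>C (w s - w t)) has_integral
      ((real N + 1) * T) *\<^sub>R (fejer_sum T w N t - w t)) {0..T}"
    by (simp add: scaleR_diff_right)
  have bd: "((\<lambda>s. e * (D s)\<^sup>2 + 4 * C) has_integral (e * ((real N + 1) * T) + (T - 0) *\<^sub>R (4 * C))) {0..T}"
    using T has_integral_const_real[of "4 * C" 0 T]
    by (intro has_integral_add has_integral_mult_right D2) simp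
  have "norm (((real N + 1) * T) *\<^sub>R (fejer_sum T w N t - w t)) \<le> e * ((real N + 1) * T) + (T - 0) *\<^sub>R (4 * C)"
    unfolding integral_unique[OF diff, symmetric] integral_unique[OF bd, symmetric]
  proof (rule integral_norm_bound_integral)
    fix s assume s: "s \<in> {0..T}"
    have "norm (G s *\<^sub>C (w s - w t)) = (D s)\<^sup>2 * norm (w s - w t)"
      by (simp add: norm_scaleC GD norm_power)
    also have "\<dots> \<le> (D s)\<^sup>2 * (e + C * (cmod (1 - fourier_exp T 1 (t - s)))\<^sup>2)"
      by (intro mult_left_mono mod[OF s] zero_le_power2)
    also have "\<dots> = e * (D s)\<^sup>2 + C * (D s * cmod (1 - fourier_exp T 1 (t - s)))\<^sup>2"
      by (simp add: power_mult_distrib algebra_simps)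
    also have "(D s * cmod (1 - fourier_exp T 1 (t - s)))\<^sup>2 \<le> 2\<^sup>2"
      unfolding D_def by (intro power_mono dirichlet_kernel_bound) simp
    finally show "norm (G s *\<^sub>C (w s - w t)) \<le> e * (D s)\<^sup>2 + 4 * C"
      using mult_left_mono[OF _ C] by simp
  qed (use diff bd in blast)+
  then have "((real N + 1) * T) * norm (fejer_sum T w N t - w t) \<le> e * ((real N + 1) * T) + T * (4 * C)"
    using T by simp
  also have "\<dots> = ((real N + 1) * T) * (e + 4 * C / (real N + 1))"
  proof -
    have "real N + 1 \<noteq> 0" by linarith
    then show ?thesis by (simp add: field_simps)
  qed
  finally show ?thesis
    by (rule mult_left_le_imp_le) (use T in \<open>simp add: add_nonneg_pos\<close>)
qed

text \<open>Pairing \<open>w\<close> with its Fejer mean \<open>g\<close> turns the integral into an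
  average of sums of squared coefficients, each controlled by \<open>B\<close>; the uniform
  closeness of \<open>g\<close> to \<open>w\<close> makes the remainder small.\<close>

lemma parseval_upper:
  assumes T: "0 < T" and w: "continuous_on {0..T} (w :: real \<Rightarrow> 'h::complex_hilbert_space)"
    and per: "w 0 = w T"
    and B: "\<And>K. finite K \<Longrightarrow> (\<Sum>k\<in>K. (norm (fourier_coeff T w k))\<^sup>2) \<le> T * B"
  shows "integral {0..T} (\<lambda>t. (norm (w t))\<^sup>2) \<le> B"
proof -
  obtain M where M: "\<And>t. t \<in> {0..T} \<Longrightarrow> norm (w t) \<le> M"
    using bounded_on_Icc[OF w] by blast
  have M0: "0 \<le> M" using M[of 0] T by (smt (verit) atLeastAtMost_iff norm_ge_zero)
  have approx: "integral {0..T} (\<lambda>t. (norm (w t))\<^sup>2) \<le> B + M * (e + e) * T" if e: "0 < e" for e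
  proof -
    obtain C where C: "0 \<le> C" "\<And>s t. s \<in> {0..T} \<Longrightarrow> t \<in> {0..T} \<Longrightarrow>
      norm (w s - w t) \<le> e + C * (cmod (1 - fourier_exp T 1 (t - s)))\<^sup>2"
      using periodic_modulus[OF T w per e] by metis
    obtain N :: nat where "4 * C / e < N" using reals_Archimedean2 by blast
    then have N: "4 * C / (real N + 1) \<le> e" using e by (simp add: field_simps)
    define g where "g = fejer_sum T w N"
    have gw: "norm (g t - w t) \<le> e + e" if "t \<in> {0..T}" for t
      using fejer_sum_error[OF T w C(1) that C(2)[OF _ that], of N] N by (simp add: g_def)
    define I where "I = (\<Sum>j\<le>N. \<Sum>l\<le>N. (norm (fourier_coeff T w (int j - int l)))\<^sup>2)"
    \<comment> \<open>After the swap the frequencies \<open>int j - int l\<close> are distinct for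
      each fixed \<open>l\<close>, so the hypothesis applies once for each of the
      \<open>N + 1\<close> values of \<open>l\<close>.\<close>
    have "I = (\<Sum>l\<le>N. \<Sum>j\<le>N. (norm (fourier_coeff T w (int j - int l)))\<^sup>2)"
      unfolding I_def by (rule sum.swap)
    also have "\<dots> = (\<Sum>l\<le>N. \<Sum>k\<in>(\<lambda>j. int j - int l) ` {..N}. (norm (fourier_coeff T w k))\<^sup>2)"
      by (intro sum.cong refl, subst sum.reindex) (auto simp: inj_on_def)
    also have "\<dots> \<le> (\<Sum>l\<le>N. T * B)"
      by (intro sum_mono B) simp
    finally have I: "I \<le> (real N + 1) * T * B" by (simp add: mult.assoc add.commute)
    have "((\<lambda>t. cinner (w t) (g t)) has_integral
       complex_of_real (1 / ((real N + 1) * T)) * (\<Sum>j\<le>N. \<Sum>l\<le>N.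
         cinner (fourier_coeff T w (int j - int l)) (fourier_coeff T w (int j - int l)))) {0..T}"
      unfolding g_def fejer_sum_def cinner_scaleR_right bounded_bilinear.sum_right[OF bounded_bilinear_cinner]
      by (intro has_integral_mult_right has_integral_sum has_integral_cinner_fourier w finite_atMost)
    also have "complex_of_real (1 / ((real N + 1) * T)) * (\<Sum>j\<le>N. \<Sum>l\<le>N.
         cinner (fourier_coeff T w (int j - int l)) (fourier_coeff T w (int j - int l))) =
         complex_of_real (I / ((real N + 1) * T))"
      by (simp add: cinner_self I_def)
    finally have wg: "((\<lambda>t. Re (cinner (w t) (g t))) has_integral I / ((real N + 1) * T)) {0..T}"
      by (auto dest: has_integral_linear[OF _ bounded_linear_Re] simp: o_def simp del: of_real_divide)
    have bound: "((\<lambda>t. Re (cinner (w t) (g t)) + M * (e + e)) has_integral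
        I / ((real N + 1) * T) + (T - 0) *\<^sub>R (M * (e + e))) {0..T}"
      using T has_integral_const_real[of "M * (e + e)" 0 T]
      by (intro has_integral_add wg) simp
    have "integral {0..T} (\<lambda>t. (norm (w t))\<^sup>2) \<le> I / ((real N + 1) * T) + (T - 0) *\<^sub>R (M * (e + e))"
    proof (rule has_integral_le[OF integrable_integral bound])
      show "(\<lambda>t. (norm (w t))\<^sup>2) integrable_on {0..T}"
        by (intro integrable_continuous_real continuous_intros w)
      fix t assume t: "t \<in> {0..T}"
      have "complex_of_real ((norm (w t))\<^sup>2) = cinner (w t) (g t) - cinner (w t) (g t - w t)"
        by (simp add: cinner_self bounded_bilinear.diff_right[OF bounded_bilinear_cinner])
      then have "(norm (w t))\<^sup>2 = Re (cinner (w t) (g t)) - Re (cinner (w t) (g t - w t))"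
        by (metis Re_complex_of_real minus_complex.sel(1))
      moreover have "- Re (cinner (w t) (g t - w t)) \<le> norm (w t) * norm (g t - w t)"
        using cmod_cinner_le[of "w t" "g t - w t"] abs_Re_le_cmod[of "cinner (w t) (g t - w t)"] by linarith
      moreover have "norm (w t) * norm (g t - w t) \<le> M * (e + e)"
        by (intro mult_mono M gw t M0) simp
      ultimately show "(norm (w t))\<^sup>2 \<le> Re (cinner (w t) (g t)) + M * (e + e)" by simp
    qed
    also have "I / ((real N + 1) * T) \<le> B"
      using I T mult_pos_pos[of "real N + 1" T] by (simp add: pos_divide_le_eq mult.commute)
    finally show ?thesis by (simp add: mult.commute)
  qed
  show ?thesis
  proof (rule field_le_epsilon)
    fix d :: real assume d: "0 < d"
    \<comment> \<open>Sized to make the error at most \<open>d\<close>; \<open>M + 1\<close> in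
      place of \<open>M\<close> keeps the denominator positive.\<close>
    define e where "e = d / (2 * (M + 1) * T)"
    have e: "0 < e" using d M0 T by (simp add: e_def)
    have "M * (e + e) * T \<le> (M + 1) * (e + e) * T"
      using e T by (intro mult_right_mono) auto
    also have "\<dots> = 2 * (M + 1) * T * e" by (simp add: algebra_simps)
    also have "\<dots> = d" using M0 T by (simp add: e_def)
    finally show "integral {0..T} (\<lambda>t. (norm (w t))\<^sup>2) \<le> B + d"
      using approx[OF e] by linarith
  qed
qed

text \<open>Bessel is applied to \<open>f\<close> and its converse to \<open>w\<close>; it is the
  converse that asks for equal values at both ends.\<close>

lemma plancherel_inequality:
  fixes w f :: "real \<Rightarrow> 'h::complex_hilbert_space"
  assumes T: "0 < T" and w: "continuous_on {0..T} w" and f: "continuous_on {0..T} f"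
    and per: "w 0 = w T"
    and le: "\<And>k. norm (fourier_coeff T w k) \<le> C * norm (fourier_coeff T f k)"
  shows "integral {0..T} (\<lambda>t. (norm (w t))\<^sup>2) \<le> C\<^sup>2 * integral {0..T} (\<lambda>t. (norm (f t))\<^sup>2)"
proof (rule parseval_upper[OF T w per])
  fix K :: "int set" assume K: "finite K"
  have "(\<Sum>k\<in>K. (norm (fourier_coeff T w k))\<^sup>2) \<le> (\<Sum>k\<in>K. (C * norm (fourier_coeff T f k))\<^sup>2)"
    by (intro sum_mono power_mono le) simp
  also have "\<dots> = C\<^sup>2 * (\<Sum>k\<in>K. (norm (fourier_coeff T f k))\<^sup>2)"
    by (simp add: power_mult_distrib sum_distrib_left)
  also have "\<dots> \<le> C\<^sup>2 * (T * integral {0..T} (\<lambda>t. (norm (f t))\<^sup>2))"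
    by (intro mult_left_mono bessel_inequality[OF T f K]) simp
  finally show "(\<Sum>k\<in>K. (norm (fourier_coeff T w k))\<^sup>2) \<le> T * (C\<^sup>2 * integral {0..T} (\<lambda>t. (norm (f t))\<^sup>2))"
    by (simp add: algebra_simps)
qed

section \<open>The resolvent and Laplace integrals over orbits\<close>

definition laplace_int ::
    "(real \<Rightarrow> 'h::complex_hilbert_space \<Rightarrow> 'h) \<Rightarrow> real \<Rightarrow> 'h \<Rightarrow> complex \<Rightarrow> (real \<Rightarrow> real) \<Rightarrow> 'h"
  where "laplace_int S T v z g =
    integral {0..T} (\<lambda>s. exp (- z * complex_of_real s) *\<^sub>C (g s *\<^sub>R S s v))"

lemma C0_semigroupD:
  assumes "C0_semigroup S"
  shows "0 \<le> t \<Longrightarrow> bounded_clinear (S t)" "S 0 x = x"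
    "0 \<le> s \<Longrightarrow> 0 \<le> t \<Longrightarrow> S (s + t) x = S s (S t x)"
    "A \<subseteq> {0..} \<Longrightarrow> continuous_on A (\<lambda>t. S t x)"
  using assms unfolding C0_semigroup_def by (auto intro: continuous_on_subset)

text \<open>The generator is applied to a time average of the orbit, so no regularity of \<open>v\<close> is needed:
  translating the orbit amounts to translating \<open>\<phi>\<close>.\<close>

lemma laplace_int_generator:
  fixes S :: "real \<Rightarrow> 'h::complex_hilbert_space \<Rightarrow> 'h" and v :: 'h and z :: complex
  assumes S: "C0_semigroup S"
    and der: "\<And>s. (\<phi> has_real_derivative \<phi>' s) (at s)"
    and cont: "continuous_on UNIV \<phi>'"
    and left: "\<And>s. s \<le> 0 \<Longrightarrow> \<phi> s = 0" and right: "\<And>s. T \<le> s \<Longrightarrow> \<phi> s = 0" and T: "0 \<le> T"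
  defines "w \<equiv> laplace_int S (T + 1) v z \<phi>"
  defines "y \<equiv> z *\<^sub>C w - laplace_int S (T + 1) v z \<phi>'"
  shows "((\<lambda>h. (S h w - w) /\<^sub>R h) \<longlongrightarrow> y) (at_right 0)"
proof -
  have cont\<phi>: "continuous_on UNIV \<phi>"
    using der by (meson DERIV_isCont continuous_at_imp_continuous_on)
  note [continuous_intros] = continuous_on_compose2[OF cont\<phi>] continuous_on_compose2[OF cont]
  have Sc: "continuous_on A (\<lambda>t. S t x)" if "A \<subseteq> {0..}" for A x
    using C0_semigroupD(4)[OF S that] .
  \<comment> \<open>The integral with \<open>\<phi>\<close> delayed by \<open>h\<close>. The horizon
    \<open>T + 1\<close> contains the support of every such translate with
    \<open>h \<le> 1\<close>.\<close>
  define J where "J h = integral (cbox 0 (T + 1))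
      (\<lambda>s. exp (- z * complex_of_real s) *\<^sub>C (\<phi> (s - h) *\<^sub>R S s v))" for h
  have J0: "J 0 = w" by (simp add: J_def w_def laplace_int_def)
  have Sw: "S h w = exp (z * complex_of_real h) *\<^sub>C J h" if h: "0 \<le> h" "h \<le> 1" for h
  proof -
    define k where "k s = exp (- z * complex_of_real s) *\<^sub>C (\<phi> (s - h) *\<^sub>R S s v)" for s
    have kc: "continuous_on {h..T + h} k"
      unfolding k_def using h by (intro continuous_intros Sc) auto
    have k1: "(k has_integral integral {h..T + h} k) {h..T + h}"
      by (intro integrable_integral integrable_continuous_real kc)
    have k0: "k s = 0" if "s \<notin> {h..T + h}" for s
      using that left[of "s - h"] right[of "s - h"] by (auto simp: k_def)
    have "(k has_integral integral {h..T + h} k) {0..T + 1}"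
      by (rule has_integral_on_superset[OF k1]) (use k0 h in auto)
    then have Jk: "J h = integral {h..T + h} k"
      unfolding J_def k_def[symmetric] by (simp add: integral_unique)
    have "((\<lambda>s. k (s + h)) has_integral integral {h..T + h} k) {0..T}"
      using has_integral_shift_real_ivl[OF k1, of h] by simp
    then have "((\<lambda>s. k (s + h)) has_integral integral {h..T + h} k) {0..T + 1}"
      by (rule has_integral_on_superset) (use k0 h in auto)
    from has_integral_linear[OF this bounded_linear_scaleC_right]
    have "((\<lambda>s. exp (z * complex_of_real h) *\<^sub>C k (s + h)) has_integral
        exp (z * complex_of_real h) *\<^sub>C J h) {0..T + 1}"
      by (simp add: o_def Jk)
    moreover have "exp (z * complex_of_real h) *\<^sub>C k (s + h) =
        S h (exp (- z * complex_of_real s) *\<^sub>C (\<phi> s *\<^sub>R S s v))" if s: "s \<in> {0..T + 1}" for s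
    proof -
      have "S (s + h) v = S h (S s v)"
        using C0_semigroupD(3)[OF S, of h s v] h s by (simp add: add.commute)
      moreover have "exp (z * complex_of_real h) * exp (- z * complex_of_real (s + h)) = exp (- z * complex_of_real s)"
        by (simp add: mult_exp_exp algebra_simps)
      moreover have "bounded_clinear (S h)" using C0_semigroupD(1)[OF S] h by blast
      ultimately show ?thesis
        by (simp add: k_def scaleC_scaleC bounded_clinear_def linear_simps(5) del: of_real_add)
    qed
    ultimately have 1: "((\<lambda>s. S h (exp (- z * complex_of_real s) *\<^sub>C (\<phi> s *\<^sub>R S s v))) has_integral
        exp (z * complex_of_real h) *\<^sub>C J h) {0..T + 1}"
      by (rule has_integral_eq[rotated])
    have hw: "((\<lambda>s. exp (- z * complex_of_real s) *\<^sub>C (\<phi> s *\<^sub>R S s v)) has_integral w) {0..T + 1}"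
      unfolding w_def laplace_int_def
      by (intro integrable_integral integrable_continuous_real continuous_intros Sc) auto
    have "bounded_linear (S h)"
      using C0_semigroupD(1)[OF S] h by (auto simp: bounded_clinear_def)
    from has_integral_linear[OF hw this] have "((\<lambda>s. S h (exp (- z * complex_of_real s) *\<^sub>C (\<phi> s *\<^sub>R S s v))) has_integral S h w) {0..T + 1}"
      by (simp add: o_def)
    with 1 show ?thesis by (metis has_integral_unique)
  qed
  have "(J has_vector_derivative integral (cbox 0 (T + 1))
      (\<lambda>s. - (exp (- z * complex_of_real s) *\<^sub>C (\<phi>' (s - 0) *\<^sub>R S s v)))) (at 0 within {0..1})"
    unfolding J_def
  proof (rule leibniz_rule_vector_derivative)
    fix h s :: real
    have "((\<lambda>h. \<phi> (s - h)) has_real_derivative - \<phi>' (s - h)) (at h within {0..1})"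
      by (rule DERIV_chain2[OF der, of "\<lambda>h. s - h" "- 1" h "{0..1}", simplified])
        (auto intro!: derivative_eq_intros)
    from has_vector_derivative_scaleR[OF this has_vector_derivative_const[of "S s v"]]
    have "((\<lambda>h. \<phi> (s - h) *\<^sub>R S s v) has_vector_derivative - \<phi>' (s - h) *\<^sub>R S s v) (at h within {0..1})"
      by simp
    from bounded_linear.has_vector_derivative[OF bounded_linear_scaleC_right this]
    show "((\<lambda>h. exp (- z * complex_of_real s) *\<^sub>C \<phi> (s - h) *\<^sub>R S s v) has_vector_derivative
         - (exp (- z * complex_of_real s) *\<^sub>C \<phi>' (s - h) *\<^sub>R S s v)) (at h within {0..1})"
      by (simp add: bounded_bilinear.minus_right[OF bounded_bilinear_scaleC])
  next
    fix h :: real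
    show "(\<lambda>s. exp (- z * complex_of_real s) *\<^sub>C \<phi> (s - h) *\<^sub>R S s v) integrable_on cbox 0 (T + 1)"
      by (intro integrable_continuous continuous_intros Sc) auto
  next
    have "continuous_on ({0..1} \<times> cbox 0 (T + 1)) (\<lambda>p. S (snd p) v)"
      by (rule continuous_on_compose2[OF Sc[of "{0..}"]]) (auto intro!: continuous_intros)
    then show "continuous_on ({0..1} \<times> cbox 0 (T + 1))
        (\<lambda>(h, s). - (exp (- z * complex_of_real s) *\<^sub>C \<phi>' (s - h) *\<^sub>R S s v))"
      unfolding split_beta by (intro continuous_intros) auto
  qed auto
  also have "integral (cbox 0 (T + 1)) (\<lambda>s. - (exp (- z * complex_of_real s) *\<^sub>C (\<phi>' (s - 0) *\<^sub>R S s v)))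
      = - laplace_int S (T + 1) v z \<phi>'"
    by (simp add: laplace_int_def)
  finally have Jd: "(J has_vector_derivative - laplace_int S (T + 1) v z \<phi>') (at 0 within {0..1})" .
  have "((\<lambda>h. exp (z * complex_of_real h)) has_vector_derivative z) (at 0 within {0..1})"
  proof -
    have "((\<lambda>h. exp (z * h)) has_field_derivative z) (at (complex_of_real 0))"
      by (auto intro!: derivative_eq_intros)
    then show ?thesis by (rule has_vector_derivative_real_field)
  qed
  from bounded_bilinear.has_vector_derivative[OF bounded_bilinear_scaleC this Jd]
  have "((\<lambda>h. exp (z * complex_of_real h) *\<^sub>C J h) has_vector_derivative y) (at 0 within {0..1})"
    by (simp add: y_def J0)
  then have "((\<lambda>h. S h w) has_vector_derivative y) (at 0 within {0..1})"
    by (rule has_vector_derivative_transform[rotated 2]) (auto simp: Sw)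
  then have "((\<lambda>h. (1 / norm (h - 0)) *\<^sub>R (S h w - (S 0 w + (h - 0) *\<^sub>R y))) \<longlongrightarrow> 0) (at_right 0)"
    unfolding has_vector_derivative_def has_derivative_within by (simp add: at_within_Icc_at_right)
  then have "((\<lambda>h. (1 / norm (h - 0)) *\<^sub>R (S h w - (S 0 w + (h - 0) *\<^sub>R y)) + y) \<longlongrightarrow> 0 + y) (at_right 0)"
    by (intro tendsto_intros)
  moreover have "\<forall>\<^sub>F h in at_right 0. (1 / norm (h - 0)) *\<^sub>R (S h w - (S 0 w + (h - 0) *\<^sub>R y)) + y
      = (S h w - w) /\<^sub>R h"
    using eventually_at_right_less[of "0::real"]
    by eventually_elim (simp add: C0_semigroupD(2)[OF S] algebra_simps divide_inverse)
  ultimately have "((\<lambda>h. (S h w - w) /\<^sub>R h) \<longlongrightarrow> 0 + y) (at_right 0)"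
    by (rule Lim_transform_eventually)
  then show ?thesis by simp
qed

text \<open>Only the open half-plane is kept, because the supremum defining \<open>r\<close> runs
  over it.\<close>

locale resolvent_bounded =
  fixes S :: "real \<Rightarrow> 'h::complex_hilbert_space \<Rightarrow> 'h" and \<omega> r :: real
  assumes semigroup: "C0_semigroup S"
    and r_pos: "0 < r"
    and resolvent_mem: "\<omega> < Re z \<Longrightarrow> z \<in> resolvent_set (generator_dom S) (generator S)"
    and resolvent_le: "\<omega> < Re z \<Longrightarrow> onorm (resolvent (generator_dom S) (generator S) z) \<le> 1 / r"
begin

text \<open>By \<open>laplace_int_generator\<close>, z - A maps the integral of
  \<open>\<phi>\<close> to that of \<open>\<phi>'\<close>, so the former is the resolvent applied to
  the latter.\<close>

lemma norm_laplace_int_le: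
  assumes der: "\<And>s. (\<phi> has_real_derivative \<phi>' s) (at s)"
    and cont: "continuous_on UNIV \<phi>'"
    and left: "\<And>s. s \<le> 0 \<Longrightarrow> \<phi> s = 0" and right: "\<And>s. T \<le> s \<Longrightarrow> \<phi> s = 0" and T: "0 \<le> T"
    and z: "\<omega> < Re z"
  shows "norm (laplace_int S (T + 1) v z \<phi>) \<le> 1 / r * norm (laplace_int S (T + 1) v z \<phi>')"
proof -
  let ?w = "laplace_int S (T + 1) v z \<phi>" and ?f = "laplace_int S (T + 1) v z \<phi>'"
  let ?R = "resolvent (generator_dom S) (generator S) z"
  note lim = laplace_int_generator[OF semigroup der cont left right T, of v z]
  then have "?w \<in> generator_dom S" by (auto simp: generator_dom_def)
  moreover have "generator S ?w = z *\<^sub>C ?w - ?f"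
    unfolding generator_def using lim by (intro tendsto_Lim) auto
  ultimately have "?R ?f = ?w"
    using resolvent_mem[OF z] unfolding resolvent_def resolvent_set_def bij_betw_def
    by (intro inv_into_f_eq) auto
  moreover have "bounded_linear ?R"
    using resolvent_mem[OF z] by (simp add: resolvent_set_def bounded_clinear_def)
  ultimately have "norm ?w \<le> onorm ?R * norm ?f"
    using onorm[of ?R ?f] by simp
  also have "\<dots> \<le> 1 / r * norm ?f"
    by (intro mult_right_mono resolvent_le z) simp
  finally show ?thesis .
qed

text \<open>The Fourier coefficients on \<open>{0..T + 1}\<close> of the orbit multiplied by
  \<open>exp (- c * s) * \<phi> s\<close> are Laplace integrals at the points c + 2 pi i k / (T +
  1), so the resolvent bound compares them one by one with those for \<open>\<phi>'\<close>.\<close>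

lemma energy_inequality_C1:
  assumes der: "\<And>s. (\<phi> has_real_derivative \<phi>' s) (at s)"
    and cont: "continuous_on UNIV \<phi>'"
    and left: "\<And>s. s \<le> 0 \<Longrightarrow> \<phi> s = 0" and right: "\<And>s. T \<le> s \<Longrightarrow> \<phi> s = 0" and T: "0 \<le> T"
    and c: "\<omega> < c"
  shows "integral {0..T + 1} (\<lambda>s. exp (- 2 * c * s) * (\<phi> s)\<^sup>2 * (norm (S s v))\<^sup>2) \<le>
    integral {0..T + 1} (\<lambda>s. exp (- 2 * c * s) * (\<phi>' s)\<^sup>2 * (norm (S s v))\<^sup>2) / r\<^sup>2"
proof -
  have cont\<phi>: "continuous_on UNIV \<phi>"
    using der by (meson DERIV_isCont continuous_at_imp_continuous_on)
  note [continuous_intros] = continuous_on_compose2[OF cont\<phi>] continuous_on_compose2[OF cont]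
  have Sc: "continuous_on A (\<lambda>t. S t x)" if "A \<subseteq> {0..}" for A x
    using C0_semigroupD(4)[OF semigroup that] .
  let ?W = "\<lambda>g s. exp (- c * s) *\<^sub>R (g s *\<^sub>R S s v)"
  have coeff: "fourier_coeff (T + 1) (?W g) k = laplace_int S (T + 1) v (Complex c (2 * pi * k / (T + 1))) g"
    for g k
  proof -
    have "fourier_exp (T + 1) (- k) s * complex_of_real (exp (- c * s)) =
        exp (- Complex c (2 * pi * k / (T + 1)) * complex_of_real s)" for s
      by (simp add: cis_conv_exp mult_exp_exp exp_of_real[symmetric] Complex_eq algebra_simps)
    then have "fourier_exp (T + 1) (- k) s *\<^sub>C (exp (- c * s) *\<^sub>R x) =
        exp (- Complex c (2 * pi * k / (T + 1)) * complex_of_real s) *\<^sub>C x" for s and x :: 'h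
      unfolding scaleR_scaleC[of "exp (- c * s)"] scaleC_scaleC by simp
    then show ?thesis unfolding fourier_coeff_def laplace_int_def by (simp del: scaleR_scaleR)
  qed
  have "integral {0..T + 1} (\<lambda>s. (norm (?W \<phi> s))\<^sup>2) \<le> (1 / r)\<^sup>2 * integral {0..T + 1} (\<lambda>s. (norm (?W \<phi>' s))\<^sup>2)"
  proof (rule plancherel_inequality)
    show "continuous_on {0..T + 1} (?W \<phi>)" "continuous_on {0..T + 1} (?W \<phi>')"
      by (intro continuous_intros Sc; auto)+
    show "?W \<phi> 0 = ?W \<phi> (T + 1)" using left[of 0] right[of "T + 1"] by simp
    show "norm (fourier_coeff (T + 1) (?W \<phi>) k) \<le> 1 / r * norm (fourier_coeff (T + 1) (?W \<phi>') k)" for k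
      unfolding coeff by (rule norm_laplace_int_le[OF der cont left right T]) (use c in simp_all)
  qed (use T in simp)
  moreover have "(norm (?W g s))\<^sup>2 = exp (- 2 * c * s) * (g s)\<^sup>2 * (norm (S s v))\<^sup>2" for g s
    by (simp add: power_mult_distrib exp_double[symmetric] mult.assoc)
  ultimately show ?thesis by (simp add: power_divide)
qed

end

section \<open>Energy inequalities\<close>

lemma lipschitz_if_piecewise_deriv_bounded:
  fixes f :: "real \<Rightarrow> real"
  assumes cont: "continuous_on {a..b} f" and fin: "finite F"
    and der: "\<And>s. s \<in> {a<..<b} - F \<Longrightarrow> (f has_real_derivative f' s) (at s)"
    and bd: "\<And>s. s \<in> {a<..<b} - F \<Longrightarrow> \<bar>f' s\<bar> \<le> L" and L: "0 \<le> L" and ab: "a \<le> b"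
  shows "\<bar>f b - f a\<bar> \<le> L * (b - a)"
proof -
  have "(f' has_integral (f b - f a)) {a..b}"
    using der by (intro fundamental_theorem_of_calculus_interior_strong[OF fin ab _ cont])
      (auto simp: has_real_derivative_iff_has_vector_derivative)
  then have "norm (f b - f a) \<le> L * measure lborel {a..b}"
    by (rule has_integral_bound_real[OF L, of "insert a (insert b F)", rotated]) (use bd fin in auto)
  then show ?thesis using ab by simp
qed

context resolvent_bounded
begin

definition weight :: "real \<Rightarrow> 'h \<Rightarrow> real \<Rightarrow> real"
  where "weight c v s = exp (- 2 * c * s) * (norm (S s v))\<^sup>2"

lemma weight_nonneg [simp]: "0 \<le> weight c v s"
  by (simp add: weight_def)

lemma continuous_on_weight [continuous_intros]: "A \<subseteq> {0..} \<Longrightarrow> continuous_on A (weight c v)"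
  unfolding weight_def using C0_semigroupD(4)[OF semigroup, of A v] by (auto intro!: continuous_intros)

text \<open>Two limits are taken with the same \<open>e n\<close>: \<open>\<phi>\<close> is averaged
  over the interval of length \<open>e n\<close> to the left of \<open>s\<close>, which is C^1 with
  a difference quotient of \<open>\<phi>\<close> as derivative, and \<open>c\<close> is raised to
  \<open>c + e n\<close>, strictly above \<omega>. The horizon is \<open>T + 2\<close> because
  averaging widens the support to \<open>{0..T + 1}\<close> and \<open>energy_inequality_C1\<close>
  adds another unit.\<close>

lemma energy_inequality_compact:
  assumes cont: "continuous_on UNIV \<phi>" and fin: "finite F"
    and der: "\<And>s. s \<notin> F \<Longrightarrow> (\<phi> has_real_derivative \<phi>' s) (at s)"
    and bd: "\<And>s. s \<notin> F \<Longrightarrow> \<bar>\<phi>' s\<bar> \<le> L"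
    and left: "\<And>s. s \<le> 0 \<Longrightarrow> \<phi> s = 0" and right: "\<And>s. T \<le> s \<Longrightarrow> \<phi> s = 0" and T: "0 \<le> T"
    and c: "\<omega> \<le> c"
  shows "(\<lambda>s. (\<phi>' s)\<^sup>2 * weight c v s) integrable_on {0..T + 2}"
    and "integral {0..T + 2} (\<lambda>s. (\<phi> s)\<^sup>2 * weight c v s) \<le>
      integral {0..T + 2} (\<lambda>s. (\<phi>' s)\<^sup>2 * weight c v s) / r\<^sup>2"
proof -
  have L0: "0 \<le> L"
    using bd fin by (metis abs_ge_zero ex_new_if_finite infinite_UNIV_char_0 order_trans)
  have lip: "\<bar>\<phi> t - \<phi> s\<bar> \<le> L * (t - s)" if "s \<le> t" for s t
    by (rule lipschitz_if_piecewise_deriv_bounded[OF continuous_on_subset[OF cont] fin])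
      (use der bd L0 that in auto)
  have \<phi>_le: "\<bar>\<phi> s\<bar> \<le> L * T" for s
  proof -
    consider "s \<le> 0" | "0 \<le> s" "s \<le> T" | "T \<le> s" by linarith
    then show ?thesis
    proof cases
      case 2
      then have "\<bar>\<phi> s\<bar> \<le> L * s" using lip[of 0 s] left[of 0] by simp
      also have "\<dots> \<le> L * T" using 2 L0 by (simp add: mult_left_mono)
      finally show ?thesis .
    qed (use left right L0 T in auto)
  qed
  define X where "X s = integral {0..s} \<phi>" for s
  have Xd: "(X has_real_derivative \<phi> s) (at s)" for s
  proof -
    \<comment> \<open>Moving the base point to \<open>- R\<close> makes every \<open>s\<close>, in
      particular \<open>s \<le> 0\<close>, interior to an interval on which the primitive is an
      ordinary integral.\<close>
    define R where "R = \<bar>s\<bar> + 1"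
    have cR: "continuous_on A \<phi>" for A using cont continuous_on_subset by blast
    have XR: "integral {- R..t} \<phi> = X t" if "- R \<le> t" for t
    proof (cases "0 \<le> t")
      case True
      have "integral {- R..0} \<phi> = integral {- R..0} (\<lambda>_. 0)"
        by (rule integral_cong) (use left in auto)
      then have "integral {- R..0} \<phi> = 0" by simp
      then show ?thesis
        using integral_combine_Icc[of "- R" 0 t \<phi>] True integrable_continuous_real[OF cR]
        by (simp add: X_def R_def)
    next
      case False
      have "integral {- R..t} \<phi> = integral {- R..t} (\<lambda>_. 0)"
        by (rule integral_cong) (use left False in auto)
      then show ?thesis using False by (simp add: X_def)
    qed
    have "((\<lambda>t. integral {- R..t} \<phi>) has_real_derivative \<phi> s) (at s within {- R..R})"
      by (rule integral_has_real_derivative[OF cR]) (auto simp: R_def)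
    then have "((\<lambda>t. integral {- R..t} \<phi>) has_real_derivative \<phi> s) (at s)"
      by (subst (asm) at_within_interior) (auto simp: R_def)
    then show ?thesis
      by (rule has_field_derivative_transform_within_open[where S = "{- R<..<R}"]) (auto simp: XR, auto simp: R_def)
  qed
  define e where "e n = 1 / (real n + 1)" for n
  have e: "0 < e n" "e n \<le> 1" for n by (auto simp: e_def)
  have e0: "e \<longlonglongrightarrow> 0"
    unfolding e_def using LIMSEQ_inverse_real_of_nat by (simp add: inverse_eq_divide add.commute)
  define p where "p n s = (X s - X (s - e n)) / e n" for n s
  define q where "q n s = (\<phi> s - \<phi> (s - e n)) / e n" for n s
  have pd: "(p n has_real_derivative q n s) (at s)" for n s
  proof -
    have "((\<lambda>s. X (s - e n)) has_real_derivative \<phi> (s - e n)) (at s)"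
      using Xd[of "s - e n"] DERIV_shift[of X "\<phi> (s - e n)" s "- e n"] by simp
    from DERIV_cdivide[OF DERIV_diff[OF Xd this]] show ?thesis
      unfolding p_def q_def .
  qed
  have pz: "\<exists>z. s - e n < z \<and> z < s \<and> p n s = \<phi> z" for n s
    using MVT2[of "s - e n" s X \<phi>] Xd e[of n] by (auto simp: p_def)
  have p_near: "\<bar>\<phi> s - p n s\<bar> \<le> L * e n" for n s
  proof -
    obtain z where z: "s - e n < z" "z < s" "p n s = \<phi> z" using pz by blast
    then have "\<bar>\<phi> s - p n s\<bar> \<le> L * (s - z)" using lip[of z s] by simp
    also have "\<dots> \<le> L * e n" using z L0 by (intro mult_left_mono) auto
    finally show ?thesis .
  qed
  have p_le: "(p n s)\<^sup>2 \<le> (L * T)\<^sup>2" for n s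
  proof -
    have "\<bar>p n s\<bar> \<le> \<bar>L * T\<bar>" using pz[of s n] \<phi>_le L0 T by fastforce
    then show ?thesis by (simp only: abs_le_square_iff)
  qed
  have q_le: "(q n s)\<^sup>2 \<le> L\<^sup>2" for n s
  proof -
    have "\<bar>q n s\<bar> \<le> L"
      using lip[of "s - e n" s] e[of n] by (simp add: q_def field_simps)
    then show ?thesis using abs_le_square_iff[of "q n s" L] L0 by simp
  qed
  have qc: "continuous_on A (q n)" for n A
    unfolding q_def using e[of n] by (intro continuous_intros continuous_on_compose2[OF cont]) auto
  have pc: "continuous_on A (p n)" for n A
    using pd by (meson DERIV_isCont continuous_at_imp_continuous_on)
  have p_lim: "(\<lambda>n. p n s) \<longlonglongrightarrow> \<phi> s" for s
  proof -
    have "(\<lambda>n. L * e n) \<longlonglongrightarrow> 0" using tendsto_mult_right_zero[OF e0] .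
    then have "(\<lambda>n. p n s - \<phi> s) \<longlonglongrightarrow> 0"
      by (rule Lim_null_comparison[rotated]) (use p_near in \<open>auto simp: abs_minus_commute\<close>)
    then show ?thesis by (rule LIM_zero_cancel)
  qed
  have q_lim: "(\<lambda>n. q n s) \<longlonglongrightarrow> \<phi>' s" if "s \<notin> F" for s
  proof -
    have "((\<lambda>h. (\<phi> (s + h) - \<phi> s) / h) \<longlongrightarrow> \<phi>' s) (at 0)"
      using der[OF that] by (simp add: DERIV_def)
    moreover have "filterlim (\<lambda>n. - e n) (at 0) sequentially"
      using tendsto_minus[OF e0] e(1)[THEN less_imp_neq] by (auto simp: filterlim_at)
    ultimately have "(\<lambda>n. (\<phi> (s + - e n) - \<phi> s) / - e n) \<longlonglongrightarrow> \<phi>' s"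
      by (rule filterlim_compose)
    moreover have "(\<phi> (s + - e n) - \<phi> s) / - e n = q n s" for n
      using e(1)[of n] by (simp add: q_def field_simps)
    ultimately show ?thesis by simp
  qed
  define ww where "ww n s = weight (c + e n) v s" for n s
  have ww_le: "ww n s \<le> weight c v s" if "0 \<le> s" for n s
    using that e[of n] by (auto simp: ww_def weight_def algebra_simps intro!: mult_left_mono)
  have ww0: "0 \<le> ww n s" for n s by (simp add: ww_def weight_nonneg)
  have ww_lim: "(\<lambda>n. ww n s) \<longlonglongrightarrow> weight c v s" for s
  proof -
    have "(\<lambda>n. weight (c + e n) v s) \<longlonglongrightarrow> weight (c + 0) v s"
      unfolding weight_def by (intro tendsto_intros e0)
    then show ?thesis by (simp add: ww_def)
  qed
  have wwc: "continuous_on {0..T + 2} (ww n)" for n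
    unfolding ww_def by (intro continuous_on_weight) auto
  have ineq: "integral {0..T + 2} (\<lambda>s. (p n s)\<^sup>2 * ww n s) \<le> integral {0..T + 2} (\<lambda>s. (q n s)\<^sup>2 * ww n s) / r\<^sup>2" for n
  proof -
    have XT: "X t = X T" if "T \<le> t" for t
    proof -
      have "integral {T..t} \<phi> = integral {T..t} (\<lambda>_. 0)"
        by (rule integral_cong) (use right in auto)
      then have "integral {T..t} \<phi> = 0" by simp
      moreover have "\<phi> integrable_on {0..t}"
        using cont by (intro integrable_continuous_real) (rule continuous_on_subset, auto)
      ultimately show ?thesis using integral_combine_Icc[of 0 T t \<phi>] that T by (simp add: X_def)
    qed
    have pR: "p n s = 0" if "T + 1 \<le> s" for s
      using XT[of s] XT[of "s - e n"] that e[of n] by (simp add: p_def)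
    have "X s = 0" if "s \<le> 0" for s
      using that left[of 0] by (cases "s = 0") (auto simp: X_def)
    then have pL: "p n s = 0" if "s \<le> 0" for s
      using that e[of n] by (simp add: p_def)
    have "integral {0..(T + 1) + 1} (\<lambda>s. exp (- 2 * (c + e n) * s) * (p n s)\<^sup>2 * (norm (S s v))\<^sup>2) \<le>
        integral {0..(T + 1) + 1} (\<lambda>s. exp (- 2 * (c + e n) * s) * (q n s)\<^sup>2 * (norm (S s v))\<^sup>2) / r\<^sup>2"
      by (rule energy_inequality_C1[OF pd qc pL pR]) (use c e(1)[of n] T in linarith)+
    then show ?thesis unfolding ww_def weight_def by (simp add: mult_ac add.commute)
  qed
  have dom: "(\<lambda>s. K * weight c v s) integrable_on {0..T + 2}" for K
    by (intro integrable_continuous_real continuous_intros) auto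
  have p1: "(\<lambda>n. integral {0..T + 2} (\<lambda>s. (p n s)\<^sup>2 * ww n s)) \<longlonglongrightarrow> integral {0..T + 2} (\<lambda>s. (\<phi> s)\<^sup>2 * weight c v s)"
  proof (rule dominated_convergence(2)[OF _ dom])
    show "(\<lambda>s. (p n s)\<^sup>2 * ww n s) integrable_on {0..T + 2}" for n
      by (intro integrable_continuous_real continuous_intros pc wwc)
    show "norm ((p n s)\<^sup>2 * ww n s) \<le> (L * T)\<^sup>2 * weight c v s" if "s \<in> {0..T + 2}" for n s
    proof -
      have "(p n s)\<^sup>2 * ww n s \<le> (L * T)\<^sup>2 * weight c v s"
        using that by (intro mult_mono p_le ww_le ww0) auto
      then show ?thesis using ww0 by simp
    qed
    show "(\<lambda>n. (p n s)\<^sup>2 * ww n s) \<longlonglongrightarrow> (\<phi> s)\<^sup>2 * weight c v s" for s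
      by (intro tendsto_intros p_lim ww_lim)
  qed
  have qI: "(\<lambda>s. (q n s)\<^sup>2 * ww n s) integrable_on {0..T + 2}" for n
    by (intro integrable_continuous_real continuous_intros qc wwc)
  \<comment> \<open>On \<open>F\<close> the values of \<open>\<phi>'\<close> are arbitrary and need
    not be limits of \<open>q n\<close>; both integrands are set to 0 there before passing to the
    limit.\<close>
  let ?q = "\<lambda>n s. if s \<in> F then 0 else (q n s)\<^sup>2 * ww n s"
  let ?g = "\<lambda>s. if s \<in> F then 0 else (\<phi>' s)\<^sup>2 * weight c v s"
  have Q: "?q n integrable_on {0..T + 2}" for n
    using qI by (rule integrable_spike_finite[OF fin, rotated]) auto
  have Qd: "norm (?q n s) \<le> L\<^sup>2 * weight c v s" if "s \<in> {0..T + 2}" for n s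
  proof -
    have "(q n s)\<^sup>2 * ww n s \<le> L\<^sup>2 * weight c v s"
      using that by (intro mult_mono q_le ww_le ww0) auto
    moreover have "0 \<le> L\<^sup>2 * weight c v s" by (simp add: weight_nonneg)
    ultimately show ?thesis using ww0 by simp
  qed
  have Ql: "(\<lambda>n. ?q n s) \<longlonglongrightarrow> ?g s" for s
  proof (cases "s \<in> F")
    case False
    then show ?thesis by (simp add: tendsto_mult tendsto_power q_lim ww_lim)
  qed simp
  note dc = dominated_convergence[OF Q dom Qd Ql]
  have "?g integrable_on {0..T + 2}" using dc(1) by blast
  then show "(\<lambda>s. (\<phi>' s)\<^sup>2 * weight c v s) integrable_on {0..T + 2}"
    by (rule integrable_spike_finite[OF fin, rotated]) auto
  have "integral {0..T + 2} ?g = integral {0..T + 2} (\<lambda>s. (\<phi>' s)\<^sup>2 * weight c v s)"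
    by (rule integral_spike[OF negligible_finite[OF fin]]) auto
  moreover have "integral {0..T + 2} (?q n) = integral {0..T + 2} (\<lambda>s. (q n s)\<^sup>2 * ww n s)" for n
    by (rule integral_spike[OF negligible_finite[OF fin]]) auto
  ultimately have "(\<lambda>n. integral {0..T + 2} (\<lambda>s. (q n s)\<^sup>2 * ww n s)) \<longlonglongrightarrow>
      integral {0..T + 2} (\<lambda>s. (\<phi>' s)\<^sup>2 * weight c v s)"
    using dc(2) by simp
  then have "(\<lambda>n. integral {0..T + 2} (\<lambda>s. (q n s)\<^sup>2 * ww n s) / r\<^sup>2) \<longlonglongrightarrow>
      integral {0..T + 2} (\<lambda>s. (\<phi>' s)\<^sup>2 * weight c v s) / r\<^sup>2"
    using r_pos by (intro tendsto_intros) auto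
  then show "integral {0..T + 2} (\<lambda>s. (\<phi> s)\<^sup>2 * weight c v s) \<le>
      integral {0..T + 2} (\<lambda>s. (\<phi>' s)\<^sup>2 * weight c v s) / r\<^sup>2"
    by (rule LIMSEQ_le[OF p1]) (use ineq in auto)
qed

end

section \<open>Free endpoint and finiteness of the energy\<close>

context resolvent_bounded
begin

text \<open>Square integrability of the weighted orbit on the half-line, phrased by uniform bounds
  on bounded intervals so that no improper integral occurs.\<close>

definition energy_bounded :: "real \<Rightarrow> 'h \<Rightarrow> bool"
  where "energy_bounded c v \<longleftrightarrow> (\<exists>B. \<forall>T\<ge>0. integral {0..T} (weight c v) \<le> B)"

lemma weight_integrable: "0 \<le> a \<Longrightarrow> weight c v integrable_on {a..b}"
  by (intro integrable_continuous_real continuous_on_weight) auto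

text \<open>Finite energy allows a linear cutoff of arbitrarily small slope, so \<open>\<phi> T\<close> is free.\<close>

lemma energy_inequality_free_end:
  assumes cont: "continuous_on {0..T} \<phi>" and fin: "finite F"
    and der: "\<And>s. s \<in> {0<..<T} - F \<Longrightarrow> (\<phi> has_real_derivative \<phi>' s) (at s)"
    and bd: "\<And>s. s \<in> {0<..<T} - F \<Longrightarrow> \<bar>\<phi>' s\<bar> \<le> L"
    and zero: "\<phi> 0 = 0" and T: "0 < T" and c: "\<omega> \<le> c" and fe: "energy_bounded c v"
  shows "(\<lambda>s. (\<phi>' s)\<^sup>2 * weight c v s) integrable_on {0..T}"
    and "integral {0..T} (\<lambda>s. (\<phi> s)\<^sup>2 * weight c v s) \<le>
      integral {0..T} (\<lambda>s. (\<phi>' s)\<^sup>2 * weight c v s) / r\<^sup>2"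
proof -
  obtain B where B: "\<And>T. 0 \<le> T \<Longrightarrow> integral {0..T} (weight c v) \<le> B"
    using fe unfolding energy_bounded_def by blast
  define d where "d l s = (if s < 0 then 0 else if s \<le> T then \<phi>' s else if s < T + l then - \<phi> T / l else 0)"
    for l s :: real
  \<comment> \<open>The first factor freezes \<open>\<phi>\<close> at its end value beyond
    \<open>T\<close>; the second is the linear ramp down to 0 on \<open>{T..T + l}\<close>.\<close>
  define f where "f l s = \<phi> (max 0 (min s T)) * max 0 (min 1 (1 - (s - T) / l))" for l s :: real
  have main: "(\<lambda>s. (\<phi>' s)\<^sup>2 * weight c v s) integrable_on {0..T} \<and>
    integral {0..T} (\<lambda>s. (\<phi> s)\<^sup>2 * weight c v s) \<le>
      (integral {0..T} (\<lambda>s. (\<phi>' s)\<^sup>2 * weight c v s) + (\<phi> T / l)\<^sup>2 * B) / r\<^sup>2"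
    if l: "0 < l" for l
  proof -
    have f_mid: "f l s = \<phi> s" if "0 \<le> s" "s \<le> T" for s
      using that l by (simp add: f_def field_simps)
    have f_cut: "f l s = \<phi> T * (1 - (s - T) / l)" if "T \<le> s" "s \<le> T + l" for s
      using that l T by (simp add: f_def min_def max_def field_simps)
    have f_left: "f l s = 0" if "s \<le> 0" for s
      using that zero T by (simp add: f_def)
    have f_right: "f l s = 0" if "T + l \<le> s" for s
      using that l by (simp add: f_def max_def min_def field_simps)
    have fc: "continuous_on UNIV (f l)"
      unfolding f_def using T l by (intro continuous_intros continuous_on_compose2[OF cont]) auto
    let ?F = "insert 0 (insert T (insert (T + l) F))"
    have fd: "(f l has_real_derivative d l s) (at s)" if s: "s \<notin> ?F" for s
    proof -
      consider "s < 0" | "s \<in> {0<..<T}" | "s \<in> {T<..<T + l}" | "T + l < s"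
        using s by fastforce
      then show ?thesis
      proof cases
        case 1
        then have "d l s = 0" by (simp add: d_def)
        then show ?thesis
          using 1 by (auto intro!: has_field_derivative_transform_within_open[OF DERIV_const[of 0], where S = "{..<0}"]
              simp: f_left)
      next
        case 2
        then have "d l s = \<phi>' s" by (simp add: d_def)
        moreover have "(\<phi> has_real_derivative \<phi>' s) (at s)" using 2 s by (intro der) auto
        ultimately show ?thesis
          using 2 by (auto intro!: has_field_derivative_transform_within_open[where S = "{0<..<T}" and f = \<phi>]
              simp: f_mid)
      next
        case 3
        then have "d l s = - \<phi> T / l" using T by (simp add: d_def)
        moreover have "((\<lambda>s. \<phi> T * (1 - (s - T) / l)) has_real_derivative - \<phi> T / l) (at s)"
          using l by (auto intro!: derivative_eq_intros)
        ultimately show ?thesis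
          using 3 by (auto intro!: has_field_derivative_transform_within_open[where S = "{T<..<T + l}"
                and f = "\<lambda>s. \<phi> T * (1 - (s - T) / l)"] simp: f_cut)
      next
        case 4
        then have "d l s = 0" using T l by (simp add: d_def)
        then show ?thesis
          using 4 by (auto intro!: has_field_derivative_transform_within_open[OF DERIV_const[of 0], where S = "{T + l<..}"]
              simp: f_right)
      qed
    qed
    define k where "k = \<bar>\<phi> T / l\<bar>"
    define M where "M = max 0 L + k"
    have db: "\<bar>d l s\<bar> \<le> M" if s: "s \<notin> ?F" for s
    proof -
      have k: "0 \<le> k" "\<bar>- \<phi> T / l\<bar> = k" by (simp_all add: k_def)
      consider "d l s = 0" | "d l s = - \<phi> T / l" | "d l s = \<phi>' s" "s \<in> {0<..<T} - F"
        using s by (cases "s < 0"; cases "s \<le> T"; cases "s < T + l") (auto simp: d_def)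
      then show ?thesis
      proof cases
        case 3
        then show ?thesis using bd[of s] k unfolding M_def by linarith
      qed (use k in \<open>unfold M_def, linarith+\<close>)
    qed
    have fin': "finite ?F" using fin by simp
    let ?I = "\<lambda>s. (d l s)\<^sup>2 * weight c v s"
    have Tl: "0 \<le> T + l" using T l by simp
    note E = energy_inequality_compact[OF fc fin' fd db f_left f_right Tl c, where v = v]
    have I1: "?I integrable_on {0..T}" "?I integrable_on {T..T + l + 2}"
      using E(1) T l by (auto intro: integrable_on_subinterval)
    have eq: "?I s = (\<phi>' s)\<^sup>2 * weight c v s" if "s \<in> {0..T}" for s
      using that by (simp add: d_def)
    have int: "(\<lambda>s. (\<phi>' s)\<^sup>2 * weight c v s) integrable_on {0..T}"
      by (rule integrable_eq[OF I1(1) eq])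
    \<comment> \<open>At the single point \<open>T\<close> the function \<open>d l\<close> still
      carries the uncontrolled value \<open>\<phi>' T\<close>.\<close>
    let ?J = "\<lambda>s. if s = T then 0 else ?I s"
    have wI: "weight c v integrable_on {a..b}" if "0 \<le> a" for a b
      using weight_integrable[OF that] .
    have "integral {T..T + l + 2} ?I = integral {T..T + l + 2} ?J"
      by (rule integral_spike[of "{T}"]) auto
    also have "\<dots> \<le> integral {T..T + l + 2} (\<lambda>s. (\<phi> T / l)\<^sup>2 * weight c v s)"
    proof (rule integral_le)
      show "?J integrable_on {T..T + l + 2}"
        by (rule integrable_spike_finite[OF _ _ I1(2), of "{T}"]) auto
      show "(\<lambda>s. (\<phi> T / l)\<^sup>2 * weight c v s) integrable_on {T..T + l + 2}"
        using integrable_on_cmult_left[OF wI[of T "T + l + 2"], of "(\<phi> T / l)\<^sup>2"] T by simp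
      show "?J s \<le> (\<phi> T / l)\<^sup>2 * weight c v s" if "s \<in> {T..T + l + 2}" for s
        using that T l weight_nonneg[of c v s] by (auto simp: d_def power_divide)
    qed
    also have "\<dots> = (\<phi> T / l)\<^sup>2 * integral {T..T + l + 2} (weight c v)"
      by simp
    also have "integral {T..T + l + 2} (weight c v) \<le> integral {0..T + l + 2} (weight c v)"
      using T l by (intro integral_subset_le wI weight_nonneg) auto
    also have "\<dots> \<le> B" using B T l by simp
    finally have tail: "integral {T..T + l + 2} ?I \<le> (\<phi> T / l)\<^sup>2 * B"
      by (simp add: mult_left_mono)
    have "integral {0..T} (\<lambda>s. (\<phi> s)\<^sup>2 * weight c v s) = integral {0..T} (\<lambda>s. (f l s)\<^sup>2 * weight c v s)"
      by (rule integral_cong) (simp add: f_mid)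
    also have "\<dots> \<le> integral {0..T + l + 2} (\<lambda>s. (f l s)\<^sup>2 * weight c v s)"
      using l by (intro integral_subset_le integrable_continuous_real continuous_intros
          continuous_on_subset[OF fc] mult_nonneg_nonneg weight_nonneg) auto
    also have "\<dots> \<le> integral {0..T + l + 2} ?I / r\<^sup>2" by (rule E(2))
    also have "integral {0..T + l + 2} ?I = integral {0..T} ?I + integral {T..T + l + 2} ?I"
      using T l by (intro integral_combine_Icc[symmetric] E(1)) auto
    also have "integral {0..T} ?I = integral {0..T} (\<lambda>s. (\<phi>' s)\<^sup>2 * weight c v s)"
      by (rule integral_cong) (rule eq)
    finally have "integral {0..T} (\<lambda>s. (\<phi> s)\<^sup>2 * weight c v s) \<le>
      (integral {0..T} (\<lambda>s. (\<phi>' s)\<^sup>2 * weight c v s) + integral {T..T + l + 2} ?I) / r\<^sup>2" .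
    also have "\<dots> \<le> (integral {0..T} (\<lambda>s. (\<phi>' s)\<^sup>2 * weight c v s) + (\<phi> T / l)\<^sup>2 * B) / r\<^sup>2"
      using tail by (intro divide_right_mono) auto
    finally show ?thesis using int by simp
  qed
  show "(\<lambda>s. (\<phi>' s)\<^sup>2 * weight c v s) integrable_on {0..T}" using main[of 1] by simp
  let ?E = "integral {0..T} (\<lambda>s. (\<phi>' s)\<^sup>2 * weight c v s)"
  \<comment> \<open>The ramp length \<open>l = real (Suc n)\<close> tends to infinity, so the tail
    term disappears.\<close>
  have "(\<lambda>n. \<phi> T / real (Suc n)) \<longlonglongrightarrow> 0"
    using tendsto_mult_right_zero[OF LIMSEQ_inverse_real_of_nat] by (simp add: divide_inverse)
  then have "(\<lambda>n. (?E + (\<phi> T / real (Suc n))\<^sup>2 * B) / r\<^sup>2) \<longlonglongrightarrow> (?E + 0\<^sup>2 * B) / r\<^sup>2"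
    using r_pos by (intro tendsto_intros) auto
  then have "integral {0..T} (\<lambda>s. (\<phi> s)\<^sup>2 * weight c v s) \<le> (?E + 0\<^sup>2 * B) / r\<^sup>2"
    by (rule LIMSEQ_le_const) (use main in auto)
  then show "integral {0..T} (\<lambda>s. (\<phi> s)\<^sup>2 * weight c v s) \<le> ?E / r\<^sup>2" by simp
qed

text \<open>A bound on \<open>{0..1}\<close> and the semigroup law give growth at most
  \<open>exp C * exp (C * t)\<close>; for \<open>C + 1 \<le> c\<close> the weight then decays at
  least like \<open>exp (- 2 * t)\<close>.\<close>

lemma energy_bounded_large:
  assumes M: "\<And>t. t \<in> {0..1} \<Longrightarrow> onorm (S t) \<le> M"
  shows "\<exists>C. \<forall>c\<ge>C. energy_bounded c v"
proof -
  have blin: "bounded_linear (S t)" if "0 \<le> t" for t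
    using C0_semigroupD(1)[OF semigroup that] by (simp add: bounded_clinear_def)
  \<comment> \<open>The maximum with 1 makes \<open>C\<close> nonnegative, so
    \<open>exp (C * t)\<close> is at least 1 for \<open>t \<ge> 0\<close>.\<close>
  define C where "C = ln (max 1 M)"
  have C0: "0 \<le> C" by (simp add: C_def)
  have expC: "M \<le> exp C" by (simp add: C_def)
  have S1: "norm (S t x) \<le> exp C * norm x" if "t \<in> {0..1}" for t x
  proof -
    have "norm (S t x) \<le> onorm (S t) * norm x" using onorm[OF blin] that by simp
    also have "\<dots> \<le> exp C * norm x" using M[OF that] expC by (intro mult_right_mono) auto
    finally show ?thesis .
  qed
  have growth: "norm (S t v) \<le> exp C * (exp (C * t) * norm v)" if "0 \<le> t" "t \<le> real k" for t k
    using that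
  proof (induction k arbitrary: t)
    case 0
    then show ?case using S1[of t v] C0 by auto
  next
    case (Suc k)
    show ?case
    proof (cases "t \<le> 1")
      case True
      have "norm (S t v) \<le> exp C * norm v" using S1 True Suc by simp
      also have "\<dots> \<le> exp C * (exp (C * t) * norm v)"
        using C0 Suc.prems mult_right_mono[of 1 "exp (C * t)" "norm v"] by (intro mult_left_mono) auto
      finally show ?thesis .
    next
      case False
      have "S t v = S 1 (S (t - 1) v)"
        using C0_semigroupD(3)[OF semigroup, of 1 "t - 1" v] False by simp
      then have "norm (S t v) \<le> exp C * norm (S (t - 1) v)" using S1[of 1] by simp
      also have "\<dots> \<le> exp C * (exp C * (exp (C * (t - 1)) * norm v))"
        using Suc.IH[of "t - 1"] Suc.prems False by (intro mult_left_mono) auto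
      also have "exp C * (exp (C * (t - 1)) * norm v) = exp (C * t) * norm v"
        unfolding mult.assoc[symmetric] mult_exp_exp by (simp add: algebra_simps)
      finally show ?thesis .
    qed
  qed
  have "energy_bounded c v" if c: "C + 1 \<le> c" for c
    unfolding energy_bounded_def
  proof (intro exI allI impI)
    fix T :: real assume T: "0 \<le> T"
    define K where "K = (exp C * norm v)\<^sup>2"
    have K0: "0 \<le> K" by (simp add: K_def)
    have "((\<lambda>t. K * exp (- 2 * t)) has_integral (- K / 2 * exp (- 2 * T) - - K / 2 * exp (- 2 * 0))) {0..T}"
      by (rule fundamental_theorem_of_calculus[OF T])
        (auto intro!: derivative_eq_intros simp: has_real_derivative_iff_has_vector_derivative[symmetric])
    then have I: "((\<lambda>t. K * exp (- 2 * t)) has_integral (K / 2 - K / 2 * exp (- 2 * T))) {0..T}"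
      by simp
    have "integral {0..T} (weight c v) \<le> K / 2 - K / 2 * exp (- 2 * T)"
    proof (rule has_integral_le[OF integrable_integral I])
      show "weight c v integrable_on {0..T}" by (rule weight_integrable) simp
      fix t assume t: "t \<in> {0..T}"
      obtain k :: nat where "t \<le> real k" using real_arch_simple by blast
      then have "(norm (S t v))\<^sup>2 \<le> (exp C * (exp (C * t) * norm v))\<^sup>2"
        using growth t by (intro power_mono) auto
      also have "\<dots> = K * exp (2 * C * t)"
        by (simp add: K_def power_mult_distrib exp_double[symmetric] mult_ac)
      finally have "weight c v t \<le> exp (- 2 * c * t) * (K * exp (2 * C * t))"
        by (simp add: weight_def mult_left_mono)
      also have "\<dots> = K * exp (- (2 * (c - C)) * t)"
        by (simp add: mult_exp_exp algebra_simps)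
      also have "\<dots> \<le> K * exp (- 2 * t)"
        using c t K0 mult_right_mono[of "- (2 * (c - C))" "- 2" t] by (intro mult_left_mono) auto
      finally show "weight c v t \<le> K * exp (- 2 * t)" .
    qed
    also have "\<dots> \<le> K / 2" using K0 by simp
    finally show "integral {0..T} (weight c v) \<le> K / 2" .
  qed
  then show ?thesis by blast
qed

text \<open>An absorption argument. For s > 1 the test function is exp (r s / 2): its square lowers
  the exponent of the weight by r / 2, while f' = (r / 2) f makes the derivative side, after
  division by r^2, only a quarter of the same tail integral. The tail is thus at most a constant
  plus a quarter of itself, with a constant independent of \<open>T\<close>. The factor
  \<open>min s 1\<close> makes \<open>f\<close> vanish at 0.\<close>

lemma energy_bounded_step:
  assumes c: "\<omega> \<le> c" and fe: "energy_bounded c v"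
  shows "energy_bounded (c - r / 2) v"
proof -
  obtain B where B: "\<And>T. 0 \<le> T \<Longrightarrow> integral {0..T} (weight c v) \<le> B"
    using fe unfolding energy_bounded_def by blast
  have B0: "0 \<le> B" using B[of 0] by simp
  define f where "f s = min s 1 * exp (r * s / 2)" for s :: real
  define f' where "f' s = (if s \<le> 1 then exp (r * s / 2) + s * (r / 2 * exp (r * s / 2)) else r / 2 * exp (r * s / 2))"
    for s :: real
  define L where "L = exp (r / 2) + r / 2 * exp (r / 2)"
  have wexp: "weight (c - r / 2) v s = exp (r * s) * weight c v s" for s
  proof -
    have "exp (- 2 * (c - r / 2) * s) = exp (r * s) * exp (- 2 * c * s)"
      unfolding mult_exp_exp by (simp add: algebra_simps)
    then show ?thesis by (simp add: weight_def)
  qed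
  have wI: "weight c' v integrable_on {a..b}" if "0 \<le> a" for a b c'
    using weight_integrable[OF that] .
  have f'_small: "\<bar>f' s\<bar> \<le> L" if "s \<in> {0..1}" for s
  proof -
    define A where "A = exp (r * s / 2)"
    define D where "D = s * (r / 2 * exp (r * s / 2))"
    have "f' s = A + D" using that by (simp add: f'_def A_def D_def)
    moreover have "A \<le> exp (r / 2)" using that r_pos by (simp add: A_def)
    moreover have "D \<le> 1 * (r / 2 * exp (r / 2))"
      unfolding D_def using that r_pos by (intro mult_mono) auto
    moreover have "0 \<le> A" "0 \<le> D" using that r_pos by (simp_all add: A_def D_def)
    ultimately show ?thesis unfolding L_def by linarith
  qed
  have head: "integral {0..T} (weight (c - r / 2) v) \<le> exp r * B" if "0 \<le> T" "T \<le> 1" for T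
  proof -
    have "integral {0..T} (weight (c - r / 2) v) \<le> integral {0..T} (\<lambda>s. exp r * weight c v s)"
    proof (rule integral_le)
      show "(\<lambda>s. exp r * weight c v s) integrable_on {0..T}"
        by (intro integrable_continuous_real continuous_intros) auto
      show "weight (c - r / 2) v s \<le> exp r * weight c v s" if "s \<in> {0..T}" for s
        unfolding wexp using that \<open>T \<le> 1\<close> r_pos by (intro mult_right_mono weight_nonneg) auto
    qed (simp add: wI)
    also have "\<dots> \<le> exp r * B" using B that by simp
    finally show ?thesis .
  qed
  have tail: "integral {1..T} (weight (c - r / 2) v) \<le> 4 / 3 * (L\<^sup>2 * B / r\<^sup>2)" if T: "1 \<le> T" for T
  proof -
    have fc: "continuous_on {0..T} f" unfolding f_def by (intro continuous_intros) auto
    have fd: "(f has_real_derivative f' s) (at s)" if "s \<in> {0<..<T} - {1}" for s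
    proof (cases "s < 1")
      case True
      have "((\<lambda>s. s * exp (r * s / 2)) has_real_derivative f' s) (at s)"
        using True by (auto intro!: derivative_eq_intros simp: f'_def)
      then show ?thesis
        by (rule has_field_derivative_transform_within_open[where S = "{..<1}"]) (use True in \<open>auto simp: f_def\<close>)
    next
      case False
      then have s: "1 < s" using that by simp
      have "((\<lambda>s. exp (r * s / 2)) has_real_derivative f' s) (at s)"
        using s by (auto intro!: derivative_eq_intros simp: f'_def)
      then show ?thesis
        by (rule has_field_derivative_transform_within_open[where S = "{1<..}"]) (use s in \<open>auto simp: f_def\<close>)
    qed
    have fb: "\<bar>f' s\<bar> \<le> max L (r / 2 * exp (r * T / 2))" if "s \<in> {0<..<T} - {1}" for s
      using f'_small[of s] that r_pos by (auto simp: f'_def le_max_iff_disj)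
    have f0: "f 0 = 0" by (simp add: f_def)
    have T0: "0 < T" using T by simp
    have fin: "finite {1 :: real}" by simp
    note E = energy_inequality_free_end[OF fc fin fd fb f0 T0 c fe]
    let ?g = "\<lambda>s. (f s)\<^sup>2 * weight c v s" and ?h = "\<lambda>s. (f' s)\<^sup>2 * weight c v s"
    have hI: "?h integrable_on {0..T}" by (rule E(1))
    have gI: "?g integrable_on {0..T}"
      by (intro integrable_continuous_real continuous_intros fc) auto
    let ?w = "integral {1..T} (weight (c - r / 2) v)"
    have "?w = integral {1..T} ?g"
      by (rule integral_cong) (auto simp: f_def wexp exp_double[symmetric])
    also have "\<dots> \<le> integral {0..T} ?g"
      using T integrable_on_subinterval[OF gI] gI
      by (intro integral_subset_le mult_nonneg_nonneg weight_nonneg) auto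
    also have "\<dots> \<le> integral {0..T} ?h / r\<^sup>2" by (rule E(2))
    also have "integral {0..T} ?h = integral {0..1} ?h + integral {1..T} ?h"
      using T by (intro integral_combine_Icc[symmetric] hI) auto
    also have "integral {0..1} ?h \<le> integral {0..1} (\<lambda>s. L\<^sup>2 * weight c v s)"
    proof (rule integral_le)
      show "?h integrable_on {0..1}" using integrable_on_subinterval[OF hI] T by auto
      show "(\<lambda>s. L\<^sup>2 * weight c v s) integrable_on {0..1}"
        by (intro integrable_continuous_real continuous_intros) auto
      show "?h s \<le> L\<^sup>2 * weight c v s" if "s \<in> {0..1}" for s
        using f'_small[OF that] by (intro mult_right_mono weight_nonneg) (metis abs_le_square_iff abs_of_nonneg abs_ge_zero order_trans)
    qed
    also have "integral {1..T} ?h = integral {1..T} (\<lambda>s. r\<^sup>2 / 4 * weight (c - r / 2) v s)"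
      by (rule integral_spike[of "{1}"])
        (auto simp: f'_def wexp power_mult_distrib exp_double[symmetric] power_divide)
    finally have "?w \<le> (integral {0..1} (\<lambda>s. L\<^sup>2 * weight c v s) + integral {1..T} (\<lambda>s. r\<^sup>2 / 4 * weight (c - r / 2) v s)) / r\<^sup>2"
      using r_pos by (simp add: divide_right_mono)
    also have "\<dots> = L\<^sup>2 * integral {0..1} (weight c v) / r\<^sup>2 + ?w / 4"
      using r_pos by (simp add: field_simps)
    also have "L\<^sup>2 * integral {0..1} (weight c v) / r\<^sup>2 \<le> L\<^sup>2 * B / r\<^sup>2"
      using B[of 1] by (intro divide_right_mono mult_left_mono) auto
    finally have "?w \<le> L\<^sup>2 * B / r\<^sup>2 + ?w / 4" by simp
    \<comment> \<open>Solving for the tail; the origin of 4 / 3.\<close>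
    moreover have "x \<le> 4 / 3 * y" if "x \<le> y + x / 4" for x y :: real
      using that by simp
    ultimately show ?thesis by blast
  qed
  show ?thesis
    unfolding energy_bounded_def
  proof (intro exI allI impI)
    fix T :: real assume T: "0 \<le> T"
    have tail0: "0 \<le> 4 / 3 * (L\<^sup>2 * B / r\<^sup>2)" using B0 by simp
    show "integral {0..T} (weight (c - r / 2) v) \<le> exp r * B + 4 / 3 * (L\<^sup>2 * B / r\<^sup>2)"
    proof (cases "T \<le> 1")
      case True
      then show ?thesis using head[OF T] tail0 by linarith
    next
      case False
      then have "integral {0..T} (weight (c - r / 2) v) =
          integral {0..1} (weight (c - r / 2) v) + integral {1..T} (weight (c - r / 2) v)"
        by (intro integral_combine_Icc[symmetric] wI) auto
      then show ?thesis using head[of 1] tail[of T] False by simp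
    qed
  qed
qed

text \<open>Stepping the exponent down by \<open>r / 2\<close> replaces an appeal to the Gearhart-Pruess theorem.\<close>

lemma energy_bounded_omega:
  assumes M: "\<And>t. t \<in> {0..1} \<Longrightarrow> onorm (S t) \<le> M"
  shows "energy_bounded \<omega> v"
proof -
  obtain C where C: "\<And>c. C \<le> c \<Longrightarrow> energy_bounded c v"
    using energy_bounded_large[OF M] by blast
  \<comment> \<open>The exponents descend along \<omega> + k r / 2: each step starts at or above
    \<omega>, as \<open>energy_bounded_step\<close> requires, and the last one lands on
    \<omega>.\<close>
  have step: "energy_bounded (\<omega> + real k * (r / 2)) v \<Longrightarrow> energy_bounded \<omega> v" for k
  proof (induction k)
    case (Suc k)
    have "\<omega> \<le> \<omega> + real (Suc k) * (r / 2)" using r_pos by simp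
    from energy_bounded_step[OF this Suc.prems] show ?case
      by (intro Suc.IH) (simp add: algebra_simps add_divide_distrib)
  qed simp
  obtain k :: nat where "C - \<omega> < real k * (r / 2)"
    by (metis half_gt_zero r_pos reals_Archimedean3)
  then show ?thesis by (intro step[of k] C) simp
qed

end

section \<open>The semigroup estimate\<close>

context resolvent_bounded
begin

text \<open>The test function solves the Euler-Lagrange equations on the outer intervals and
  satisfies \<open>\<phi>' = r \<phi>\<close>, hence contributes nothing, in between.\<close>

lemma semigroup_estimate:
  assumes growth: "\<And>t x. 0 \<le> t \<Longrightarrow> norm (S t x) \<le> m t * norm x"
    and n_pos: "\<And>s. 0 \<le> s \<Longrightarrow> 0 < n s" and n_cont: "continuous_on {0..} n"
    and n_def: "\<And>s. n s = exp (- \<omega> * s) * m s"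
    and u_cont: "continuous_on {0..} u" and p_cont: "continuous_on {0..} p"
    and u_der: "\<And>s. 0 < s \<Longrightarrow> (u has_real_derivative r * p s / (n s)\<^sup>2) (at s)"
    and p_der: "\<And>s. 0 < s \<Longrightarrow> (p has_real_derivative - r * (n s)\<^sup>2 * u s) (at s)"
    and u0: "u 0 = 0"
    and a: "0 < a" "0 < u a" "\<And>s. s \<in> {0..a} \<Longrightarrow> 0 \<le> u s \<and> (n s)\<^sup>2 * u s \<le> p s"
    and b: "0 < b" "0 < u b" "\<And>s. s \<in> {0..b} \<Longrightarrow> 0 \<le> u s \<and> (n s)\<^sup>2 * u s \<le> p s"
    and t: "a + b < t" and fe: "energy_bounded \<omega> v"
  shows "(norm (S t v))\<^sup>2 \<le>
    exp (2 * \<omega> * t) * exp (- 2 * r * (t - (a + b))) * (p a / u a) * (p b / u b) * (norm v)\<^sup>2"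
proof -
  let ?G = "weight \<omega> v"
  have pb: "0 < p b"
  proof -
    have "0 < (n b)\<^sup>2 * u b" using b n_pos[of b] by simp
    then show ?thesis using b(3)[of b] b(1) by simp
  qed
  define K where "K = exp (r * (t - b - a))"
  \<comment> \<open>On the last interval the available lower bound on the weight is proportional to
    1 / n^2 in reversed time. For that weight the Euler-Lagrange equation is solved by
    \<open>p\<close>, whose derivative vanishes at 0, the natural condition at the free end
    \<open>t\<close>. \<open>K\<close> matches the values at \<open>t - b\<close>.\<close>
  define f where "f s = (if s \<le> a then u s / u a else if s \<le> t - b then exp (r * (s - a)) else K * p (t - s) / p b)" for s
  define f' where "f' s = (if s \<le> a then r * p s / ((n s)\<^sup>2 * u a) else if s \<le> t - b then r * exp (r * (s - a))
      else K * (r * (n (t - s))\<^sup>2 * u (t - s)) / p b)" for s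
  have cu: "continuous_on A (\<lambda>s. u (g s))" if "continuous_on A g" "g ` A \<subseteq> {0..}" for A g
    using continuous_on_compose2[OF u_cont that] .
  have cp: "continuous_on A (\<lambda>s. p (g s))" if "continuous_on A g" "g ` A \<subseteq> {0..}" for A g
    using continuous_on_compose2[OF p_cont that] .
  have cn: "continuous_on A (\<lambda>s. n (g s))" if "continuous_on A g" "g ` A \<subseteq> {0..}" for A g
    using continuous_on_compose2[OF n_cont that] .
  have f_cont: "continuous_on {0..t} f"
    unfolding f_def
  proof (intro continuous_on_cases_le)
    show "continuous_on {s \<in> {0..t}. s \<le> a} (\<lambda>s. u s / u a)"
      using a by (intro continuous_intros cu) auto
    show "continuous_on {x \<in> {s \<in> {0..t}. a \<le> s}. t - b \<le> x} (\<lambda>s. K * p (t - s) / p b)"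
      using pb by (intro continuous_intros cp) auto
  qed (use a b t pb in \<open>auto intro!: continuous_intros simp: K_def\<close>)
  have f_der: "(f has_real_derivative f' s) (at s)" if s: "s \<in> {0<..<t} - {a, t - b}" for s
  proof -
    consider "s \<in> {0<..<a}" | "s \<in> {a<..<t - b}" | "s \<in> {t - b<..<t}" using s by fastforce
    then show ?thesis
    proof cases
      case 1
      then have "((\<lambda>s. u s / u a) has_real_derivative f' s) (at s)"
        using DERIV_cdivide[OF u_der[of s], of "u a"] by (simp add: f'_def)
      then show ?thesis
        by (rule has_field_derivative_transform_within_open[where S = "{0<..<a}"]) (use 1 in \<open>auto simp: f_def\<close>)
    next
      case 2
      then have "((\<lambda>s. exp (r * (s - a))) has_real_derivative f' s) (at s)"
        by (auto intro!: derivative_eq_intros simp: f'_def)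
      then show ?thesis
        by (rule has_field_derivative_transform_within_open[where S = "{a<..<t - b}"]) (use 2 in \<open>auto simp: f_def\<close>)
    next
      case 3
      have "((\<lambda>s. t - s) has_real_derivative - 1) (at s)"
        by (auto intro!: derivative_eq_intros)
      moreover have "(p has_real_derivative - r * (n (t - s))\<^sup>2 * u (t - s)) (at (t - s))"
        using 3 by (intro p_der) simp
      ultimately have "((\<lambda>s. p (t - s)) has_real_derivative - (- r * (n (t - s))\<^sup>2 * u (t - s))) (at s)"
        using DERIV_chain2[where f = p and g = "\<lambda>s. t - s" and Db = "- 1"] by fastforce
      from DERIV_cdivide[OF DERIV_cmult[OF this, of K], of "p b"]
      have "((\<lambda>s. K * p (t - s) / p b) has_real_derivative f' s) (at s)"
        using 3 t a by (simp add: f'_def)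
      then show ?thesis
        by (rule has_field_derivative_transform_within_open[where S = "{t - b<..<t}"])
          (use 3 a t in \<open>auto simp: f_def\<close>)
    qed
  qed
  obtain M1 where M1: "\<And>s. s \<in> {0..a} \<Longrightarrow> \<bar>r * p s / ((n s)\<^sup>2 * u a)\<bar> \<le> M1"
  proof -
    have "continuous_on {0..a} (\<lambda>s. r * p s / ((n s)\<^sup>2 * u a))"
      using a n_pos by (intro continuous_intros cp cn) (auto simp: less_imp_neq[symmetric])
    from bounded_on_Icc[OF this] show ?thesis using that by (metis real_norm_def)
  qed
  obtain M2 where M2: "\<And>s. s \<in> {a..t - b} \<Longrightarrow> \<bar>r * exp (r * (s - a))\<bar> \<le> M2"
  proof -
    have "continuous_on {a..t - b} (\<lambda>s. r * exp (r * (s - a)))" by (intro continuous_intros)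
    from bounded_on_Icc[OF this] show ?thesis using that by (metis real_norm_def)
  qed
  obtain M3 where M3: "\<And>s. s \<in> {t - b..t} \<Longrightarrow> \<bar>K * (r * (n (t - s))\<^sup>2 * u (t - s)) / p b\<bar> \<le> M3"
  proof -
    have "continuous_on {t - b..t} (\<lambda>s. K * (r * (n (t - s))\<^sup>2 * u (t - s)) / p b)"
      using pb by (intro continuous_intros cu cn) auto
    from bounded_on_Icc[OF this] show ?thesis using that by (metis real_norm_def)
  qed
  have f_bd: "\<bar>f' s\<bar> \<le> max M1 (max M2 M3)" if "s \<in> {0<..<t} - {a, t - b}" for s
    using M1[of s] M2[of s] M3[of s] that by (auto simp: f'_def le_max_iff_disj)
  have f0: "f 0 = 0" using a u0 by (simp add: f_def)
  have t0: "0 < t" using a b t by simp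
  have fin: "finite {a, t - b}" by simp
  note E = energy_inequality_free_end[OF f_cont fin f_der f_bd f0 t0 order_refl fe]
  define w where "w s = ((f' s)\<^sup>2 / r\<^sup>2 - (f s)\<^sup>2) * ?G s" for s
  have w1: "(\<lambda>s. (f' s)\<^sup>2 * ?G s / r\<^sup>2) integrable_on {0..t}"
    using integrable_on_cmult_right[OF E(1), of "inverse (r\<^sup>2)"] by (simp add: divide_inverse)
  have w2: "(\<lambda>s. (f s)\<^sup>2 * ?G s) integrable_on {0..t}"
    by (intro integrable_continuous_real continuous_intros f_cont) auto
  have w_eq: "w = (\<lambda>s. (f' s)\<^sup>2 * ?G s / r\<^sup>2 - (f s)\<^sup>2 * ?G s)"
    by (auto simp: w_def algebra_simps)
  have w_int: "w integrable_on {0..t}"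
    unfolding w_eq by (intro integrable_diff w1 w2)
  have w_nonneg: "0 \<le> integral {0..t} w"
    using E(2) by (simp add: w_eq integral_diff[OF w1 w2])
  have split: "integral {0..t} w = integral {0..a} w + integral {a..t - b} w + integral {t - b..t} w"
  proof -
    have "integral {0..t} w = integral {0..a} w + integral {a..t} w"
      using a b t by (intro integral_combine_Icc[symmetric] w_int) auto
    moreover have "integral {a..t} w = integral {a..t - b} w + integral {t - b..t} w"
      using a b t by (intro integral_combine_Icc[symmetric]
          integrable_on_subinterval[OF w_int]) auto
    ultimately show ?thesis by simp
  qed
  \<comment> \<open>This is 1 / r times the derivative of \<open>p * u\<close>, so the costs of both
    outer intervals reduce to boundary values.\<close>
  let ?h = "\<lambda>s. (p s)\<^sup>2 / (n s)\<^sup>2 - (n s)\<^sup>2 * (u s)\<^sup>2"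
  have pu_der: "((\<lambda>s. p s * u s) has_real_derivative r * ?h s) (at s)" if "0 < s" for s
    using DERIV_mult[OF p_der[OF that] u_der[OF that]]
    by (simp add: algebra_simps power2_eq_square)
  have h_int: "(?h has_integral p c * u c / r) {0..c}" if c: "0 < c" for c
  proof -
    have "((\<lambda>s. r * ?h s) has_integral p c * u c - p 0 * u 0) {0..c}"
      using c by (intro fundamental_theorem_of_calculus_interior)
        (auto intro!: continuous_intros cp cu pu_der simp: has_real_derivative_iff_has_vector_derivative[symmetric])
    from has_integral_mult_right[OF this, of "1 / r"]
    have "((\<lambda>s. 1 / r * (r * ?h s)) has_integral 1 / r * (p c * u c - p 0 * u 0)) {0..c}" .
    moreover have "(\<lambda>s. 1 / r * (r * ?h s)) = ?h" "1 / r * (p c * u c - p 0 * u 0) = p c * u c / r"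
      using r_pos u0 by auto
    ultimately show ?thesis by (simp only:)
  qed
  have int1: "integral {0..a} w \<le> (norm v)\<^sup>2 / (u a)\<^sup>2 * (p a * u a / r)"
  proof (rule has_integral_le[OF integrable_integral has_integral_mult_right[OF h_int[OF a(1)]]])
    show "w integrable_on {0..a}" using integrable_on_subinterval[OF w_int] a b t by auto
    fix s assume s: "s \<in> {0..a}"
    have ns: "0 < n s" using n_pos s by simp
    have G: "?G s \<le> (n s)\<^sup>2 * (norm v)\<^sup>2"
    proof -
      have "(norm (S s v))\<^sup>2 \<le> (m s * norm v)\<^sup>2" using growth s by (intro power_mono) auto
      then have "?G s \<le> exp (- 2 * \<omega> * s) * (m s * norm v)\<^sup>2"
        unfolding weight_def by (intro mult_left_mono) auto
      also have "\<dots> = (n s)\<^sup>2 * (norm v)\<^sup>2"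
        by (simp add: n_def power_mult_distrib exp_double[symmetric] mult_ac)
      finally show ?thesis .
    qed
    have "(f' s)\<^sup>2 / r\<^sup>2 - (f s)\<^sup>2 = ((p s)\<^sup>2 - ((n s)\<^sup>2 * u s)\<^sup>2) / ((n s)\<^sup>2 * u a)\<^sup>2"
      using s r_pos ns a by (simp add: f_def f'_def field_simps)
    \<comment> \<open>The upper bound on the weight may be inserted only where f'^2 / r^2 - f^2 is
      nonnegative. This is the inequality between \<open>p\<close> and \<open>n\<^sup>2 * u\<close>,
      the restriction on the length \<open>a\<close>.\<close>
    moreover have "0 \<le> (p s)\<^sup>2 - ((n s)\<^sup>2 * u s)\<^sup>2"
      using a(3)[OF s] ns by (simp add: power_mono)
    ultimately have "w s \<le> ((p s)\<^sup>2 - ((n s)\<^sup>2 * u s)\<^sup>2) / ((n s)\<^sup>2 * u a)\<^sup>2 * ((n s)\<^sup>2 * (norm v)\<^sup>2)"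
      unfolding w_def using G by (intro mult_mono) auto
    also have "\<dots> = (norm v)\<^sup>2 / (u a)\<^sup>2 * ?h s"
      using ns a by (simp add: field_simps power2_eq_square)
    finally show "w s \<le> (norm v)\<^sup>2 / (u a)\<^sup>2 * ?h s" .
  qed
  have int2: "integral {a..t - b} w = 0"
  proof -
    have "integral {a..t - b} w = integral {a..t - b} (\<lambda>_. 0)"
      using r_pos by (intro integral_spike[of "{a}"]) (auto simp: w_def f_def f'_def power_mult_distrib)
    then show ?thesis by simp
  qed
  define N where "N = exp (- 2 * \<omega> * t) * (norm (S t v))\<^sup>2"
  have int3: "integral {t - b..t} w \<le> - (K\<^sup>2 * N / (p b)\<^sup>2) * (p b * u b / r)"
  proof -
    \<comment> \<open>At \<open>t - b\<close> the function \<open>f'\<close> still follows the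
      middle branch, so the integrand is redefined at that one point.\<close>
    let ?w = "\<lambda>s. if s = t - b then - (K\<^sup>2 * N / (p b)\<^sup>2) * ?h (t - s) else w s"
    have wI: "w integrable_on {t - b..t}" using integrable_on_subinterval[OF w_int] a b t by auto
    have "integral {t - b..t} w = integral {t - b..t} ?w"
      by (rule integral_spike[of "{t - b}"]) auto
    also have "\<dots> \<le> - (K\<^sup>2 * N / (p b)\<^sup>2) * (p b * u b / r)"
    proof (rule has_integral_le[OF integrable_integral])
      show "?w integrable_on {t - b..t}"
        by (rule integrable_spike_finite[OF _ _ wI, of "{t - b}"]) auto
      have "((\<lambda>s. ?h (- s + t)) has_integral p b * u b / r) {t - b..t}"
        using has_integral_shift_real_ivl[OF has_integral_reflect_real[THEN iffD2, OF h_int[OF b(1)]], of "- t"] by simp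
      then have "((\<lambda>s. ?h (t - s)) has_integral p b * u b / r) {t - b..t}" by simp
      then show "((\<lambda>s. - (K\<^sup>2 * N / (p b)\<^sup>2) * ?h (t - s)) has_integral - (K\<^sup>2 * N / (p b)\<^sup>2) * (p b * u b / r)) {t - b..t}"
        by (rule has_integral_mult_right)
      fix s assume s: "s \<in> {t - b..t}"
      show "?w s \<le> - (K\<^sup>2 * N / (p b)\<^sup>2) * ?h (t - s)"
      proof (cases "s = t - b")
        case False
        define \<sigma> where "\<sigma> = t - s"
        have \<sigma>: "\<sigma> \<in> {0..b}" "0 \<le> s" "0 \<le> \<sigma>" "t = \<sigma> + s" using s a b t by (auto simp: \<sigma>_def)
        have ns: "0 < n \<sigma>" using n_pos \<sigma> by simp
        have G: "N \<le> (n \<sigma>)\<^sup>2 * ?G s"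
        proof -
          have "S t v = S \<sigma> (S s v)" using C0_semigroupD(3)[OF semigroup \<sigma>(3,2)] \<sigma>(4) by simp
          then have "(norm (S t v))\<^sup>2 \<le> (m \<sigma> * norm (S s v))\<^sup>2"
            using growth[OF \<sigma>(3)] by (intro power_mono) auto
          then have "N \<le> exp (- 2 * \<omega> * t) * (m \<sigma> * norm (S s v))\<^sup>2"
            unfolding N_def by (intro mult_left_mono) auto
          also have "exp (- 2 * \<omega> * t) = exp (- 2 * \<omega> * \<sigma>) * exp (- 2 * \<omega> * s)"
            unfolding mult_exp_exp \<sigma>(4) by (simp add: algebra_simps)
          also have "exp (- 2 * \<omega> * \<sigma>) * exp (- 2 * \<omega> * s) * (m \<sigma> * norm (S s v))\<^sup>2 = (n \<sigma>)\<^sup>2 * ?G s"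
            by (simp add: n_def weight_def power_mult_distrib exp_double[symmetric] mult_ac)
          finally show ?thesis .
        qed
        have w: "w s = - (K\<^sup>2 / (p b)\<^sup>2 * ((p \<sigma>)\<^sup>2 - ((n \<sigma>)\<^sup>2 * u \<sigma>)\<^sup>2) * ?G s)"
          using s False r_pos a b t pb
          by (simp add: w_def f_def f'_def \<sigma>_def[symmetric] field_simps)
        \<comment> \<open>Here f'^2 / r^2 - f^2 is nonpositive, so it is the lower bound on the
          weight, from the semigroup law, that can be inserted.\<close>
        have "0 \<le> (p \<sigma>)\<^sup>2 - ((n \<sigma>)\<^sup>2 * u \<sigma>)\<^sup>2"
          using b(3)[OF \<sigma>(1)] ns by (simp add: power_mono)
        moreover have "N / (n \<sigma>)\<^sup>2 \<le> ?G s" using G ns by (simp add: field_simps)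
        ultimately have "K\<^sup>2 / (p b)\<^sup>2 * ((p \<sigma>)\<^sup>2 - ((n \<sigma>)\<^sup>2 * u \<sigma>)\<^sup>2) * (N / (n \<sigma>)\<^sup>2)
           \<le> K\<^sup>2 / (p b)\<^sup>2 * ((p \<sigma>)\<^sup>2 - ((n \<sigma>)\<^sup>2 * u \<sigma>)\<^sup>2) * ?G s"
          by (intro mult_left_mono) auto
        moreover have "K\<^sup>2 / (p b)\<^sup>2 * ((p \<sigma>)\<^sup>2 - ((n \<sigma>)\<^sup>2 * u \<sigma>)\<^sup>2) * (N / (n \<sigma>)\<^sup>2) = K\<^sup>2 * N / (p b)\<^sup>2 * ?h \<sigma>"
          using ns pb by (simp add: field_simps power2_eq_square)
        ultimately show ?thesis using w False by (simp add: \<sigma>_def)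
      qed simp
    qed
    finally show ?thesis .
  qed
  have "K\<^sup>2 * N / (p b)\<^sup>2 * (p b * u b / r) \<le> (norm v)\<^sup>2 / (u a)\<^sup>2 * (p a * u a / r)"
    using w_nonneg split int1 int2 int3 by linarith
  then have "K\<^sup>2 * N * (u b / p b) \<le> (norm v)\<^sup>2 * (p a / u a)"
    using pb a b r_pos by (simp add: field_simps power2_eq_square)
  then have "K\<^sup>2 * N * (u b / p b) * (p b / u b) \<le> (norm v)\<^sup>2 * (p a / u a) * (p b / u b)"
    using pb b by (intro mult_right_mono) auto
  then have "K\<^sup>2 * N \<le> (norm v)\<^sup>2 * (p a / u a) * (p b / u b)"
    using pb b by simp
  then have "exp (2 * \<omega> * t) * exp (- 2 * r * (t - (a + b))) * (K\<^sup>2 * N) \<le>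
     exp (2 * \<omega> * t) * exp (- 2 * r * (t - (a + b))) * ((norm v)\<^sup>2 * (p a / u a) * (p b / u b))"
    by (intro mult_left_mono) auto
  also have "exp (2 * \<omega> * t) * exp (- 2 * r * (t - (a + b))) * (K\<^sup>2 * N) = (norm (S t v))\<^sup>2"
  proof -
    have "exp (2 * \<omega> * t) * exp (- 2 * \<omega> * t) = 1" "exp (- 2 * r * (t - (a + b))) * K\<^sup>2 = 1"
      unfolding K_def exp_double[symmetric] mult_exp_exp by (simp_all add: algebra_simps)
    moreover have "x * y * (k * (x' * z)) = (x * x') * (y * k) * z" for x y k x' z :: real
      by (simp add: mult_ac)
    ultimately show ?thesis unfolding N_def by (simp only: mult_1)
  qed
  finally show ?thesis by (simp add: mult_ac)
qed

end

section \<open>A linear Sturm-Liouville system\<close>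

lemma at_within_Icc_eq_Ici: "s < T \<Longrightarrow> at s within {0..T} = at s within {0..}" for s T :: real
  by (rule at_within_nhd[where S = "{..<T}"]) auto

lemma DERIV_transform_on:
  assumes "(f has_real_derivative d) (at x within S)" "x \<in> S" "\<And>y. y \<in> S \<Longrightarrow> f y = g y"
  shows "(g has_real_derivative d) (at x within S)"
  using assms has_derivative_transform[of x S g f] unfolding has_field_derivative_def by auto

text \<open>The coefficient of \<mu>^k when the integral equation for p, 1 minus \<mu> times the
  iterated integral of \<beta> and \<alpha> p, is solved by iteration.\<close>

primrec volterra_p :: "(real \<Rightarrow> real) \<Rightarrow> (real \<Rightarrow> real) \<Rightarrow> nat \<Rightarrow> real \<Rightarrow> real"
  where
    "volterra_p \<alpha> \<beta> 0 = (\<lambda>s. 1)"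
  | "volterra_p \<alpha> \<beta> (Suc k) =
      (\<lambda>s. - integral {0..s} (\<lambda>x. \<beta> x * integral {0..x} (\<lambda>y. \<alpha> y * volterra_p \<alpha> \<beta> k y)))"

definition volterra_u :: "(real \<Rightarrow> real) \<Rightarrow> (real \<Rightarrow> real) \<Rightarrow> nat \<Rightarrow> real \<Rightarrow> real"
  where "volterra_u \<alpha> \<beta> k s = integral {0..s} (\<lambda>y. \<alpha> y * volterra_p \<alpha> \<beta> k y)"

text \<open>Solution of \<open>u' = \<alpha> p\<close>, \<open>p' = - \<mu> \<beta> u\<close>, \<open>u 0 = 0\<close>, \<open>p 0 = 1\<close> as a power series in \<open>\<mu>\<close>.\<close>

definition sl_p :: "(real \<Rightarrow> real) \<Rightarrow> (real \<Rightarrow> real) \<Rightarrow> real \<Rightarrow> real \<Rightarrow> real"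
  where "sl_p \<alpha> \<beta> \<mu> s = (\<Sum>k. \<mu> ^ k * volterra_p \<alpha> \<beta> k s)"

definition sl_u :: "(real \<Rightarrow> real) \<Rightarrow> (real \<Rightarrow> real) \<Rightarrow> real \<Rightarrow> real \<Rightarrow> real"
  where "sl_u \<alpha> \<beta> \<mu> s = (\<Sum>k. \<mu> ^ k * volterra_u \<alpha> \<beta> k s)"

context
  fixes \<alpha> \<beta> :: "real \<Rightarrow> real"
  assumes \<alpha>: "continuous_on {0..} \<alpha>" and \<beta>: "continuous_on {0..} \<beta>"
begin

private abbreviation "pc \<equiv> volterra_p \<alpha> \<beta>"
private abbreviation "uc \<equiv> volterra_u \<alpha> \<beta>"
private abbreviation "ps \<equiv> sl_p \<alpha> \<beta>"
private abbreviation "us \<equiv> sl_u \<alpha> \<beta>"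

private lemma cont\<alpha>\<beta>: "continuous_on {0..T} \<alpha>" "continuous_on {0..T} \<beta>"
  using \<alpha> \<beta> by (auto intro: continuous_on_subset)

lemma continuous_on_volterra:
  "continuous_on {0..T} (pc k)" "continuous_on {0..T} (uc k)"
proof (induction k)
  case 0
  show "continuous_on {0..T} (pc 0)" by simp
  show "continuous_on {0..T} (uc 0)"
    unfolding volterra_u_def
    by (intro indefinite_integral_continuous_1 integrable_continuous_real continuous_intros cont\<alpha>\<beta>) simp
next
  case (Suc k)
  show *: "continuous_on {0..T} (pc (Suc k))"
    unfolding volterra_p.simps
    by (intro continuous_on_minus indefinite_integral_continuous_1 integrable_continuous_real
        continuous_on_mult cont\<alpha>\<beta> Suc(1))
  show "continuous_on {0..T} (uc (Suc k))"
    unfolding volterra_u_def[of _ _ "Suc k"]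
    by (intro indefinite_integral_continuous_1 integrable_continuous_real continuous_on_mult cont\<alpha>\<beta> *)
qed

lemma volterra_deriv:
  assumes "s \<in> {0..T}"
  shows "(uc k has_real_derivative \<alpha> s * pc k s) (at s within {0..T})"
    and "(pc (Suc k) has_real_derivative - (\<beta> s * uc k s)) (at s within {0..T})"
proof -
  show "(uc k has_real_derivative \<alpha> s * pc k s) (at s within {0..T})"
    unfolding volterra_u_def
    by (intro integral_has_real_derivative continuous_intros cont\<alpha>\<beta> continuous_on_volterra assms)
  have "((\<lambda>s. integral {0..s} (\<lambda>x. \<beta> x * uc k x)) has_real_derivative \<beta> s * uc k s)
      (at s within {0..T})"
    by (intro integral_has_real_derivative continuous_intros cont\<alpha>\<beta> continuous_on_volterra assms)
  from DERIV_minus[OF this]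
  show "(pc (Suc k) has_real_derivative - (\<beta> s * uc k s)) (at s within {0..T})"
    by (simp add: volterra_u_def)
qed

text \<open>Each pass from \<open>k\<close> to \<open>Suc k\<close> integrates twice. One
  integration is bounded crudely by the factor \<open>T\<close>; the other builds up the power of
  \<open>s\<close> over the factorial, which is enough for an exponential majorant.\<close>

lemma volterra_bound:
  assumes A: "\<And>s. s \<in> {0..T} \<Longrightarrow> \<bar>\<alpha> s\<bar> \<le> A" and B: "\<And>s. s \<in> {0..T} \<Longrightarrow> \<bar>\<beta> s\<bar> \<le> B"
    and s: "s \<in> {0..T}"
  shows "\<bar>pc k s\<bar> \<le> (A * B * T * s) ^ k / fact k"
    and "\<bar>uc k s\<bar> \<le> A * T * ((A * B * T * s) ^ k / fact k)"
proof -
  have T: "0 \<le> T" using s by simp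
  have AB: "0 \<le> A" "0 \<le> B" using A[of 0] B[of 0] T by auto
  have u: "\<bar>uc k s\<bar> \<le> A * T * ((A * B * T * s) ^ k / fact k)"
    if s: "s \<in> {0..T}" and p: "\<And>s. s \<in> {0..T} \<Longrightarrow> \<bar>pc k s\<bar> \<le> (A * B * T * s) ^ k / fact k" for k s
  proof -
    have "norm (uc k s) \<le> integral {0..s} (\<lambda>y. A * ((A * B * T * s) ^ k / fact k))"
      unfolding volterra_u_def
    proof (rule integral_norm_bound_integral)
      show "(\<lambda>y. \<alpha> y * pc k y) integrable_on {0..s}"
        by (intro integrable_continuous_real continuous_intros cont\<alpha>\<beta> continuous_on_volterra)
      fix y assume y: "y \<in> {0..s}"
      have "\<bar>\<alpha> y\<bar> * \<bar>pc k y\<bar> \<le> A * ((A * B * T * y) ^ k / fact k)"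
        using y s by (intro mult_mono A p AB) auto
      also have "\<dots> \<le> A * ((A * B * T * s) ^ k / fact k)"
        using y AB T by (intro mult_left_mono divide_right_mono power_mono) auto
      finally show "norm (\<alpha> y * pc k y) \<le> A * ((A * B * T * s) ^ k / fact k)"
        by (simp add: abs_mult)
    qed (intro integrable_continuous_real continuous_intros)
    also have "\<dots> = s * (A * ((A * B * T * s) ^ k / fact k))" using s by simp
    also have "\<dots> \<le> T * (A * ((A * B * T * s) ^ k / fact k))"
      using s AB T by (intro mult_right_mono) auto
    finally show ?thesis by (simp add: mult_ac)
  qed
  have p: "\<bar>pc k s\<bar> \<le> (A * B * T * s) ^ k / fact k" if "s \<in> {0..T}" for k s
    using that
  proof (induction k arbitrary: s)
    case 0
    then show ?case by simp
  next
    case (Suc k)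
    define K where "K = A * B * T"
    have K0: "0 \<le> K" using AB T by (simp add: K_def)
    have "((\<lambda>y. K * (K * y) ^ k / fact k) has_integral (K * s) ^ Suc k / fact (Suc k) - (K * 0) ^ Suc k / fact (Suc k)) {0..s}"
    proof (rule fundamental_theorem_of_calculus)
      fix y
      have "((\<lambda>y. (K * y) ^ Suc k / fact (Suc k)) has_real_derivative real (Suc k) * (K * y) ^ k * K / fact (Suc k)) (at y within {0..s})"
        by (auto intro!: derivative_eq_intros simp del: power_Suc fact_Suc)
      also have "real (Suc k) * (K * y) ^ k * K / fact (Suc k) = K * (K * y) ^ k / fact k"
        by (simp add: field_simps del: of_nat_Suc)
      finally show "((\<lambda>y. (K * y) ^ Suc k / fact (Suc k)) has_vector_derivative K * (K * y) ^ k / fact k) (at y within {0..s})"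
        by (simp add: has_real_derivative_iff_has_vector_derivative)
    qed (use Suc.prems in simp)
    then have I: "((\<lambda>y. K * (K * y) ^ k / fact k) has_integral (K * s) ^ Suc k / fact (Suc k)) {0..s}" by simp
    have "norm (integral {0..s} (\<lambda>x. \<beta> x * uc k x)) \<le> integral {0..s} (\<lambda>y. K * (K * y) ^ k / fact k)"
    proof (rule integral_norm_bound_integral)
      show "(\<lambda>x. \<beta> x * uc k x) integrable_on {0..s}"
        by (intro integrable_continuous_real continuous_intros cont\<alpha>\<beta> continuous_on_volterra)
      show "(\<lambda>y. K * (K * y) ^ k / fact k) integrable_on {0..s}" using I by blast
      fix y assume y: "y \<in> {0..s}"
      then have yT: "y \<in> {0..T}" using Suc.prems by auto
      have "\<bar>\<beta> y\<bar> * \<bar>uc k y\<bar> \<le> B * (A * T * ((A * B * T * y) ^ k / fact k))"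
        by (intro mult_mono B u Suc.IH yT AB) auto
      then show "norm (\<beta> y * uc k y) \<le> K * (K * y) ^ k / fact k"
        by (simp add: abs_mult K_def mult_ac)
    qed
    then show ?case unfolding integral_unique[OF I] by (simp add: volterra_u_def K_def)
  qed
  show "\<bar>pc k s\<bar> \<le> (A * B * T * s) ^ k / fact k" using p[OF s] .
  show "\<bar>uc k s\<bar> \<le> A * T * ((A * B * T * s) ^ k / fact k)" using u[OF s p] .
qed

text \<open>Uniform in \<mu> as well as in \<open>s\<close>: this is what yields joint continuity in
  the spectral parameter.\<close>

lemma volterra_majorant:
  assumes T: "0 \<le> T" and R: "0 \<le> R"
  obtains M where "summable M"
    "\<And>k \<mu> s. \<bar>\<mu>\<bar> \<le> R \<Longrightarrow> s \<in> {0..T} \<Longrightarrow> \<bar>\<mu> ^ k * pc k s\<bar> \<le> M k"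
    "\<And>k \<mu> s. \<bar>\<mu>\<bar> \<le> R \<Longrightarrow> s \<in> {0..T} \<Longrightarrow> \<bar>\<mu> ^ k * uc k s\<bar> \<le> M k"
proof -
  obtain A where A: "\<And>s. s \<in> {0..T} \<Longrightarrow> \<bar>\<alpha> s\<bar> \<le> A" using bounded_on_Icc[OF cont\<alpha>\<beta>(1)] by (metis real_norm_def)
  obtain B where B: "\<And>s. s \<in> {0..T} \<Longrightarrow> \<bar>\<beta> s\<bar> \<le> B" using bounded_on_Icc[OF cont\<alpha>\<beta>(2)] by (metis real_norm_def)
  have AB: "0 \<le> A" "0 \<le> B" using A[of 0] B[of 0] T by auto
  define K where "K = A * B * T * T"
  have K0: "0 \<le> K" using AB T by (simp add: K_def)
  define M where "M k = (1 + A * T) * (R * K) ^ k / fact k" for k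
  have "summable M"
    using summable_mult[OF summable_exp[of "R * K"], of "1 + A * T"]
    unfolding M_def by (simp add: divide_inverse mult_ac)
  moreover have pw: "(A * B * T * s) ^ k / fact k \<le> K ^ k / fact k" if "s \<in> {0..T}" for s k
    using that AB T unfolding K_def by (intro divide_right_mono power_mono mult_left_mono) auto
  have \<mu>: "\<bar>\<mu> ^ k * x\<bar> \<le> M k" if \<mu>: "\<bar>\<mu>\<bar> \<le> R" and x: "\<bar>x\<bar> \<le> (1 + A * T) * (K ^ k / fact k)" for \<mu> x k
  proof -
    have "\<bar>\<mu>\<bar> ^ k * \<bar>x\<bar> \<le> R ^ k * ((1 + A * T) * (K ^ k / fact k))"
      using \<mu> R by (intro mult_mono power_mono x) auto
    then show ?thesis by (simp add: M_def abs_mult power_abs power_mult_distrib mult_ac)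
  qed
  have "\<bar>pc k s\<bar> \<le> (1 + A * T) * (K ^ k / fact k)" if "s \<in> {0..T}" for k s
  proof -
    have "\<bar>pc k s\<bar> \<le> 1 * (K ^ k / fact k)"
      using volterra_bound(1)[OF A B that, of k] pw[OF that, of k] by linarith
    also have "\<dots> \<le> (1 + A * T) * (K ^ k / fact k)" using AB T K0 by (intro mult_right_mono) auto
    finally show ?thesis .
  qed
  moreover have "\<bar>uc k s\<bar> \<le> (1 + A * T) * (K ^ k / fact k)" if "s \<in> {0..T}" for k s
  proof -
    have "\<bar>uc k s\<bar> \<le> A * T * ((A * B * T * s) ^ k / fact k)"
      using volterra_bound(2)[OF A B that, of k] .
    also have "\<dots> \<le> (1 + A * T) * (K ^ k / fact k)"
      using AB T K0 that by (intro mult_mono pw) auto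
    finally show ?thesis .
  qed
  ultimately show ?thesis using that \<mu> by blast
qed

lemma volterra_uniform_limit:
  assumes T: "0 \<le> T" and R: "0 \<le> R"
  shows "uniform_limit ({-R..R} \<times> {0..T}) (\<lambda>n z. \<Sum>k<n. fst z ^ k * pc k (snd z))
      (\<lambda>z. ps (fst z) (snd z)) sequentially"
    and "uniform_limit ({-R..R} \<times> {0..T}) (\<lambda>n z. \<Sum>k<n. fst z ^ k * uc k (snd z))
      (\<lambda>z. us (fst z) (snd z)) sequentially"
proof -
  obtain M where M: "summable M"
    "\<And>k \<mu> s. \<bar>\<mu>\<bar> \<le> R \<Longrightarrow> s \<in> {0..T} \<Longrightarrow> \<bar>\<mu> ^ k * pc k s\<bar> \<le> M k"
    "\<And>k \<mu> s. \<bar>\<mu>\<bar> \<le> R \<Longrightarrow> s \<in> {0..T} \<Longrightarrow> \<bar>\<mu> ^ k * uc k s\<bar> \<le> M k"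
    using volterra_majorant[OF T R] by metis
  show "uniform_limit ({-R..R} \<times> {0..T}) (\<lambda>n z. \<Sum>k<n. fst z ^ k * pc k (snd z))
      (\<lambda>z. ps (fst z) (snd z)) sequentially"
    unfolding sl_p_def by (rule Weierstrass_m_test[OF _ M(1)]) (auto intro!: M(2))
  show "uniform_limit ({-R..R} \<times> {0..T}) (\<lambda>n z. \<Sum>k<n. fst z ^ k * uc k (snd z))
      (\<lambda>z. us (fst z) (snd z)) sequentially"
    unfolding sl_u_def by (rule Weierstrass_m_test[OF _ M(1)]) (auto intro!: M(3))
qed

lemma continuous_on_sl:
  assumes T: "0 \<le> T" and R: "0 \<le> R"
  shows "continuous_on ({-R..R} \<times> {0..T}) (\<lambda>z. ps (fst z) (snd z))"
    and "continuous_on ({-R..R} \<times> {0..T}) (\<lambda>z. us (fst z) (snd z))"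
proof -
  have "continuous_on ({-R..R} \<times> {0..T}) (\<lambda>z. \<Sum>k<n. fst z ^ k * pc k (snd z))" for n
    by (intro continuous_intros continuous_on_compose2[OF continuous_on_volterra(1)[of T]]) auto
  then show "continuous_on ({-R..R} \<times> {0..T}) (\<lambda>z. ps (fst z) (snd z))"
    by (intro uniform_limit_theorem[OF _ volterra_uniform_limit(1)[OF T R]]) auto
  have "continuous_on ({-R..R} \<times> {0..T}) (\<lambda>z. \<Sum>k<n. fst z ^ k * uc k (snd z))" for n
    by (intro continuous_intros continuous_on_compose2[OF continuous_on_volterra(2)[of T]]) auto
  then show "continuous_on ({-R..R} \<times> {0..T}) (\<lambda>z. us (fst z) (snd z))"
    by (intro uniform_limit_theorem[OF _ volterra_uniform_limit(2)[OF T R]]) auto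
qed

lemma sl_summable:
  assumes "0 \<le> s"
  shows "summable (\<lambda>k. \<mu> ^ k * pc k s)" "summable (\<lambda>k. \<mu> ^ k * uc k s)"
proof -
  obtain M where M: "summable M"
    "\<And>k \<nu> t. \<bar>\<nu>\<bar> \<le> \<bar>\<mu>\<bar> \<Longrightarrow> t \<in> {0..s} \<Longrightarrow> \<bar>\<nu> ^ k * pc k t\<bar> \<le> M k"
    "\<And>k \<nu> t. \<bar>\<nu>\<bar> \<le> \<bar>\<mu>\<bar> \<Longrightarrow> t \<in> {0..s} \<Longrightarrow> \<bar>\<nu> ^ k * uc k t\<bar> \<le> M k"
    using volterra_majorant[OF assms, of "\<bar>\<mu>\<bar>"] by (metis abs_ge_zero)
  show "summable (\<lambda>k. \<mu> ^ k * pc k s)" "summable (\<lambda>k. \<mu> ^ k * uc k s)"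
    by (rule summable_comparison_test'[OF M(1)], use M(2,3) assms in simp)+
qed

lemma sl_initial: "us \<mu> 0 = 0" "ps \<mu> 0 = 1"
proof -
  show "us \<mu> 0 = 0" by (simp add: sl_u_def volterra_u_def)
  have "\<mu> ^ k * pc k 0 = (if k = 0 then 1 else 0)" for k by (cases k) auto
  then show "ps \<mu> 0 = 1"
    unfolding sl_p_def by (simp only:) (subst suminf_finite[of "{0}"], auto)
qed

lemma sl_deriv:
  assumes s: "0 \<le> s"
  shows "(us \<mu> has_real_derivative \<alpha> s * ps \<mu> s) (at s within {0..})"
    and "(ps \<mu> has_real_derivative - (\<mu> * \<beta> s * us \<mu> s)) (at s within {0..})"
proof -
  \<comment> \<open>Keeps \<open>s\<close> off the right end of \<open>{0..T}\<close>, so that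
    derivatives within \<open>{0..T}\<close> and within the half-line agree at
    \<open>s\<close>.\<close>
  define T where "T = s + 1"
  define R where "R = \<bar>\<mu>\<bar>"
  have T: "0 \<le> T" "s < T" "s \<in> {0..T}" and R: "0 \<le> R" "\<mu> \<in> {-R..R}" using s by (auto simp: T_def R_def)
  have bounded: "bounded (g ` {0..T})" if "continuous_on {0..T} g" for g :: "real \<Rightarrow> real"
    using compact_imp_bounded[OF compact_continuous_image[OF that compact_Icc]] .
  have lim_p: "uniform_limit {0..T} (\<lambda>n s. \<Sum>k<n. \<mu> ^ k * pc k s) (ps \<mu>) sequentially"
    using uniform_limit_compose'[OF volterra_uniform_limit(1)[OF T(1) R(1)], of "Pair \<mu>" "{0..T}"] R(2) by auto
  have lim_u: "uniform_limit {0..T} (\<lambda>n s. \<Sum>k<n. \<mu> ^ k * uc k s) (us \<mu>) sequentially"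
    using uniform_limit_compose'[OF volterra_uniform_limit(2)[OF T(1) R(1)], of "Pair \<mu>" "{0..T}"] R(2) by auto
  have cp: "continuous_on {0..T} (ps \<mu>)"
    by (rule uniform_limit_theorem[OF _ lim_p]) (intro always_eventually allI continuous_intros continuous_on_volterra, simp)
  have cu: "continuous_on {0..T} (us \<mu>)"
    by (rule uniform_limit_theorem[OF _ lim_u]) (intro always_eventually allI continuous_intros continuous_on_volterra, simp)
  have "uniform_limit {0..T} (\<lambda>n s. \<alpha> s * (\<Sum>k<n. \<mu> ^ k * pc k s)) (\<lambda>s. \<alpha> s * ps \<mu> s) sequentially"
    by (rule bounded_bilinear.bounded_uniform_limit[OF bounded_bilinear_mult uniform_limit_const lim_p])
      (intro bounded cont\<alpha>\<beta> cp)+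
  then have l1: "uniform_limit {0..T} (\<lambda>n s. \<Sum>k<n. \<mu> ^ k * (\<alpha> s * pc k s)) (\<lambda>s. \<alpha> s * ps \<mu> s) sequentially"
    by (simp add: sum_distrib_left mult_ac)
  have "\<exists>g. \<forall>x\<in>{0..T}. (\<lambda>k. \<mu> ^ k * uc k x) sums g x \<and>
      (g has_real_derivative \<alpha> x * ps \<mu> x) (at x within {0..T})"
    by (rule has_field_derivative_series[OF _ _ l1, of _ 0])
      (auto intro!: DERIV_cmult volterra_deriv sl_summable simp: T)
  then obtain g where g: "\<And>x. x \<in> {0..T} \<Longrightarrow> (\<lambda>k. \<mu> ^ k * uc k x) sums g x"
    "\<And>x. x \<in> {0..T} \<Longrightarrow> (g has_real_derivative \<alpha> x * ps \<mu> x) (at x within {0..T})" by blast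
  have "g x = us \<mu> x" if "x \<in> {0..T}" for x
    using g(1)[OF that] by (simp add: sl_u_def sums_iff)
  then have "(us \<mu> has_real_derivative \<alpha> s * ps \<mu> s) (at s within {0..T})"
    using g(2)[OF T(3)] T(3) by (auto intro: DERIV_transform_on)
  then show "(us \<mu> has_real_derivative \<alpha> s * ps \<mu> s) (at s within {0..})"
    using T(2) by (simp add: at_within_Icc_eq_Ici)
  have "uniform_limit {0..T} (\<lambda>n s. (- \<mu> * \<beta> s) * (\<Sum>k<n. \<mu> ^ k * uc k s)) (\<lambda>s. (- \<mu> * \<beta> s) * us \<mu> s) sequentially"
    by (rule bounded_bilinear.bounded_uniform_limit[OF bounded_bilinear_mult uniform_limit_const lim_u])
      (intro bounded continuous_intros cont\<alpha>\<beta> cu)+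
  then have l2: "uniform_limit {0..T} (\<lambda>n s. \<Sum>k<n. \<mu> ^ Suc k * - (\<beta> s * uc k s)) (\<lambda>s. - (\<mu> * \<beta> s * us \<mu> s)) sequentially"
    by (simp add: sum_distrib_left mult_ac)
  \<comment> \<open>The term of index 0 in the series for p is the constant 1. Differentiating the
    remaining terms reproduces the series for u, shifted by one power of \<mu>.\<close>
  have "\<exists>g. \<forall>x\<in>{0..T}. (\<lambda>k. \<mu> ^ Suc k * pc (Suc k) x) sums g x \<and>
      (g has_real_derivative - (\<mu> * \<beta> x * us \<mu> x)) (at x within {0..T})"
  proof (rule has_field_derivative_series[OF _ _ l2, of _ 0])
    show "summable (\<lambda>k. \<mu> ^ Suc k * pc (Suc k) 0)"
      using summable_Suc_iff[THEN iffD2, OF sl_summable(1)[of 0 \<mu>]] by simp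
    show "((\<lambda>x. \<mu> ^ Suc k * pc (Suc k) x) has_real_derivative
        \<mu> ^ Suc k * - (\<beta> x * uc k x)) (at x within {0..T})" if "x \<in> {0..T}" for k x
      by (intro DERIV_cmult volterra_deriv that)
  qed (use T in simp_all)
  then obtain g where g: "\<And>x. x \<in> {0..T} \<Longrightarrow> (\<lambda>k. \<mu> ^ Suc k * pc (Suc k) x) sums g x"
    "\<And>x. x \<in> {0..T} \<Longrightarrow> (g has_real_derivative - (\<mu> * \<beta> x * us \<mu> x)) (at x within {0..T})" by blast
  have eq: "1 + g x = ps \<mu> x" if "x \<in> {0..T}" for x
  proof -
    have "(\<lambda>k. \<mu> ^ k * pc k x) sums (g x + \<mu> ^ 0 * pc 0 x)"
      using g(1)[OF that] by (rule sums_Suc)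
    then show ?thesis by (simp add: sl_p_def sums_iff)
  qed
  have "((\<lambda>x. 1 + g x) has_real_derivative - (\<mu> * \<beta> s * us \<mu> s)) (at s within {0..T})"
    using DERIV_add[OF DERIV_const[of 1] g(2)[OF T(3)]] by simp
  then have "(ps \<mu> has_real_derivative - (\<mu> * \<beta> s * us \<mu> s)) (at s within {0..T})"
    using eq T(3) by (auto intro: DERIV_transform_on)
  then show "(ps \<mu> has_real_derivative - (\<mu> * \<beta> s * us \<mu> s)) (at s within {0..})"
    using T(2) by (simp add: at_within_Icc_eq_Ici)
qed

end

lemma wronskian_constant:
  fixes y q u p \<alpha> \<beta> :: "real \<Rightarrow> real"
  assumes "convex X"
    and "\<And>s. s \<in> X \<Longrightarrow> (y has_real_derivative \<alpha> s * q s) (at s within X)"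
    and "\<And>s. s \<in> X \<Longrightarrow> (q has_real_derivative - (\<beta> s * y s)) (at s within X)"
    and "\<And>s. s \<in> X \<Longrightarrow> (u has_real_derivative \<alpha> s * p s) (at s within X)"
    and "\<And>s. s \<in> X \<Longrightarrow> (p has_real_derivative - (\<beta> s * u s)) (at s within X)"
    and "s \<in> X" "t \<in> X"
  shows "q s * u s - y s * p s = q t * u t - y t * p t"
proof -
  have "((\<lambda>s. q s * u s - y s * p s) has_real_derivative 0) (at s within X)" if "s \<in> X" for s
    using DERIV_diff[OF DERIV_mult[OF assms(3)[OF that] assms(4)[OF that]] DERIV_mult[OF assms(2)[OF that] assms(5)[OF that]]]
    by (simp add: algebra_simps)
  then show ?thesis
    using has_field_derivative_zero_constant[OF assms(1), of "\<lambda>s. q s * u s - y s * p s"] assms(6,7) by metis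
qed

lemma sl_fundamental_system:
  assumes \<alpha>: "continuous_on {0..} \<alpha>" and \<beta>: "continuous_on {0..} \<beta>"
  obtains u2 p2 where
    "\<And>s. 0 \<le> s \<Longrightarrow> (u2 has_real_derivative \<alpha> s * p2 s) (at s within {0..})"
    "\<And>s. 0 \<le> s \<Longrightarrow> (p2 has_real_derivative - (\<mu> * \<beta> s * u2 s)) (at s within {0..})"
    "u2 0 = 1" "p2 0 = 0"
    "\<And>s. 0 \<le> s \<Longrightarrow> sl_p \<alpha> \<beta> \<mu> s * u2 s - sl_u \<alpha> \<beta> \<mu> s * p2 s = 1"
proof -
  \<comment> \<open>Exchanging the two components gives a system of the same kind, with coefficients
    - \<mu> \<beta> and - \<alpha> and parameter 1; its standard solution, read in exchanged order,
    has the complementary initial values.\<close>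
  define u2 where "u2 = sl_p (\<lambda>s. - (\<mu> * \<beta> s)) (\<lambda>s. - \<alpha> s) 1"
  define p2 where "p2 = sl_u (\<lambda>s. - (\<mu> * \<beta> s)) (\<lambda>s. - \<alpha> s) 1"
  have c: "continuous_on {0..} (\<lambda>s. - (\<mu> * \<beta> s))" "continuous_on {0..} (\<lambda>s. - \<alpha> s)"
    by (auto intro!: continuous_intros \<alpha> \<beta>)
  have d: "(u2 has_real_derivative \<alpha> s * p2 s) (at s within {0..})"
    "(p2 has_real_derivative - (\<mu> * \<beta> s * u2 s)) (at s within {0..})" if "0 \<le> s" for s
    using sl_deriv[OF c that, of 1] by (simp_all add: u2_def p2_def)
  have i: "u2 0 = 1" "p2 0 = 0" using sl_initial[OF c, of 1] by (simp_all add: u2_def p2_def)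
  have "sl_p \<alpha> \<beta> \<mu> s * u2 s - sl_u \<alpha> \<beta> \<mu> s * p2 s = sl_p \<alpha> \<beta> \<mu> 0 * u2 0 - sl_u \<alpha> \<beta> \<mu> 0 * p2 0"
    if "0 \<le> s" for s
    by (rule wronskian_constant[where X = "{0..}" and \<alpha> = \<alpha> and \<beta> = "\<lambda>s. \<mu> * \<beta> s"])
      (use d sl_deriv[OF \<alpha> \<beta>] that in auto)
  then show ?thesis using that[OF d i] by (simp add: sl_initial[OF \<alpha> \<beta>] i)
qed

text \<open>Constant Wronskians against both members of a fundamental system give two linear
  equations for \<open>y s\<close> and \<open>q s\<close> with determinant 1, solved by Cramer's
  rule. A general \<open>X\<close> covers both the half-line and a bounded interval
  \<open>{0..a}\<close>.\<close>

lemma sl_unique: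
  assumes \<alpha>: "continuous_on {0..} \<alpha>" and \<beta>: "continuous_on {0..} \<beta>"
    and X: "convex X" "0 \<in> X" "X \<subseteq> {0..}"
    and y: "\<And>s. s \<in> X \<Longrightarrow> (y has_real_derivative \<alpha> s * q s) (at s within X)"
    and q: "\<And>s. s \<in> X \<Longrightarrow> (q has_real_derivative - (\<mu> * \<beta> s * y s)) (at s within X)"
    and y0: "y 0 = 0" and s: "s \<in> X"
  shows "y s = q 0 * sl_u \<alpha> \<beta> \<mu> s" "q s = q 0 * sl_p \<alpha> \<beta> \<mu> s"
proof -
  obtain u2 p2 where d2: "\<And>s. 0 \<le> s \<Longrightarrow> (u2 has_real_derivative \<alpha> s * p2 s) (at s within {0..})"
    "\<And>s. 0 \<le> s \<Longrightarrow> (p2 has_real_derivative - (\<mu> * \<beta> s * u2 s)) (at s within {0..})"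
    and i2: "u2 0 = 1" "p2 0 = 0"
    and det: "\<And>s. 0 \<le> s \<Longrightarrow> sl_p \<alpha> \<beta> \<mu> s * u2 s - sl_u \<alpha> \<beta> \<mu> s * p2 s = 1"
    using sl_fundamental_system[OF \<alpha> \<beta>, of \<mu>] by metis
  let ?u = "sl_u \<alpha> \<beta> \<mu>" and ?p = "sl_p \<alpha> \<beta> \<mu>"
  have dX: "(?u has_real_derivative \<alpha> s * ?p s) (at s within X)" "(?p has_real_derivative - (\<mu> * \<beta> s * ?u s)) (at s within X)"
    "(u2 has_real_derivative \<alpha> s * p2 s) (at s within X)" "(p2 has_real_derivative - (\<mu> * \<beta> s * u2 s)) (at s within X)"
    if "s \<in> X" for s
    using sl_deriv[OF \<alpha> \<beta>, of s \<mu>] d2[of s] that X(3) by (auto intro: DERIV_subset)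
  have W1: "q s * ?u s - y s * ?p s = q 0 * ?u 0 - y 0 * ?p 0"
    by (rule wronskian_constant[where X = X and \<alpha> = \<alpha> and \<beta> = "\<lambda>s. \<mu> * \<beta> s"]) (use X y q dX s in auto)
  have W2: "q s * u2 s - y s * p2 s = q 0 * u2 0 - y 0 * p2 0"
    by (rule wronskian_constant[where X = X and \<alpha> = \<alpha> and \<beta> = "\<lambda>s. \<mu> * \<beta> s"]) (use X y q dX s in auto)
  have D: "?p s * u2 s - ?u s * p2 s = 1" using det s X(3) by auto
  have 1: "q s * ?u s - y s * ?p s = 0" and 2: "q s * u2 s - y s * p2 s = q 0"
    using W1 W2 by (simp_all add: sl_initial[OF \<alpha> \<beta>] i2 y0)
  have "y s = y s * (?p s * u2 s - ?u s * p2 s)" using D by simp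
  also have "\<dots> = ?u s * (q s * u2 s - y s * p2 s) - u2 s * (q s * ?u s - y s * ?p s)" by (simp add: algebra_simps)
  finally show "y s = q 0 * ?u s" using 1 2 by simp
  have "q s = q s * (?p s * u2 s - ?u s * p2 s)" using D by simp
  also have "\<dots> = ?p s * (q s * u2 s - y s * p2 s) - p2 s * (q s * ?u s - y s * ?p s)" by (simp add: algebra_simps)
  finally show "q s = q 0 * ?p s" using 1 2 by simp
qed

section \<open>The solution defining the extremal length\<close>

lemma D0_eqI:
  assumes "(f has_real_derivative d) (at s within {0..})" "0 \<le> s"
  shows "D0 f s = d"
proof -
  have "at s within {0..} \<noteq> bot"
    using assms(2) not_trivial_limit_within_ball[of s "{0..}"]
    by (metis atLeast_iff connected_imp_perfect convex_connected convex_real_interval(1) infinite_Ici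
        finite.emptyI finite.insertI insert_iff trivial_limit_within)
  then show ?thesis
    unfolding D0_def using assms(1)
    by (intro vector_derivative_within) (auto simp: has_real_derivative_iff_has_vector_derivative)
qed

lemma has_real_derivative_D0:
  assumes "f differentiable_on {0..}" "0 \<le> s"
  shows "(f has_real_derivative D0 f s) (at s within {0..})"
  using assms unfolding D0_def differentiable_on_def has_real_derivative_iff_has_vector_derivative
  by (auto simp: vector_derivative_works)

lemma differentiable_on_halflineI:
  assumes "\<And>s. 0 \<le> s \<Longrightarrow> (f has_real_derivative d s) (at s within {0..})"
  shows "f differentiable_on {0..}"
  using assms unfolding differentiable_on_def has_field_derivative_def differentiable_def by (metis atLeast_iff)

locale half_line_weight =
  fixes m :: "real \<Rightarrow> real" and \<omega> r :: real
  assumes m_C1: "C1_halfline m" and m_pos: "0 \<le> s \<Longrightarrow> 0 < m s" and r_pos: "0 < r"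
begin

abbreviation n :: "real \<Rightarrow> real"
  where "n \<equiv> n_hat m \<omega>"

text \<open>With \<open>\<beta>\<close>, the coefficients of the first-order form u' = \<alpha> p,
  p' = - \<beta> u of the equation in \<open>is_u_hat\<close>, where p stands for n^2 u' /
  r.\<close>

definition \<alpha> :: "real \<Rightarrow> real"
  where "\<alpha> s = r / (n s)\<^sup>2"

definition \<beta> :: "real \<Rightarrow> real"
  where "\<beta> s = r * (n s)\<^sup>2"

definition u :: "real \<Rightarrow> real"
  where "u = sl_u \<alpha> \<beta> 1"

definition p :: "real \<Rightarrow> real"
  where "p = sl_p \<alpha> \<beta> 1"

lemma n_pos: "0 \<le> s \<Longrightarrow> 0 < n s"
  by (simp add: n_hat_def m_pos)

lemma m_cont: "continuous_on {0..} m"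
  using m_C1 by (auto simp: C1_halfline_def intro: differentiable_imp_continuous_on)

lemma n_cont: "continuous_on {0..} n"
  unfolding n_hat_def by (intro continuous_intros m_cont)

lemma \<alpha>_cont: "continuous_on {0..} \<alpha>"
  unfolding \<alpha>_def by (intro continuous_intros n_cont) (auto dest: n_pos)

lemma \<beta>_cont: "continuous_on {0..} \<beta>"
  unfolding \<beta>_def by (intro continuous_intros n_cont)

lemma u_deriv: "0 \<le> s \<Longrightarrow> (u has_real_derivative r * p s / (n s)\<^sup>2) (at s within {0..})"
  using sl_deriv(1)[OF \<alpha>_cont \<beta>_cont, of s 1] by (simp add: u_def p_def \<alpha>_def)

lemma p_deriv: "0 \<le> s \<Longrightarrow> (p has_real_derivative - r * (n s)\<^sup>2 * u s) (at s within {0..})"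
  using sl_deriv(2)[OF \<alpha>_cont \<beta>_cont, of s 1] by (simp add: u_def p_def \<beta>_def)

lemma deriv_interior:
  assumes "0 < s"
  shows "(u has_real_derivative r * p s / (n s)\<^sup>2) (at s)" "(p has_real_derivative - r * (n s)\<^sup>2 * u s) (at s)"
proof -
  have "at s within {0..} = at s" using assms by (intro at_within_interior) simp
  then show "(u has_real_derivative r * p s / (n s)\<^sup>2) (at s)" "(p has_real_derivative - r * (n s)\<^sup>2 * u s) (at s)"
    using u_deriv[of s] p_deriv[of s] assms by auto
qed

lemma u_0 [simp]: "u 0 = 0" and p_0 [simp]: "p 0 = 1"
  using sl_initial[OF \<alpha>_cont \<beta>_cont] by (simp_all add: u_def p_def)

lemma u_cont: "continuous_on {0..} u" and p_cont: "continuous_on {0..} p"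
  using u_deriv p_deriv by (auto intro!: DERIV_continuous_on)

lemma is_u_hat_u: "is_u_hat m \<omega> r u"
proof -
  have D: "D0 u s = r * p s / (n s)\<^sup>2" if "0 \<le> s" for s
    using u_deriv[OF that] that by (rule D0_eqI)
  have q: "(n s)\<^sup>2 * (1 / r * D0 u s) = p s" if "0 \<le> s" for s
    using that n_pos[of s] r_pos by (simp add: D)
  have qd: "((\<lambda>s. (n s)\<^sup>2 * (1 / r * D0 u s)) has_real_derivative - r * (n s)\<^sup>2 * u s) (at s within {0..})"
    if "0 \<le> s" for s
    by (rule DERIV_transform_on[OF p_deriv[OF that]]) (use that q in auto)
  show ?thesis
    unfolding is_u_hat_def
  proof (intro conjI allI impI)
    show "u differentiable_on {0..}" by (rule differentiable_on_halflineI[OF u_deriv])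
    show "(\<lambda>s. (n s)\<^sup>2 * (1 / r * D0 u s)) differentiable_on {0..}"
      by (rule differentiable_on_halflineI[OF qd])
    fix s :: real assume "0 \<le> s"
    then show "1 / r * D0 (\<lambda>s. (n s)\<^sup>2 * (1 / r * D0 u s)) s + (n s)\<^sup>2 * u s = 0"
      using D0_eqI[OF qd, of s] r_pos by simp
  qed (use D[of 0] n_pos[of 0] r_pos in auto)
qed

text \<open>\<open>v\<close> and its quasi-derivative \<open>q\<close> solve the system of
  \<open>u\<close> and \<open>p\<close>, so uniqueness gives the factor \<open>q 0\<close>, positive
  because \<open>D0 v 0\<close> is. This neutralizes the choice hidden in
  \<open>u_hat\<close>.\<close>

lemma is_u_hat_multiple:
  assumes "is_u_hat m \<omega> r v"
  shows "\<exists>c>0. \<forall>s\<ge>0. v s = c * u s \<and> D0 v s = c * (r * p s / (n s)\<^sup>2)"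
proof -
  define q where "q s = (n s)\<^sup>2 * (1 / r * D0 v s)" for s
  have *: "v differentiable_on {0..}" "q differentiable_on {0..}" "v 0 = 0" "0 < D0 v 0"
    "\<And>s. 0 \<le> s \<Longrightarrow> 1 / r * D0 q s + (n s)\<^sup>2 * v s = 0"
    using assms by (auto simp: is_u_hat_def q_def[abs_def])
  have vq: "D0 v s = \<alpha> s * q s" if "0 \<le> s" for s
    using n_pos[OF that] r_pos by (simp add: \<alpha>_def q_def)
  have vd: "(v has_real_derivative \<alpha> s * q s) (at s within {0..})" if "s \<in> {0..}" for s
    using has_real_derivative_D0[OF *(1), of s] vq[of s] that by simp
  have qd: "(q has_real_derivative - (1 * \<beta> s * v s)) (at s within {0..})" if "s \<in> {0..}" for s
  proof -
    have "D0 q s = - (1 * \<beta> s * v s)"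
      using *(5)[of s] that r_pos by (simp add: \<beta>_def field_simps)
    then show ?thesis using has_real_derivative_D0[OF *(2), of s] that by simp
  qed
  have vs: "v s = q 0 * u s" "q s = q 0 * p s" if "0 \<le> s" for s
    using sl_unique[OF \<alpha>_cont \<beta>_cont convex_real_interval(1) _ _ vd qd *(3), of s] that by (simp_all add: u_def p_def)
  moreover have "0 < q 0" using *(4) n_pos[of 0] r_pos by (simp add: q_def)
  moreover have "D0 v s = q 0 * (r * p s / (n s)\<^sup>2)" if "0 \<le> s" for s
    unfolding vq[OF that] vs(2)[OF that] by (simp add: \<alpha>_def)
  ultimately show ?thesis using vs(1) by blast
qed

lemma u_hat_multiple: "\<exists>c>0. \<forall>s\<ge>0. u_hat m \<omega> r s = c * u s \<and> D0 (u_hat m \<omega> r) s = c * (r * p s / (n s)\<^sup>2)"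
  unfolding u_hat_def by (rule is_u_hat_multiple) (rule someI[where P = "is_u_hat m \<omega> r", OF is_u_hat_u])

lemma psi_hat_eq:
  assumes "0 \<le> s"
  shows "psi_hat m \<omega> r s = p s / ((n s)\<^sup>2 * u s)"
proof -
  obtain c where c: "0 < c" "u_hat m \<omega> r s = c * u s" "D0 (u_hat m \<omega> r) s = c * (r * p s / (n s)\<^sup>2)"
    using u_hat_multiple assms by blast
  then show ?thesis using r_pos unfolding psi_hat_def c(2,3) by simp
qed

section \<open>The extremal length and the optimality of the bound\<close>

definition admissible :: "ereal \<Rightarrow> bool"
  where "admissible a \<longleftrightarrow> 0 < a \<and> (\<forall>s>0. ereal s < a \<longrightarrow> 0 < u s \<and> (n s)\<^sup>2 * u s < p s)"

lemma a_hat_star_eq: "a_hat_star m \<omega> r = (GREATEST a. admissible a)"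
proof -
  obtain c where c: "0 < c" "\<And>s. 0 \<le> s \<Longrightarrow> u_hat m \<omega> r s = c * u s"
    "\<And>s. 0 \<le> s \<Longrightarrow> D0 (u_hat m \<omega> r) s = c * (r * p s / (n s)\<^sup>2)"
    using u_hat_multiple by blast
  have "0 < u_hat m \<omega> r s \<and> u_hat m \<omega> r s < D0 (u_hat m \<omega> r) s / r \<longleftrightarrow> 0 < u s \<and> (n s)\<^sup>2 * u s < p s"
    if "0 < s" for s
    using that c n_pos[of s] r_pos by (simp add: zero_less_mult_iff field_simps)
  then show ?thesis unfolding a_hat_star_def admissible_def by (metis (no_types, lifting))
qed

text \<open>Positivity of \<open>p\<close> persists near \<open>a\<close> and keeps \<open>u\<close>
  increasing, hence positive; the strict inequality persists by continuity. Used at 0, where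
  \<open>u\<close> vanishes, and at a supposed end where the inequality is still strict.\<close>

lemma admissible_extend:
  assumes a: "0 \<le> a" "0 \<le> u a" "0 < p a" "(n a)\<^sup>2 * u a < p a"
    and below: "\<And>s. 0 < s \<Longrightarrow> s \<le> a \<Longrightarrow> 0 < u s \<and> (n s)\<^sup>2 * u s < p s"
  shows "\<exists>e>0. admissible (ereal (a + e))"
proof -
  define F where "F s = min (p s) (p s - (n s)\<^sup>2 * u s)" for s
  have "continuous_on {0..} F" unfolding F_def by (intro continuous_intros u_cont p_cont n_cont)
  moreover have "0 < F a" using a by (simp add: F_def)
  ultimately obtain e where e: "0 < e" "\<And>s. 0 \<le> s \<Longrightarrow> \<bar>s - a\<bar> < e \<Longrightarrow> \<bar>F s - F a\<bar> < F a"
    using a(1) unfolding continuous_on_iff dist_real_def by (metis atLeast_iff)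
  have F: "0 < F s" if "a \<le> s" "s < a + e" for s
  proof -
    have "\<bar>F s - F a\<bar> < F a" using e(2)[of s] that a(1) by auto
    then show ?thesis by linarith
  qed
  have "0 < u s \<and> (n s)\<^sup>2 * u s < p s" if s: "0 < s" "s < a + e" for s
  proof (cases "s \<le> a")
    case False
    have "u a < u s"
    proof (rule DERIV_pos_imp_increasing_open[where f = u])
      show "continuous_on {a..s} u" using a(1) by (intro continuous_on_subset[OF u_cont]) auto
      show "\<exists>y. (u has_real_derivative y) (at x) \<and> 0 < y" if "a < x" "x < s" for x
      proof -
        have "0 < p x" using F[of x] that s by (simp add: F_def)
        then have "0 < r * p x / (n x)\<^sup>2" using n_pos[of x] that a(1) r_pos by simp
        then show ?thesis using deriv_interior(1)[of x] that a(1) by auto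
      qed
    qed (use False in simp)
    then show ?thesis using F[of s] False s a(2) by (simp add: F_def)
  qed (use below s in auto)
  then show ?thesis using e(1) a(1) by (intro exI[of _ e]) (auto simp: admissible_def)
qed

text \<open>\<open>GREATEST\<close> is meaningful only if the supremum is itself admissible. It is,
  because admissibility constrains only points strictly below the length.\<close>

lemma admissible_Sup: "admissible (Sup {a. admissible a})"
proof -
  obtain e where e: "0 < e" "admissible (ereal (0 + e))"
    using admissible_extend[of 0] by (auto simp: n_pos)
  have "0 < ereal (0 + e)" using e by simp
  also have "\<dots> \<le> Sup {a. admissible a}" using e(2) by (intro Sup_upper) simp
  finally show ?thesis
    unfolding admissible_def[of "Sup _"] by (auto simp: less_Sup_iff admissible_def)
qed

lemma admissible_a_hat_star: "admissible (a_hat_star m \<omega> r)"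
  and admissible_le_a_hat_star: "admissible a \<Longrightarrow> a \<le> a_hat_star m \<omega> r"
proof -
  have "a_hat_star m \<omega> r = Sup {a. admissible a}"
    unfolding a_hat_star_eq by (rule Greatest_equality[where P = admissible, OF admissible_Sup]) (auto intro: Sup_upper)
  then show "admissible (a_hat_star m \<omega> r)" "admissible a \<Longrightarrow> a \<le> a_hat_star m \<omega> r"
    using admissible_Sup by (auto intro: Sup_upper)
qed

text \<open>The endpoint is included: \<open>u\<close> is positive there because it increases, while
  the inequality with \<open>p\<close> survives in weak form, by continuity.\<close>

lemma below_a_hat_star:
  assumes s: "0 < s" "ereal s \<le> a_hat_star m \<omega> r"
  shows "0 < u s" "(n s)\<^sup>2 * u s \<le> p s"
proof -
  have g: "0 < u x \<and> (n x)\<^sup>2 * u x < p x" if "0 < x" "x < s" for x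
    using admissible_a_hat_star s(2) that unfolding admissible_def by (metis ereal_less_eq(3) less_ereal.simps(1) less_le_trans)
  have "u 0 < u s"
  proof (rule DERIV_pos_imp_increasing_open[where f = u])
    show "continuous_on {0..s} u" by (intro continuous_on_subset[OF u_cont]) auto
    show "\<exists>y. (u has_real_derivative y) (at x) \<and> 0 < y" if "0 < x" "x < s" for x
    proof -
      have "0 < (n x)\<^sup>2 * u x" using g[OF that] n_pos[of x] that by simp
      then have "0 < p x" using g[OF that] by simp
      then have "0 < r * p x / (n x)\<^sup>2" using n_pos[of x] that r_pos by simp
      then show ?thesis using deriv_interior(1)[of x] that by auto
    qed
  qed (use s in simp)
  then show "0 < u s" by simp
  have "0 \<le> p s - (n s)\<^sup>2 * u s"
  proof (rule continuous_ge_on_closure[where f = "\<lambda>s. p s - (n s)\<^sup>2 * u s" and x = s and S = "{0<..<s}"])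
    show "continuous_on (closure {0<..<s}) (\<lambda>s. p s - (n s)\<^sup>2 * u s)"
      using s by (intro continuous_intros continuous_on_subset[OF p_cont] continuous_on_subset[OF n_cont]
          continuous_on_subset[OF u_cont]) auto
    show "s \<in> closure {0<..<s}" using s by simp
  qed (use g in \<open>force intro: less_imp_le\<close>)
  then show "(n s)\<^sup>2 * u s \<le> p s" by simp
qed

text \<open>A strict inequality at \<open>a\<close> would let \<open>admissible_extend\<close> go
  past the greatest admissible length.\<close>

lemma at_a_hat_star:
  assumes "a_hat_star m \<omega> r = ereal a"
  shows "0 < a" "(n a)\<^sup>2 * u a = p a"
proof -
  show a: "0 < a" using admissible_a_hat_star by (simp add: assms admissible_def)
  show "(n a)\<^sup>2 * u a = p a"
  proof (rule ccontr)
    assume "(n a)\<^sup>2 * u a \<noteq> p a"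
    then have lt: "(n a)\<^sup>2 * u a < p a" and ua: "0 < u a"
      using below_a_hat_star[of a] a assms by auto
    have "0 < (n a)\<^sup>2 * u a" using ua n_pos[of a] a by simp
    then have "0 < p a" using lt by simp
    moreover have "0 < u s \<and> (n s)\<^sup>2 * u s < p s" if "0 < s" "s \<le> a" for s
      using that lt ua admissible_a_hat_star by (cases "s = a") (auto simp: admissible_def assms)
    ultimately obtain e where "0 < e" "admissible (ereal (a + e))"
      using admissible_extend[of a] a lt ua by auto
    then show False using admissible_le_a_hat_star[of "ereal (a + e)"] by (simp add: assms)
  qed
qed

text \<open>Since n^2 times \<open>psi_hat\<close> is p / u, the bound separates into a factor in
  \<open>a\<close> and the same factor in \<open>b\<close>; optimality becomes monotonicity of a
  single function.\<close>

lemma semigroup_bound_eq: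
  assumes "0 < a" "ereal a \<le> a_hat_star m \<omega> r" "0 < b" "ereal b \<le> a_hat_star m \<omega> r"
  shows "semigroup_bound m \<omega> r t a b =
    exp ((\<omega> - r) * t) * sqrt (exp (2 * r * a) * p a / u a) * sqrt (exp (2 * r * b) * p b / u b)"
proof -
  have g: "exp ((r - \<omega>) * a) * m a * sqrt (psi_hat m \<omega> r a) = sqrt (exp (2 * r * a) * p a / u a)"
    if a: "0 < a" "ereal a \<le> a_hat_star m \<omega> r" for a
  proof -
    have na: "0 < n a" using n_pos a by simp
    have "exp (2 * r * a) * p a / u a = (exp (r * a) * n a)\<^sup>2 * psi_hat m \<omega> r a"
      using na a by (simp add: psi_hat_eq power_mult_distrib exp_double[symmetric] mult.assoc)
    then have "sqrt (exp (2 * r * a) * p a / u a) = exp (r * a) * n a * sqrt (psi_hat m \<omega> r a)"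
      using na by (simp add: real_sqrt_mult)
    moreover have "exp (r * a) * n a = exp ((r - \<omega>) * a) * m a"
      unfolding n_hat_def mult.assoc[symmetric] mult_exp_exp by (simp add: algebra_simps)
    ultimately show ?thesis by simp
  qed
  have "exp ((\<omega> - r) * (t - (a + b))) = exp ((\<omega> - r) * t) * exp ((r - \<omega>) * a) * exp ((r - \<omega>) * b)"
    unfolding mult_exp_exp by (simp add: algebra_simps)
  then show ?thesis
    unfolding semigroup_bound_def g[OF assms(1,2), symmetric] g[OF assms(3,4), symmetric] by (simp add: mult_ac)
qed

text \<open>The derivative is minus a square, - r exp (2 r s) (p / n - n u)^2 / u^2, which vanishes
  exactly where p = n^2 u.\<close>

lemma bound_factor_antimono:
  assumes "0 < a" "a \<le> b" "ereal b \<le> a_hat_star m \<omega> r"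
  shows "exp (2 * r * b) * p b / u b \<le> exp (2 * r * a) * p a / u a"
proof (rule DERIV_nonpos_imp_nonincreasing[OF assms(2), where f = "\<lambda>s. exp (2 * r * s) * p s / u s"])
  fix s :: real assume s: "a \<le> s" "s \<le> b"
  then have s0: "0 < s" and us: "0 < u s"
    using assms below_a_hat_star(1)[of s] order_trans[of "ereal s" "ereal b"] by auto
  have ns: "0 < n s" using n_pos s0 by simp
  let ?d = "((exp (2 * r * s) * (2 * r) * p s + - r * (n s)\<^sup>2 * u s * exp (2 * r * s)) * u s
      - exp (2 * r * s) * p s * (r * p s / (n s)\<^sup>2)) / (u s * u s)"
  have "((\<lambda>s. exp (2 * r * s)) has_real_derivative exp (2 * r * s) * (2 * r)) (at s)"
    by (auto intro!: derivative_eq_intros)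
  from DERIV_divide[OF DERIV_mult[OF this deriv_interior(2)[OF s0]] deriv_interior(1)[OF s0]]
  have "((\<lambda>s. exp (2 * r * s) * p s / u s) has_real_derivative ?d) (at s)"
    using us by simp
  moreover have "?d = - (exp (2 * r * s) * r * (p s / n s - n s * u s)\<^sup>2 / (u s)\<^sup>2)"
  proof -
    have "(E * (2 * r) * P + - r * N\<^sup>2 * U * E) * U - E * P * (r * P / N\<^sup>2) = - (E * r * (P / N - N * U)\<^sup>2)"
      if "0 < N" for E P N U :: real
      using that by (simp add: power2_diff power_mult_distrib power_divide algebra_simps power2_eq_square)
    from this[OF ns] show ?thesis by (simp add: power2_eq_square)
  qed
  then have "?d \<le> 0" using r_pos by simp
  ultimately show "\<exists>y. ((\<lambda>s. exp (2 * r * s) * p s / u s) has_real_derivative y) (at s) \<and> y \<le> 0"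
    by (intro exI conjI)
qed

lemma bound_factor_nonneg:
  assumes "0 < a" "ereal a \<le> a_hat_star m \<omega> r"
  shows "0 \<le> exp (2 * r * a) * p a / u a"
proof -
  have "0 \<le> (n a)\<^sup>2 * u a" using below_a_hat_star(1)[OF assms] by simp
  then have "0 \<le> p a" using below_a_hat_star(2)[OF assms] by linarith
  then show ?thesis using below_a_hat_star(1)[OF assms] by simp
qed

lemma semigroup_bound_optimal:
  assumes A: "a_hat_star m \<omega> r = ereal A"
  shows "\<And>a b. a \<in> {0<..A} \<Longrightarrow> b \<in> {0<..A} \<Longrightarrow> semigroup_bound m \<omega> r t A A \<le> semigroup_bound m \<omega> r t a b"
    and "semigroup_bound m \<omega> r t A A = exp ((\<omega> - r) * (t - 2 * A)) * (m A)\<^sup>2"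
proof -
  have A0: "0 < A" "(n A)\<^sup>2 * u A = p A" using at_a_hat_star[OF A] by auto
  show "semigroup_bound m \<omega> r t A A \<le> semigroup_bound m \<omega> r t a b" if "a \<in> {0<..A}" "b \<in> {0<..A}" for a b
  proof -
    have "sqrt (exp (2 * r * A) * p A / u A) * sqrt (exp (2 * r * A) * p A / u A) \<le>
        sqrt (exp (2 * r * a) * p a / u a) * sqrt (exp (2 * r * b) * p b / u b)"
      using that A0 A by (intro mult_mono real_sqrt_le_mono bound_factor_antimono real_sqrt_ge_zero bound_factor_nonneg) auto
    from mult_left_mono[OF this, of "exp ((\<omega> - r) * t)"]
    have "exp ((\<omega> - r) * t) * sqrt (exp (2 * r * A) * p A / u A) * sqrt (exp (2 * r * A) * p A / u A) \<le>
        exp ((\<omega> - r) * t) * sqrt (exp (2 * r * a) * p a / u a) * sqrt (exp (2 * r * b) * p b / u b)"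
      unfolding mult.assoc by simp
    then show ?thesis
      using that A0 A by (simp only: semigroup_bound_eq greaterThanAtMost_iff ereal_less_eq order_refl)
  qed
  have "psi_hat m \<omega> r A = 1"
    using A0 below_a_hat_star(1)[of A] A n_pos[of A] by (simp add: psi_hat_eq A0(2)[symmetric])
  then show "semigroup_bound m \<omega> r t A A = exp ((\<omega> - r) * (t - 2 * A)) * (m A)\<^sup>2"
    by (simp add: semigroup_bound_def power2_eq_square mult.assoc)
qed

end

section \<open>The Dirichlet-Robin eigenvalue problem\<close>

lemma ac_deriv_has_integral:
  assumes "ac_deriv a f g" "s \<in> {0..a}"
  shows "(g has_integral (f s - f 0)) {0..s}"
proof -
  have "g absolutely_integrable_on {0..s}"
    using assms by (auto simp: ac_deriv_def intro: absolutely_integrable_on_subinterval)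
  then have "(g has_integral (LINT t:{0..s}|lebesgue. g t)) {0..s}"
    by (rule has_integral_set_lebesgue)
  moreover have "f s = f 0 + (LINT t:{0..s}|lebesgue. g t)"
    using assms unfolding ac_deriv_def by blast
  ultimately show ?thesis by (metis add_diff_cancel_left')
qed

lemma ac_deriv_continuous:
  assumes "ac_deriv a f g" "0 \<le> a"
  shows "continuous_on {0..a} f"
proof -
  have "g integrable_on {0..a}"
    using ac_deriv_has_integral[OF assms(1), of a] assms(2) by auto
  then have "continuous_on {0..a} (\<lambda>s. f 0 + integral {0..s} g)"
    by (intro continuous_intros indefinite_integral_continuous_1)
  moreover have "f 0 + integral {0..s} g = f s" if "s \<in> {0..a}" for s
    using integral_unique[OF ac_deriv_has_integral[OF assms(1) that]] by simp
  ultimately show ?thesis by (rule continuous_on_eq)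
qed

text \<open>The passage from weak to classical solutions: the integrand may be replaced by the
  continuous function \<open>h\<close>, and the fundamental theorem then gives a derivative at every
  point.\<close>

lemma ac_deriv_classical:
  assumes f: "ac_deriv a f g" and ae: "AE s in lebesgue. s \<in> {0<..<a} \<longrightarrow> g s = h s"
    and h: "continuous_on {0..a} h" and s: "s \<in> {0..a}"
  shows "(f has_vector_derivative h s) (at s within {0..a})"
proof -
  obtain N where N: "negligible N" "{s. \<not> (s \<in> {0<..<a} \<longrightarrow> g s = h s)} \<subseteq> N"
    using ae unfolding eventually_ae_filter negligible_iff_null_sets by auto
  have gh: "g x = h x" if "0 < x" "x < a" "x \<notin> N" for x
    using N(2) that by auto
  have eq: "f 0 + integral {0..x} h = f x" if x: "x \<in> {0..a}" for x
  proof -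
    have "integral {0..x} g = integral {0..x} h"
      by (rule integral_spike[of "insert 0 (insert a N)"]) (use N(1) gh x in auto)
    then show ?thesis
      using integral_unique[OF ac_deriv_has_integral[OF f x]] by (metis add.commute diff_add_cancel)
  qed
  have "((\<lambda>x. f 0 + integral {0..x} h) has_vector_derivative 0 + h s) (at s within {0..a})"
    by (intro has_vector_derivative_add has_vector_derivative_const integral_has_vector_derivative h s)
  then show ?thesis
    by (intro has_vector_derivative_transform[OF s eq[symmetric]]) simp_all
qed

lemma ac_derivI:
  assumes "\<And>s. s \<in> {0..a} \<Longrightarrow> (f has_vector_derivative g s) (at s within {0..a})"
    and g: "continuous_on {0..a} g"
  shows "ac_deriv a f g"
  unfolding ac_deriv_def
proof (intro conjI ballI)
  show "set_integrable lebesgue {0..a} g"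
    using absolutely_integrable_continuous_real[OF g] .
  fix s assume s: "s \<in> {0..a}"
  have "set_integrable lebesgue {0..s} g"
    using s by (intro absolutely_integrable_continuous_real continuous_on_subset[OF g]) auto
  then have "(LINT t:{0..s}|lebesgue. g t) = integral {0..s} g"
    by (rule set_lebesgue_integral_eq_integral)
  also have "\<dots> = f s - f 0"
  proof (rule integral_unique[OF fundamental_theorem_of_calculus])
    fix x assume "x \<in> {0..s}"
    then show "(f has_vector_derivative g x) (at x within {0..s})"
      using s by (intro has_vector_derivative_within_subset[OF assms(1)]) auto
  qed (use s in simp)
  finally show "f s = f 0 + (LINT t:{0..s}|lebesgue. g t)" by simp
qed

text \<open>Positivity near 0 is a separate assumption because \<open>f\<close> may vanish at 0, as
  \<open>U \<mu>\<close> does; it confines the search to the compact interval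
  \<open>{d..a}\<close>.\<close>

lemma first_zero:
  fixes f :: "real \<Rightarrow> real"
  assumes f: "continuous_on {0..a} f" and d: "0 < d" "\<And>s. 0 < s \<Longrightarrow> s \<le> d \<Longrightarrow> 0 < f s"
    and x: "0 < x" "x \<le> a" "f x \<le> 0"
  obtains z where "0 < z" "z \<le> a" "f z = 0" "\<And>s. 0 < s \<Longrightarrow> s < z \<Longrightarrow> 0 < f s"
proof -
  define Z where "Z = {d..a} \<inter> {s \<in> {d..a}. f s \<le> 0}"
  have xd: "d < x" using d(2)[of x] x by force
  have "closed {s \<in> {d..a}. f s \<le> 0}"
    using d(1) by (intro continuous_on_closed_Collect_le continuous_on_subset[OF f] continuous_intros) auto
  then have "compact Z" unfolding Z_def by (intro compact_Int_closed) auto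
  moreover have "x \<in> Z" using x xd by (auto simp: Z_def)
  then have "Z \<noteq> {}" by blast
  ultimately obtain z where z: "z \<in> Z" "\<And>s. s \<in> Z \<Longrightarrow> z \<le> s"
    using continuous_attains_inf[of Z "\<lambda>x. x"] continuous_on_id by blast
  have pos: "0 < f s" if "0 < s" "s < z" for s
  proof (cases "s \<le> d")
    case False
    then show ?thesis using z(2)[of s] that z(1) by (force simp: Z_def)
  qed (use d that in auto)
  have z0: "0 < z" "z \<le> a" "f z \<le> 0" using z(1) d(1) by (auto simp: Z_def)
  have "0 \<le> f z"
  proof (rule continuous_ge_on_closure[where f = f and x = z and S = "{0<..<z}"])
    show "continuous_on (closure {0<..<z}) f" using z0 by (intro continuous_on_subset[OF f]) auto
    show "z \<in> closure {0<..<z}" using z0 by simp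
  qed (use pos in \<open>force intro: less_imp_le\<close>)
  then show ?thesis using that z0 pos by force
qed

text \<open>The normalized case \<omega> = 0, r = 1, in which the equation of
  \<open>is_u_hat\<close> becomes that of \<open>is_u0\<close>.\<close>

locale sturm_liouville = half_line_weight m 0 1 for m
begin

lemma n_eq [simp]: "n = m"
  by (simp add: n_hat_def fun_eq_iff)

text \<open>For \<mu> = 1 + l this is the only candidate, up to a factor, for an eigenfunction with
  eigenvalue l; \<mu> = 1 gives \<open>u\<close>.\<close>

definition U :: "real \<Rightarrow> real \<Rightarrow> real"
  where "U \<mu> = sl_u \<alpha> \<beta> \<mu>"

definition P :: "real \<Rightarrow> real \<Rightarrow> real"
  where "P \<mu> = sl_p \<alpha> \<beta> \<mu>"

lemma u_eq: "u = U 1" and p_eq: "p = P 1"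
  by (simp_all add: u_def p_def U_def P_def)

lemma UP_0 [simp]: "U \<mu> 0 = 0" "P \<mu> 0 = 1"
  using sl_initial[OF \<alpha>_cont \<beta>_cont] by (simp_all add: U_def P_def)

lemma UP_deriv:
  assumes "0 \<le> s"
  shows "(U \<mu> has_real_derivative P \<mu> s / (m s)\<^sup>2) (at s within {0..})"
    "(P \<mu> has_real_derivative - (\<mu> * (m s)\<^sup>2 * U \<mu> s)) (at s within {0..})"
  using sl_deriv[OF \<alpha>_cont \<beta>_cont assms, of \<mu>] by (simp_all add: U_def P_def \<alpha>_def \<beta>_def)

lemma UP_deriv_at:
  assumes "0 < s"
  shows "(U \<mu> has_real_derivative P \<mu> s / (m s)\<^sup>2) (at s)"
    "(P \<mu> has_real_derivative - (\<mu> * (m s)\<^sup>2 * U \<mu> s)) (at s)"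
proof -
  have "at s within {0..} = at s" using assms by (intro at_within_interior) simp
  then show "(U \<mu> has_real_derivative P \<mu> s / (m s)\<^sup>2) (at s)"
    "(P \<mu> has_real_derivative - (\<mu> * (m s)\<^sup>2 * U \<mu> s)) (at s)"
    using UP_deriv[of s \<mu>] assms by auto
qed

lemma UP_cont: "continuous_on {0..a} (U \<mu>)" "continuous_on {0..a} (P \<mu>)"
proof -
  have "continuous_on {0..} (U \<mu>)" "continuous_on {0..} (P \<mu>)"
    using UP_deriv by (auto intro!: DERIV_continuous_on)
  then show "continuous_on {0..a} (U \<mu>)" "continuous_on {0..a} (P \<mu>)"
    by (auto intro: continuous_on_subset)
qed

lemma UP_jointly_cont:
  assumes "0 \<le> a" "0 \<le> R"
  shows "continuous_on ({-R..R} \<times> {0..a}) (\<lambda>z. U (fst z) (snd z))"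
    "continuous_on ({-R..R} \<times> {0..a}) (\<lambda>z. P (fst z) (snd z))"
  using continuous_on_sl[OF \<alpha>_cont \<beta>_cont assms] by (simp_all add: U_def P_def)

lemma UP_cont_param:
  assumes "0 \<le> s"
  shows "continuous_on {c..d} (\<lambda>\<mu>. U \<mu> s)" "continuous_on {c..d} (\<lambda>\<mu>. P \<mu> s)"
proof -
  define R where "R = max \<bar>c\<bar> \<bar>d\<bar>"
  have sub: "(\<lambda>\<mu>. (\<mu>, s)) ` {c..d} \<subseteq> {-R..R} \<times> {0..s}" using assms by (auto simp: R_def)
  have R: "0 \<le> R" by (simp add: R_def)
  have pair: "continuous_on {c..d} (\<lambda>\<mu>. (\<mu>, s))" by (intro continuous_intros)
  show "continuous_on {c..d} (\<lambda>\<mu>. U \<mu> s)" "continuous_on {c..d} (\<lambda>\<mu>. P \<mu> s)"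
    using continuous_on_compose2[OF UP_jointly_cont(1)[OF assms R] pair sub]
      continuous_on_compose2[OF UP_jointly_cont(2)[OF assms R] pair sub] by simp_all
qed

lemma UP_nonzero: "0 \<le> s \<Longrightarrow> U \<mu> s \<noteq> 0 \<or> P \<mu> s \<noteq> 0"
  using sl_fundamental_system[OF \<alpha>_cont \<beta>_cont, of \<mu>] unfolding U_def P_def
  by (metis diff_self mult_zero_left zero_neq_one)

text \<open>An eigenfunction is complex and only in H^2. \<open>ac_deriv_classical\<close> makes it
  a classical solution; its real and imaginary parts solve the real system with parameter
  \<open>1 + l\<close>, so it is a nonzero complex multiple of \<open>U (1 + l)\<close>, and its
  Robin condition passes to that function.\<close>

lemma eigenvalue_DR_imp:
  assumes a: "0 < a" and ev: "eigenvalue_DR m a l"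
  shows "P (1 + l) a = (m a)\<^sup>2 * U (1 + l) a"
proof -
  obtain y y' w y'' where y: "ac_deriv a y y'" "ac_deriv a y' y''" "y 0 = 0" "y' a = y a"
    and w: "ac_deriv a (\<lambda>s. complex_of_real ((m s)\<^sup>2) * y' s) w"
    and ae: "AE s in lebesgue. s \<in> {0<..<a} \<longrightarrow>
      complex_of_real l * y s = - (1 / complex_of_real ((m s)\<^sup>2)) * w s - y s"
    and nt: "\<not> (AE s in lebesgue. s \<in> {0<..<a} \<longrightarrow> y s = 0)"
    using ev unfolding eigenvalue_DR_def K_DR_def sobolev_H2_def by blast
  define q where "q s = complex_of_real ((m s)\<^sup>2) * y' s" for s
  have mc: "continuous_on {0..a} m" by (intro continuous_on_subset[OF m_cont]) auto
  have yc: "continuous_on {0..a} y" using ac_deriv_continuous[OF y(1)] a by simp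
  have y'c: "continuous_on {0..a} y'" using ac_deriv_continuous[OF y(2)] a by simp
  have yd: "(y has_vector_derivative y' s) (at s within {0..a})" if "s \<in> {0..a}" for s
    by (rule ac_deriv_classical[OF y(1) _ y'c that]) simp
  have "AE s in lebesgue. s \<in> {0<..<a} \<longrightarrow> w s = - (complex_of_real ((1 + l) * (m s)\<^sup>2) * y s)"
    using ae
  proof eventually_elim
    case (elim s)
    show ?case
    proof
      assume s: "s \<in> {0<..<a}"
      then have "complex_of_real ((m s)\<^sup>2) \<noteq> 0" using m_pos[of s] by simp
      moreover have "complex_of_real l * y s = - (1 / complex_of_real ((m s)\<^sup>2)) * w s - y s" using elim s by blast
      ultimately show "w s = - (complex_of_real ((1 + l) * (m s)\<^sup>2) * y s)"
        by (simp add: field_simps)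
    qed
  qed
  then have qd: "(q has_vector_derivative - (complex_of_real ((1 + l) * (m s)\<^sup>2) * y s)) (at s within {0..a})"
    if "s \<in> {0..a}" for s
    unfolding q_def by (rule ac_deriv_classical[OF w _ _ that]) (intro continuous_intros mc yc)
  have y'q: "y' s = complex_of_real (1 / (m s)\<^sup>2) * q s" if "s \<in> {0..a}" for s
    using m_pos[of s] that by (simp add: q_def)
  have part: "f (y s) = f (q 0) * U (1 + l) s \<and> f (q s) = f (q 0) * P (1 + l) s"
    if s: "s \<in> {0..a}" and f: "bounded_linear f" and fm: "\<And>c z. f (complex_of_real c * z) = c * f z"
    for s and f :: "complex \<Rightarrow> real"
  proof -
    have X: "convex {0..a}" "0 \<in> {0..a}" "{0..a} \<subseteq> {0..}" using a by auto
    have d1: "((\<lambda>s. f (y s)) has_real_derivative \<alpha> s * f (q s)) (at s within {0..a})" if "s \<in> {0..a}" for s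
      using bounded_linear.has_vector_derivative[OF f yd[OF that]] unfolding y'q[OF that] fm
      by (simp add: has_real_derivative_iff_has_vector_derivative \<alpha>_def)
    have d2: "((\<lambda>s. f (q s)) has_real_derivative - ((1 + l) * \<beta> s * f (y s))) (at s within {0..a})"
      if "s \<in> {0..a}" for s
      using bounded_linear.has_vector_derivative[OF f qd[OF that]]
      unfolding linear_neg[OF bounded_linear.linear[OF f]] fm
      by (simp add: has_real_derivative_iff_has_vector_derivative \<beta>_def)
    have f0: "f (y 0) = 0" using y(3) linear_0[OF bounded_linear.linear[OF f]] by simp
    show ?thesis
      using sl_unique[OF \<alpha>_cont \<beta>_cont X d1 d2 f0 s] by (simp add: U_def P_def)
  qed
  have yU: "y s = q 0 * complex_of_real (U (1 + l) s)" "q s = q 0 * complex_of_real (P (1 + l) s)"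
    if "s \<in> {0..a}" for s
    using part[OF that bounded_linear_Re] part[OF that bounded_linear_Im] by (auto simp: complex_eq_iff)
  have "q 0 \<noteq> 0"
  proof
    assume "q 0 = 0"
    then have "y s = 0" if "s \<in> {0<..<a}" for s using yU(1)[of s] that by auto
    then show False using nt by auto
  qed
  moreover have "q 0 * complex_of_real (1 / (m a)\<^sup>2 * P (1 + l) a) = q 0 * complex_of_real (U (1 + l) a)"
    using y(4) y'q[of a] yU[of a] a by (simp add: mult_ac)
  ultimately have "complex_of_real (1 / (m a)\<^sup>2 * P (1 + l) a) = complex_of_real (U (1 + l) a)"
    by (metis mult_left_cancel)
  then have "1 / (m a)\<^sup>2 * P (1 + l) a = U (1 + l) a" by (simp only: of_real_eq_iff)
  then show ?thesis using m_pos[of a] a by (simp add: field_simps)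
qed

lemma eigenvalue_DRI:
  assumes a: "0 < a" and F: "P (1 + l) a = (m a)\<^sup>2 * U (1 + l) a"
  shows "eigenvalue_DR m a l"
proof -
  define \<mu> where "\<mu> = 1 + l"
  have mc: "continuous_on {0..a} m" by (intro continuous_on_subset[OF m_cont]) auto
  have mnz: "m s \<noteq> 0" if "0 \<le> s" for s using m_pos[OF that] by simp
  have Dc: "continuous_on {0..a} (D0 m)" using m_C1 by (auto simp: C1_halfline_def intro: continuous_on_subset)
  \<comment> \<open>The second derivative of \<open>U \<mu>\<close>, by the quotient rule from
    \<open>P \<mu> s / (m s)\<^sup>2\<close>. It is continuous because \<open>m\<close> is C^1,
    which puts \<open>U \<mu>\<close> in H^2.\<close>
  define d2 where "d2 s = (- (\<mu> * (m s)\<^sup>2 * U \<mu> s) * (m s)\<^sup>2 - P \<mu> s * (2 * m s * D0 m s)) / ((m s)\<^sup>2 * (m s)\<^sup>2)" for s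
  have sub: "(f has_real_derivative d) (at s within {0..a})" if "(f has_real_derivative d) (at s within {0..})" for f d s
    using that by (rule DERIV_subset) auto
  have lift: "((\<lambda>s. complex_of_real (f s)) has_vector_derivative complex_of_real d) (at s within X)"
    if "(f has_real_derivative d) (at s within X)" for f d s X
    using bounded_linear.has_vector_derivative[OF bounded_linear_of_real, of f d "at s within X"] that
    by (simp add: has_real_derivative_iff_has_vector_derivative)
  have ac1: "ac_deriv a (\<lambda>s. complex_of_real (U \<mu> s)) (\<lambda>s. complex_of_real (P \<mu> s / (m s)\<^sup>2))"
    by (intro ac_derivI lift sub UP_deriv continuous_intros UP_cont mc) (auto simp: mnz)
  have ac2: "ac_deriv a (\<lambda>s. complex_of_real (P \<mu> s / (m s)\<^sup>2)) (\<lambda>s. complex_of_real (d2 s))"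
  proof (rule ac_derivI[OF lift[OF sub]])
    fix s assume s: "s \<in> {0..a}"
    have "(m has_real_derivative D0 m s) (at s within {0..})"
      using m_C1 s by (intro has_real_derivative_D0) (auto simp: C1_halfline_def)
    then have "((\<lambda>s. (m s)\<^sup>2) has_real_derivative 2 * m s * D0 m s) (at s within {0..})"
      by (auto intro!: derivative_eq_intros)
    from DERIV_divide[OF UP_deriv(2) this]
    show "((\<lambda>s. P \<mu> s / (m s)\<^sup>2) has_real_derivative d2 s) (at s within {0..})"
      using s mnz by (simp add: d2_def)
  qed (use mnz in \<open>auto simp: d2_def intro!: continuous_intros UP_cont mc Dc\<close>)
  have sq: "set_integrable lebesgue {0..a} (\<lambda>s. (norm (complex_of_real (d2 s)))\<^sup>2)"
    unfolding d2_def
    by (intro absolutely_integrable_continuous_real continuous_intros UP_cont mc Dc) (auto simp: mnz)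
  have ac3: "ac_deriv a (\<lambda>s. complex_of_real ((m s)\<^sup>2) * complex_of_real (P \<mu> s / (m s)\<^sup>2))
      (\<lambda>s. complex_of_real (- (\<mu> * (m s)\<^sup>2 * U \<mu> s)))"
  proof (rule ac_derivI)
    fix s assume s: "s \<in> {0..a}"
    show "((\<lambda>s. complex_of_real ((m s)\<^sup>2) * complex_of_real (P \<mu> s / (m s)\<^sup>2)) has_vector_derivative
        complex_of_real (- (\<mu> * (m s)\<^sup>2 * U \<mu> s))) (at s within {0..a})"
      by (rule has_vector_derivative_transform[OF s _ lift[OF sub[OF UP_deriv(2)]]]) (use s mnz in auto)
  qed (intro continuous_intros UP_cont mc)
  have "K_DR m a (\<lambda>s. complex_of_real (U \<mu> s)) (\<lambda>s. complex_of_real l * complex_of_real (U \<mu> s))"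
    unfolding K_DR_def sobolev_H2_def
  proof (intro exI conjI)
    show "AE s in lebesgue. s \<in> {0<..<a} \<longrightarrow> complex_of_real l * complex_of_real (U \<mu> s) =
        - (1 / complex_of_real ((m s)\<^sup>2)) * complex_of_real (- (\<mu> * (m s)\<^sup>2 * U \<mu> s)) - complex_of_real (U \<mu> s)"
      by (rule AE_I2) (auto simp: mnz \<mu>_def field_simps)
    show "complex_of_real (P \<mu> a / (m a)\<^sup>2) = complex_of_real (U \<mu> a)"
      using F mnz[of a] a by (simp add: \<mu>_def)
  qed (rule ac1 ac2 ac3 sq | simp)+
  moreover have "\<not> (AE s in lebesgue. s \<in> {0<..<a} \<longrightarrow> complex_of_real (U \<mu> s) = 0)"
  proof
    assume "AE s in lebesgue. s \<in> {0<..<a} \<longrightarrow> complex_of_real (U \<mu> s) = 0"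
    then obtain N where N: "negligible N" "{s. \<not> (s \<in> {0<..<a} \<longrightarrow> complex_of_real (U \<mu> s) = 0)} \<subseteq> N"
      unfolding eventually_ae_filter negligible_iff_null_sets by auto
    have UN: "U \<mu> x = 0" if "0 < x" "x < a" "x \<notin> N" for x
      using N(2) that by auto
    have "integral {0..a} (\<lambda>s. (U \<mu> s)\<^sup>2) = integral {0..a} (\<lambda>_. 0)"
      by (rule integral_spike[of "insert 0 (insert a N)"]) (use N(1) UN in auto)
    then have "integral {0..a} (\<lambda>s. (U \<mu> s)\<^sup>2) = 0" by simp
    moreover have "continuous_on {0..a} (\<lambda>s. (U \<mu> s)\<^sup>2)" by (intro continuous_intros UP_cont)
    ultimately have zero: "U \<mu> s = 0" if "s \<in> {0..a}" for s
      using integral_eq_0_iff[of 0 a "\<lambda>s. (U \<mu> s)\<^sup>2"] a that by auto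
    have "((\<lambda>s. 0) has_real_derivative P \<mu> (a / 2) / (m (a / 2))\<^sup>2) (at (a / 2))"
      by (rule has_field_derivative_transform_within_open[OF UP_deriv_at(1)[of "a / 2" \<mu>], where S = "{0<..<a}"])
        (use a zero in auto)
    then have "P \<mu> (a / 2) / (m (a / 2))\<^sup>2 = 0" using DERIV_unique[OF _ DERIV_const] by blast
    then show False using UP_nonzero[of "a / 2" \<mu>] zero[of "a / 2"] mnz[of "a / 2"] a by auto
  qed
  ultimately show ?thesis unfolding eigenvalue_DR_def by blast
qed

section \<open>The sign of the Robin defect P - m^2 U as the spectral parameter varies\<close>

lemma U_pos_near_0:
  assumes "0 \<le> R" "0 < a"
  obtains d where "0 < d" "d \<le> a" "\<And>\<mu> s. \<mu> \<in> {-R..R} \<Longrightarrow> 0 < s \<Longrightarrow> s \<le> d \<Longrightarrow> 0 < U \<mu> s"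
proof -
  \<comment> \<open>\<open>P \<mu> 0 = 1\<close> for every \<mu>, so uniform continuity keeps
    \<open>P \<mu>\<close> positive on a common interval \<open>{0..d}\<close>, on which
    \<open>U \<mu>\<close> then increases from 0.\<close>
  have "uniformly_continuous_on ({-R..R} \<times> {0..a}) (\<lambda>z. P (fst z) (snd z))"
    using assms by (intro compact_uniformly_continuous UP_jointly_cont compact_Times) auto
  then obtain e where e: "0 < e" "\<And>x y. x \<in> {-R..R} \<times> {0..a} \<Longrightarrow> y \<in> {-R..R} \<times> {0..a} \<Longrightarrow>
      dist y x < e \<Longrightarrow> dist (P (fst y) (snd y)) (P (fst x) (snd x)) < 1"
    unfolding uniformly_continuous_on_def by (metis zero_less_one)
  define d where "d = min a (e / 2)"
  have P: "0 < P \<mu> s" if "\<mu> \<in> {-R..R}" "0 \<le> s" "s \<le> d" for \<mu> s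
  proof -
    have "dist (\<mu>, s) (\<mu>, 0) < e" using that e(1) by (simp add: dist_Pair_Pair d_def)
    then have "\<bar>P \<mu> s - 1\<bar> < 1"
      using e(2)[of "(\<mu>, 0)" "(\<mu>, s)"] that assms by (simp add: dist_real_def d_def)
    then show ?thesis by linarith
  qed
  have "0 < U \<mu> s" if "\<mu> \<in> {-R..R}" "0 < s" "s \<le> d" for \<mu> s
  proof -
    have "U \<mu> 0 < U \<mu> s"
    proof (rule DERIV_pos_imp_increasing_open[where f = "U \<mu>"])
      show "\<exists>y. (U \<mu> has_real_derivative y) (at x) \<and> 0 < y" if x: "0 < x" "x < s" for x
        using UP_deriv_at(1)[OF x(1), of \<mu>] P[of \<mu> x] m_pos[of x] x \<open>\<mu> \<in> {-R..R}\<close> \<open>s \<le> d\<close>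
        by (intro exI[of _ "P \<mu> x / (m x)\<^sup>2"] conjI) auto
    qed (use that UP_cont in auto)
    then show ?thesis by simp
  qed
  then show ?thesis using that[of d] e(1) assms by (auto simp: d_def)
qed

lemma P_nonpos_at_zero:
  assumes z: "0 < z" "U \<mu> z = 0" and pos: "\<And>s. 0 < s \<Longrightarrow> s < z \<Longrightarrow> 0 \<le> U \<mu> s"
  shows "P \<mu> z \<le> 0"
proof (rule ccontr)
  assume "\<not> P \<mu> z \<le> 0"
  then have "0 < P \<mu> z / (m z)\<^sup>2" using m_pos[of z] z by simp
  then obtain d where d: "0 < d" "\<And>h. 0 < h \<Longrightarrow> h < d \<Longrightarrow> U \<mu> (z - h) < U \<mu> z"
    using DERIV_pos_inc_left[OF UP_deriv_at(1)[OF z(1)]] by blast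
  define h where "h = min d z / 2"
  have "0 < h" "h < d" "h < z" using d(1) z(1) by (auto simp: h_def)
  then show False using d(2)[of h] pos[of "z - h"] z(2) by simp
qed

text \<open>Sturm comparison with \<open>u\<close>: for \<mu> < 1 the Wronskian \<open>W\<close>
  vanishes at 0 and increases while \<open>U \<mu>\<close> is positive. At a first zero of
  \<open>U \<mu>\<close> it would be nonpositive, so there is none up to \<open>a\<close>. Then
  \<open>W a > 0\<close> says that P / U exceeds p / u, which is at least m^2 up to the extremal
  length.\<close>

lemma robin_defect_pos:
  assumes a: "0 < a" "ereal a \<le> a_hat_star m 0 1" and \<mu>: "\<mu> < 1"
  shows "(m a)\<^sup>2 * U \<mu> a < P \<mu> a"
proof -
  have upos: "0 < u s" if "0 < s" "s \<le> a" for s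
    using below_a_hat_star(1)[of s] that order_trans[of "ereal s" "ereal a"] a(2) by auto
  define W where "W s = P \<mu> s * u s - p s * U \<mu> s" for s
  have Wd: "(W has_real_derivative (1 - \<mu>) * (m s)\<^sup>2 * U \<mu> s * u s) (at s)" if "0 < s" for s
    using DERIV_diff[OF DERIV_mult[OF UP_deriv_at(2)[OF that] deriv_interior(1)[OF that]]
        DERIV_mult[OF deriv_interior(2)[OF that] UP_deriv_at(1)[OF that]], of \<mu> \<mu>]
    by (simp add: W_def[abs_def] algebra_simps)
  have Wc: "continuous_on {0..z} W" for z
    unfolding W_def by (intro continuous_intros UP_cont continuous_on_subset[OF u_cont] continuous_on_subset[OF p_cont]) auto
  have Wpos: "0 < W z" if z: "0 < z" "z \<le> a" "\<And>s. 0 < s \<Longrightarrow> s < z \<Longrightarrow> 0 < U \<mu> s" for z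
  proof -
    have "W 0 < W z"
    proof (rule DERIV_pos_imp_increasing_open[where f = W])
      show "\<exists>y. (W has_real_derivative y) (at x) \<and> 0 < y" if x: "0 < x" "x < z" for x
        using Wd[OF x(1)] z upos[of x] m_pos[of x] x \<mu>
        by (intro exI[of _ "(1 - \<mu>) * (m x)\<^sup>2 * U \<mu> x * u x"] conjI) auto
    qed (use z Wc in auto)
    then show ?thesis by (simp add: W_def)
  qed
  obtain d where d: "0 < d" "d \<le> a" "\<And>s. 0 < s \<Longrightarrow> s \<le> d \<Longrightarrow> 0 < U \<mu> s"
    using U_pos_near_0[of "\<bar>\<mu>\<bar>" a] a(1) by (metis abs_ge_zero abs_le_iff abs_le_D2 atLeastAtMost_iff minus_le_iff order_refl)
  have pos: "0 < U \<mu> s" if s: "0 < s" "s \<le> a" for s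
  proof (rule ccontr)
    assume "\<not> 0 < U \<mu> s"
    then obtain z where z: "0 < z" "z \<le> a" "U \<mu> z = 0" "\<And>s. 0 < s \<Longrightarrow> s < z \<Longrightarrow> 0 < U \<mu> s"
      using first_zero[OF UP_cont(1) d(1,3), of s a] s by (metis not_less)
    have "P \<mu> z \<le> 0" using P_nonpos_at_zero[OF z(1,3)] z(4) by (meson less_imp_le)
    then have "W z \<le> 0" using upos[OF z(1,2)] z(3) by (simp add: W_def mult_nonpos_nonneg)
    then show False using Wpos[OF z(1,2,4)] by simp
  qed
  have "0 < W a" using Wpos[OF a(1)] pos by simp
  moreover have "(m a)\<^sup>2 * u a * U \<mu> a \<le> p a * U \<mu> a"
    using below_a_hat_star(2)[OF a] pos[of a] a(1) by (intro mult_right_mono) auto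
  ultimately have "u a * ((m a)\<^sup>2 * U \<mu> a) < u a * P \<mu> a"
    by (simp add: W_def mult_ac)
  then show ?thesis using upos[of a] a(1) by simp
qed

text \<open>A Picone estimate with test function s - h on \<open>{h..a}\<close>. With x = (s - h) P
  / U, the derivative of (s - h)^2 P / U is 2 x - x^2 / m^2 - \<mu> m^2 (s - h)^2, hence at most m^2
  - \<mu> m^2 (s - h)^2, and a large \<mu> makes its integral negative. Starting at
  \<open>h = a / 2\<close> avoids dividing by U at its zero 0.\<close>

lemma robin_defect_nonpos_if_positive:
  assumes a: "0 < a"
  obtains \<mu> where "1 \<le> \<mu>" "(\<And>s. 0 < s \<Longrightarrow> s \<le> a \<Longrightarrow> 0 < U \<mu> s) \<Longrightarrow> P \<mu> a \<le> (m a)\<^sup>2 * U \<mu> a"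
proof -
  define h where "h = a / 2"
  have h: "0 < h" "h < a" "a - h = h" using a by (auto simp: h_def)
  have mc: "continuous_on {h..a} (\<lambda>s. (m s)\<^sup>2)" using h by (intro continuous_intros continuous_on_subset[OF m_cont]) auto
  obtain s1 where s1: "s1 \<in> {h..a}" "\<And>s. s \<in> {h..a} \<Longrightarrow> (m s1)\<^sup>2 \<le> (m s)\<^sup>2"
    using continuous_attains_inf[OF compact_Icc _ mc] h by auto
  obtain s2 where s2: "s2 \<in> {h..a}" "\<And>s. s \<in> {h..a} \<Longrightarrow> (m s)\<^sup>2 \<le> (m s2)\<^sup>2"
    using continuous_attains_sup[OF compact_Icc _ mc] h by auto
  define b c where "b = (m s1)\<^sup>2" and "c = (m s2)\<^sup>2"
  have b: "0 < b" "0 < c" using m_pos[of s1] m_pos[of s2] s1(1) s2(1) h by (auto simp: b_def c_def)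
  \<comment> \<open>Chosen so that \<open>c * h - \<mu> * b * h ^ 3 / 3\<close> equals
    \<open>- (b * h ^ 3 / 3)\<close>.\<close>
  define \<mu> where "\<mu> = 1 + 3 * c / (b * h\<^sup>2)"
  have \<mu>: "1 \<le> \<mu>" using b h by (simp add: \<mu>_def)
  have "P \<mu> a \<le> (m a)\<^sup>2 * U \<mu> a" if pos: "\<And>s. 0 < s \<Longrightarrow> s \<le> a \<Longrightarrow> 0 < U \<mu> s"
  proof -
    \<comment> \<open>The subtracted polynomial is the primitive, vanishing at \<open>h\<close>, of
      c - \<mu> b (s - h)^2, where \<open>b\<close> and \<open>c\<close> are the minimum and maximum
      of m^2 on \<open>{h..a}\<close>.\<close>
    define G where "G s = (s - h)\<^sup>2 * P \<mu> s / U \<mu> s - (c * (s - h) - \<mu> * b * (s - h) ^ 3 / 3)" for s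
    have "G a \<le> G h"
    proof (rule DERIV_nonpos_imp_nonincreasing[where f = G])
      fix s assume s: "h \<le> s" "s \<le> a"
      then have s0: "0 < s" and us: "0 < U \<mu> s" and ms: "0 < m s" using h pos[of s] m_pos[of s] by auto
      let ?e = "((2 * (s - h) * P \<mu> s + - (\<mu> * (m s)\<^sup>2 * U \<mu> s) * (s - h)\<^sup>2) * U \<mu> s
          - (s - h)\<^sup>2 * P \<mu> s * (P \<mu> s / (m s)\<^sup>2)) / (U \<mu> s * U \<mu> s)"
      have d1: "((\<lambda>s. (s - h)\<^sup>2) has_real_derivative 2 * (s - h)) (at s)"
        by (auto intro!: derivative_eq_intros)
      have d2: "((\<lambda>s. c * (s - h) - \<mu> * b * (s - h) ^ 3 / 3) has_real_derivative c - \<mu> * b * (s - h)\<^sup>2) (at s)"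
        by (auto intro!: derivative_eq_intros simp: power2_eq_square)
      have "((\<lambda>s. (s - h)\<^sup>2 * P \<mu> s / U \<mu> s) has_real_derivative ?e) (at s)"
        using DERIV_divide[OF DERIV_mult[OF d1 UP_deriv_at(2)[OF s0, of \<mu>]] UP_deriv_at(1)[OF s0, of \<mu>]] us by simp
      from DERIV_diff[OF this d2]
      have "(G has_real_derivative ?e - (c - \<mu> * b * (s - h)\<^sup>2)) (at s)"
        by (simp add: G_def[abs_def])
      moreover have "?e - (c - \<mu> * b * (s - h)\<^sup>2) \<le> 0"
      proof -
        define x where "x = (s - h) * P \<mu> s / U \<mu> s"
        have "?e = 2 * x - x\<^sup>2 / (m s)\<^sup>2 - \<mu> * (m s)\<^sup>2 * (s - h)\<^sup>2"
        proof -
          have "((2 * k * Q + - (\<mu> * N\<^sup>2 * V) * k\<^sup>2) * V - k\<^sup>2 * Q * (Q / N\<^sup>2)) / (V * V) =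
              2 * (k * Q / V) - (k * Q / V)\<^sup>2 / N\<^sup>2 - \<mu> * N\<^sup>2 * k\<^sup>2" if "0 < V" "0 < N" for k Q V N :: real
            using that by (simp add: power2_eq_square diff_divide_distrib add_divide_distrib ring_distribs mult_ac)
          from this[OF us ms] show ?thesis unfolding x_def .
        qed
        moreover have "2 * x - x\<^sup>2 / (m s)\<^sup>2 \<le> (m s)\<^sup>2"
        proof -
          have "0 \<le> (m s - x / m s)\<^sup>2" by simp
          also have "\<dots> = (m s)\<^sup>2 - 2 * x + x\<^sup>2 / (m s)\<^sup>2" using ms by (simp add: power2_diff power_divide)
          finally show ?thesis by simp
        qed
        moreover have "(m s)\<^sup>2 \<le> c" using s2(2)[of s] s by (simp add: c_def)
        moreover have "\<mu> * b * (s - h)\<^sup>2 \<le> \<mu> * (m s)\<^sup>2 * (s - h)\<^sup>2"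
          using s1(2)[of s] s \<mu> by (intro mult_right_mono mult_left_mono) (auto simp: b_def)
        ultimately show ?thesis by linarith
      qed
      ultimately show "\<exists>y. (G has_real_derivative y) (at s) \<and> y \<le> 0" by (intro exI conjI)
    qed (use h in simp)
    then have "h\<^sup>2 * P \<mu> a / U \<mu> a \<le> c * h - \<mu> * b * h ^ 3 / 3" by (simp add: G_def h(3))
    also have "\<dots> = - (b * h ^ 3 / 3)"
      using b h by (simp add: \<mu>_def field_simps power2_eq_square power3_eq_cube)
    also have "\<dots> < 0" using b h by simp
    finally have "h\<^sup>2 * P \<mu> a / U \<mu> a < 0" .
    then have "P \<mu> a < 0" using pos[of a] a h by (simp add: divide_less_0_iff mult_less_0_iff)
    moreover have "0 \<le> (m a)\<^sup>2 * U \<mu> a" using pos[of a] a by simp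
    ultimately show ?thesis by linarith
  qed
  then show ?thesis using that \<mu> by blast
qed

text \<open>If positivity on \<open>]0, a]\<close> is lost when \<open>\<mu>\<close> increases, it is lost at the endpoint first:
  an interior zero of a nonnegative solution would be a double zero.\<close>

lemma robin_defect_nonpos_exists:
  assumes a: "0 < a" and pos: "\<And>s. 0 < s \<Longrightarrow> s \<le> a \<Longrightarrow> 0 < U 1 s"
  obtains \<mu> where "1 \<le> \<mu>" "P \<mu> a \<le> (m a)\<^sup>2 * U \<mu> a"
proof -
  obtain \<mu>1 where \<mu>1: "1 \<le> \<mu>1" "(\<And>s. 0 < s \<Longrightarrow> s \<le> a \<Longrightarrow> 0 < U \<mu>1 s) \<Longrightarrow> P \<mu>1 a \<le> (m a)\<^sup>2 * U \<mu>1 a"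
    using robin_defect_nonpos_if_positive[OF a] by blast
  show ?thesis
  proof (cases "\<forall>s. 0 < s \<longrightarrow> s \<le> a \<longrightarrow> 0 < U \<mu>1 s")
    case True
    then show ?thesis using that \<mu>1 by blast
  next
    case False
    then obtain s1 where s1: "0 < s1" "s1 \<le> a" "U \<mu>1 s1 \<le> 0" by force
    obtain d where d: "0 < d" "d \<le> a" "\<And>\<mu> s. \<mu> \<in> {-\<mu>1..\<mu>1} \<Longrightarrow> 0 < s \<Longrightarrow> s \<le> d \<Longrightarrow> 0 < U \<mu> s"
      using U_pos_near_0[of \<mu>1 a] a \<mu>1(1) by (metis order_trans zero_le_one)
    have Uc: "continuous_on ({-\<mu>1..\<mu>1} \<times> {0..a}) (\<lambda>z. U (fst z) (snd z))"
      using a \<mu>1(1) by (intro UP_jointly_cont) auto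
    \<comment> \<open>The parameters and points at which positivity fails. The uniform
      \<open>d\<close> separates them from the common zero at \<open>s = 0\<close>, so the set is
      compact and there is a first parameter of failure.\<close>
    define Z where "Z = ({1..\<mu>1} \<times> {d..a}) \<inter> {z \<in> {1..\<mu>1} \<times> {d..a}. U (fst z) (snd z) \<le> 0}"
    have "closed {z \<in> {1..\<mu>1} \<times> {d..a}. U (fst z) (snd z) \<le> 0}"
      using d \<mu>1(1) by (intro continuous_on_closed_Collect_le continuous_on_subset[OF Uc] continuous_intros closed_Times) auto
    then have "compact Z" unfolding Z_def by (intro compact_Int_closed compact_Times) auto
    moreover have "(\<mu>1, s1) \<in> Z" using s1 d(3)[of \<mu>1 s1] \<mu>1(1) by (force simp: Z_def)
    then have "Z \<noteq> {}" by blast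
    moreover have "continuous_on Z fst" by (intro continuous_intros)
    ultimately obtain z where z: "z \<in> Z" "\<And>y. y \<in> Z \<Longrightarrow> fst z \<le> fst y"
      using continuous_attains_inf[of Z fst] by blast
    obtain \<nu> s0 where \<nu>: "z = (\<nu>, s0)" by fastforce
    have zs: "1 \<le> \<nu>" "\<nu> \<le> \<mu>1" "d \<le> s0" "s0 \<le> a" "U \<nu> s0 \<le> 0" using z(1) by (auto simp: Z_def \<nu>)
    have "\<nu> \<noteq> 1" using pos[of s0] zs d(1) by auto
    then have \<nu>1: "1 < \<nu>" using zs by simp
    have nonneg: "0 \<le> U \<nu> s" if s: "0 < s" "s \<le> a" for s
    proof (cases "s \<le> d")
      case True
      then show ?thesis using d(3)[of \<nu> s] zs s \<mu>1(1) by force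
    next
      case False
      show ?thesis
      proof (rule continuous_ge_on_closure[where f = "\<lambda>\<mu>. U \<mu> s" and x = \<nu> and S = "{1<..<\<nu>}"])
        show "continuous_on (closure {1<..<\<nu>}) (\<lambda>\<mu>. U \<mu> s)"
          using UP_cont_param(1)[of s 1 \<nu>] \<nu>1 s by simp
        show "\<nu> \<in> closure {1<..<\<nu>}" using \<nu>1 by simp
        show "0 \<le> U \<mu> s" if \<mu>: "\<mu> \<in> {1<..<\<nu>}" for \<mu>
        proof (rule ccontr)
          assume "\<not> 0 \<le> U \<mu> s"
          then have "(\<mu>, s) \<in> Z" using \<mu> False s zs by (auto simp: Z_def)
          then show False using z(2)[of "(\<mu>, s)"] \<mu> \<nu> by simp
        qed
      qed
    qed
    have U0: "U \<nu> s0 = 0" using nonneg[of s0] zs d(1) by simp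
    have "s0 = a"
    proof (rule ccontr)
      assume "s0 \<noteq> a"
      then have s0: "0 < s0" "s0 < a" using zs d(1) by auto
      have "P \<nu> s0 / (m s0)\<^sup>2 = 0"
      proof (rule DERIV_local_min[OF UP_deriv_at(1)[OF s0(1)]])
        show "0 < min s0 (a - s0)" using s0 by simp
        show "\<forall>y. \<bar>s0 - y\<bar> < min s0 (a - s0) \<longrightarrow> U \<nu> s0 \<le> U \<nu> y"
          using nonneg by (auto simp: U0 abs_if split: if_splits)
      qed
      then have "P \<nu> s0 = 0" using m_pos[of s0] s0 by simp
      then show False using UP_nonzero[of s0 \<nu>] U0 s0 by simp
    qed
    then have "P \<nu> a \<le> 0" using P_nonpos_at_zero[of a \<nu>] nonneg U0 a by auto
    then show ?thesis using that[of \<nu>] zs(1) U0 \<open>s0 = a\<close> by simp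
  qed
qed

text \<open>\<open>LEAST\<close> returns the lowest eigenvalue only if there is one. The Robin
  defect is positive at \<mu> = 1 and nonpositive at a larger parameter, so its zeros in between
  form a nonempty compact set with least element \<nu> > 1. \<open>robin_defect_pos\<close> excludes
  parameters below 1, hence \<nu> - 1 is the least eigenvalue.\<close>

lemma lambda_DR_pos:
  assumes a: "0 < a" "ereal a < a_hat_star m 0 1"
  shows "0 < lambda_DR a m"
proof -
  let ?F = "\<lambda>\<mu>. P \<mu> a - (m a)\<^sup>2 * U \<mu> a"
  have admissible: "0 < u s \<and> (m s)\<^sup>2 * u s < p s" if "0 < s" "s \<le> a" for s
  proof -
    have "ereal s < a_hat_star m 0 1" using that a(2) by (metis ereal_less_eq(3) le_less_trans)
    then show ?thesis using admissible_a_hat_star that unfolding admissible_def by simp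
  qed
  have F1: "0 < ?F 1" using admissible[of a] a(1) by (simp add: u_eq p_eq)
  obtain \<mu>2 where \<mu>2: "1 \<le> \<mu>2" "?F \<mu>2 \<le> 0"
    using robin_defect_nonpos_exists[OF a(1)] admissible by (metis diff_le_0_iff_le u_eq)
  have Fc: "continuous_on {1..\<mu>2} ?F"
    using a(1) by (intro continuous_intros UP_cont_param) auto
  define E where "E = {\<mu> \<in> {1..\<mu>2}. ?F \<mu> = 0}"
  have "E \<noteq> {}"
    using IVT2'[of ?F \<mu>2 0 1] \<mu>2 F1 Fc by (auto simp: E_def)
  moreover have "compact E"
    unfolding E_def compact_eq_bounded_closed
    by (intro conjI bounded_subset[OF bounded_closed_interval[of 1 \<mu>2]] continuous_closed_preimage_constant[OF Fc]) auto
  ultimately obtain \<nu> where \<nu>: "\<nu> \<in> E" "\<And>y. y \<in> E \<Longrightarrow> \<nu> \<le> y"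
    using continuous_attains_inf[of E "\<lambda>x. x"] continuous_on_id by blast
  have \<nu>1: "1 < \<nu>" using \<nu>(1) F1 by (cases "\<nu> = 1") (auto simp: E_def)
  have "lambda_DR a m = \<nu> - 1"
    unfolding lambda_DR_def
  proof (rule Least_equality)
    show "eigenvalue_DR m a (\<nu> - 1)" using eigenvalue_DRI[of a "\<nu> - 1"] a(1) \<nu>(1) by (simp add: E_def)
    fix l assume "eigenvalue_DR m a l"
    then have F: "?F (1 + l) = 0" using eigenvalue_DR_imp[OF a(1)] by simp
    then have "1 \<le> 1 + l" using robin_defect_pos[of a "1 + l"] a by (force intro: less_imp_le)
    then show "\<nu> - 1 \<le> l"
      using \<nu>(2)[of "1 + l"] \<nu>(1) F by (cases "1 + l \<le> \<mu>2") (auto simp: E_def)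
  qed
  then show ?thesis using \<nu>1 by simp
qed

text \<open>At a finite extremal length the Robin defect vanishes for \<mu> = 1, so 0 is an
  eigenvalue, and \<open>robin_defect_pos\<close> leaves none below it.\<close>

lemma lambda_DR_at_a_hat_star:
  assumes A: "a_hat_star m 0 1 = ereal A"
  shows "lambda_DR A m = 0"
  unfolding lambda_DR_def
proof (rule Least_equality)
  have A0: "0 < A" "(m A)\<^sup>2 * u A = p A" using at_a_hat_star[OF A] by auto
  show "eigenvalue_DR m A 0" using eigenvalue_DRI[of A 0] A0 by (simp add: u_eq p_eq)
  fix l assume "eigenvalue_DR m A l"
  then have "P (1 + l) A = (m A)\<^sup>2 * U (1 + l) A" using eigenvalue_DR_imp[OF A0(1)] by simp
  then show "0 \<le> l" using robin_defect_pos[of A "1 + l"] A0 A by force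
qed

text \<open>\<open>lambda_DR\<close> is positive below the extremal length and 0 at it when it is
  finite, so an interval of positivity cannot reach beyond.\<close>

lemma a_star_eq: "a_star m = a_hat_star m 0 1"
proof (rule antisym)
  have pos: "0 < a_hat_star m 0 1" using admissible_a_hat_star by (simp add: admissible_def)
  show "a_star m \<le> a_hat_star m 0 1"
    unfolding a_star_def
  proof (rule Sup_least, clarify)
    fix a' :: real assume a': "0 < a'" "\<forall>a. 0 < a \<and> a < a' \<longrightarrow> 0 < lambda_DR a m"
    show "ereal a' \<le> a_hat_star m 0 1"
    proof (rule ccontr)
      assume "\<not> ereal a' \<le> a_hat_star m 0 1"
      then have lt: "a_hat_star m 0 1 < ereal a'" by simp
      then obtain A where A: "a_hat_star m 0 1 = ereal A"
        using pos by (cases "a_hat_star m 0 1") auto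
      then have "0 < A" "A < a'" using pos lt by auto
      then show False using a'(2) lambda_DR_at_a_hat_star[OF A] by auto
    qed
  qed
  show "a_hat_star m 0 1 \<le> a_star m"
  proof (rule ccontr)
    assume "\<not> a_hat_star m 0 1 \<le> a_star m"
    \<comment> \<open>The maximum with 0 guarantees that the intermediate real \<open>y\<close> is
      positive, as membership in the set defining \<open>a_star\<close> demands.\<close>
    then have "max 0 (a_star m) < a_hat_star m 0 1" using pos by simp
    then obtain y where y: "max 0 (a_star m) < ereal y" "ereal y < a_hat_star m 0 1"
      using ereal_dense2 by blast
    have "0 < lambda_DR a m" if "0 < a" "a < y" for a
      using lambda_DR_pos[OF that(1)] that(2) y(2) by (meson ereal_less_eq(3) less_imp_le le_less_trans)
    then have "ereal y \<le> a_star m"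
      unfolding a_star_def using y(1) by (intro Sup_upper) auto
    moreover have "a_star m < ereal y" using y(1) by simp
    ultimately show False by (simp add: leD)
  qed
qed

end

section \<open>Scaling and the main theorem\<close>

lemma DERIV_halfline_scale:
  fixes f :: "real \<Rightarrow> real"
  assumes "(f has_real_derivative d) (at (c * s) within {0..})" "0 < c"
  shows "((\<lambda>x. f (c * x)) has_real_derivative c * d) (at s within {0..})"
proof -
  have "(f has_real_derivative d) (at (c * s) within (*) c ` {0..})"
    using assms(2) by (intro DERIV_subset[OF assms(1)]) auto
  moreover have "((*) c has_real_derivative c) (at s within {0..})"
    by (auto intro!: derivative_eq_intros)
  ultimately have "(f \<circ> (*) c has_real_derivative d * c) (at s within {0..})"
    by (rule DERIV_image_chain)
  then show ?thesis by (simp add: o_def mult.commute)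
qed

text \<open>For \<omega> = 0 and r = 1 the predicates \<open>is_u_hat\<close> and
  \<open>is_u0\<close> coincide, so \<open>SOME\<close> picks the same function in both
  definitions.\<close>

lemma psi0_eq: "psi0 M s = psi_hat M 0 1 s"
proof -
  have "is_u0 M = is_u_hat M 0 1"
    by (simp add: is_u0_def is_u_hat_def n_hat_def fun_eq_iff)
  then have "u0 M = u_hat M 0 1" by (simp add: u0_def u_hat_def)
  then show ?thesis by (simp add: psi0_def psi_hat_def)
qed

context half_line_weight
begin

definition M :: "real \<Rightarrow> real"
  where "M s = exp (- \<omega> * s / r) * m (s / r)"

lemma M_scale: "M (r * s) = n s"
  using r_pos by (simp add: M_def n_hat_def)

lemma sturm_liouville_M: "sturm_liouville M"
proof (unfold_locales)
  define d where "d s = exp (- \<omega> * s / r) * (1 / r * D0 m (s / r)) - \<omega> / r * exp (- \<omega> * s / r) * m (s / r)" for s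
  have md: "(m has_real_derivative D0 m s) (at s within {0..})" if "0 \<le> s" for s
    using m_C1 that by (intro has_real_derivative_D0) (auto simp: C1_halfline_def)
  have der: "(M has_real_derivative d s) (at s within {0..})" if "0 \<le> s" for s
  proof -
    have "((\<lambda>x. m (1 / r * x)) has_real_derivative 1 / r * D0 m (1 / r * s)) (at s within {0..})"
      using r_pos that by (intro DERIV_halfline_scale md) auto
    moreover have "((\<lambda>s. exp (- \<omega> * s / r)) has_real_derivative exp (- \<omega> * s / r) * (- \<omega> / r)) (at s within {0..})"
      using r_pos by (auto intro!: derivative_eq_intros)
    ultimately show ?thesis
      using DERIV_mult[of "\<lambda>s. exp (- \<omega> * s / r)" "exp (- \<omega> * s / r) * (- \<omega> / r)" s "{0..}"
          "\<lambda>x. m (1 / r * x)" "1 / r * D0 m (1 / r * s)"]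
      by (simp add: M_def[abs_def] d_def mult_ac)
  qed
  have quot: "continuous_on {0..} (\<lambda>s. s / r)" "(\<lambda>s. s / r) ` {0..} \<subseteq> {0..}"
    using r_pos by (auto intro!: continuous_intros)
  have "continuous_on {0..} (D0 m)" using m_C1 by (simp add: C1_halfline_def)
  note cont = continuous_on_compose2[OF m_cont quot] continuous_on_compose2[OF this quot]
  have "continuous_on {0..} d"
    unfolding d_def using r_pos by (intro continuous_intros cont) auto
  moreover have "d s = D0 M s" if "s \<in> {0..}" for s
    using D0_eqI[OF der, of s] that by simp
  ultimately have "continuous_on {0..} (D0 M)" by (rule continuous_on_eq)
  then show "C1_halfline M"
    using differentiable_on_halflineI[OF der] by (simp add: C1_halfline_def)
  show "0 < M s" if "0 \<le> s" for s
    using that r_pos m_pos[of "s / r"] by (simp add: M_def)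
qed simp

interpretation M: sturm_liouville M
  by (rule sturm_liouville_M)

text \<open>By \<open>M_scale\<close> the rescaled pair solves the system for \<open>n\<close>; as
  both p-components are 1 at 0, uniqueness gives equality without a factor.\<close>

lemma up_scale:
  assumes "0 \<le> s"
  shows "u s = M.u (r * s)" "p s = M.p (r * s)"
proof -
  have d1: "((\<lambda>s. M.u (r * s)) has_real_derivative \<alpha> s * M.p (r * s)) (at s within {0..})"
    and d2: "((\<lambda>s. M.p (r * s)) has_real_derivative - (1 * \<beta> s * M.u (r * s))) (at s within {0..})"
    if "s \<in> {0..}" for s
    using DERIV_halfline_scale[OF M.u_deriv[of "r * s"] r_pos] DERIV_halfline_scale[OF M.p_deriv[of "r * s"] r_pos]
      that r_pos by (simp_all add: M_scale \<alpha>_def \<beta>_def mult.assoc)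
  have "M.u (r * s) = M.p (r * 0) * sl_u \<alpha> \<beta> 1 s" "M.p (r * s) = M.p (r * 0) * sl_p \<alpha> \<beta> 1 s"
    using sl_unique[OF \<alpha>_cont \<beta>_cont convex_real_interval(1) _ _ d1 d2] assms by simp_all
  then show "u s = M.u (r * s)" "p s = M.p (r * s)" by (simp_all add: u_def p_def)
qed

lemma psi_hat_scale:
  assumes "0 \<le> s"
  shows "psi_hat m \<omega> r s = psi0 M (r * s)"
  using assms r_pos by (simp add: psi0_eq psi_hat_eq M.psi_hat_eq up_scale M_scale)

lemma admissible_scale: "admissible a \<longleftrightarrow> M.admissible (ereal r * a)"
proof
  have r: "0 < ereal r" "ereal r \<noteq> \<infinity>" using r_pos by auto
  show "M.admissible (ereal r * a)" if g: "admissible a"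
    unfolding M.admissible_def
  proof (intro conjI allI impI)
    show "0 < ereal r * a" using g r by (simp add: admissible_def ereal_zero_less_0_iff)
    fix s :: real assume s: "0 < s" "ereal s < ereal r * a"
    have "ereal (s / r) < a"
      using s(2) r_pos ereal_divide_less_pos[OF r, of "ereal s" a] by simp
    then have "0 < u (s / r) \<and> (n (s / r))\<^sup>2 * u (s / r) < p (s / r)"
      using g s(1) r_pos by (simp add: admissible_def)
    then show "0 < M.u s" "(M.n s)\<^sup>2 * M.u s < M.p s"
      using up_scale[of "s / r"] M_scale[of "s / r"] s(1) r_pos by simp_all
  qed
  show "admissible a" if g: "M.admissible (ereal r * a)"
    unfolding admissible_def
  proof (intro conjI allI impI)
    show "0 < a" using g r_pos by (simp add: M.admissible_def ereal_zero_less_0_iff)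
    fix s :: real assume s: "0 < s" "ereal s < a"
    have "ereal (r * s) < ereal r * a"
      using s(2) r_pos ereal_mult_strict_left_mono[of "ereal s" a "ereal r"] by simp
    then have "0 < M.u (r * s) \<and> (M.n (r * s))\<^sup>2 * M.u (r * s) < M.p (r * s)"
      using g s(1) r_pos by (simp add: M.admissible_def)
    then show "0 < u s" "(n s)\<^sup>2 * u s < p s"
      using up_scale[of s] M_scale[of s] s(1) by simp_all
  qed
qed

text \<open>Admissibility transfers under scaling in both directions, so each greatest length bounds
  the other.\<close>

lemma a_hat_star_scale: "a_hat_star m \<omega> r = a_star M / ereal r"
proof (rule antisym)
  have r: "0 < ereal r" "ereal r \<noteq> \<infinity>" using r_pos by auto
  have "ereal r * a_hat_star m \<omega> r \<le> a_star M"
    unfolding M.a_star_eq using admissible_a_hat_star by (intro M.admissible_le_a_hat_star) (simp add: admissible_scale)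
  then show "a_hat_star m \<omega> r \<le> a_star M / ereal r"
    by (simp add: ereal_le_divide_pos[OF r])
  have "ereal r * (a_star M / ereal r) = a_star M"
    using r by (simp add: ereal_mult_divide)
  then have "admissible (a_star M / ereal r)"
    using M.admissible_a_hat_star by (simp add: admissible_scale M.a_star_eq)
  then show "a_star M / ereal r \<le> a_hat_star m \<omega> r" by (rule admissible_le_a_hat_star)
qed

lemma semigroup_norm_le:
  fixes S :: "real \<Rightarrow> 'h::complex_hilbert_space \<Rightarrow> 'h"
  assumes S: "resolvent_bounded S \<omega> r" and growth: "\<And>t. 0 < t \<Longrightarrow> onorm (S t) \<le> m t"
    and a: "0 < a" "ereal a \<le> a_hat_star m \<omega> r" and b: "0 < b" "ereal b \<le> a_hat_star m \<omega> r"
    and t: "a + b < t"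
  shows "onorm (S t) \<le> semigroup_bound m \<omega> r t a b"
proof -
  interpret resolvent_bounded S \<omega> r by (rule S)
  have blin: "bounded_linear (S t)" if "0 \<le> t" for t
    using C0_semigroupD(1)[OF semigroup that] by (simp add: bounded_clinear_def)
  have Sm_pos: "norm (S t x) \<le> m t * norm x" if "0 < t" for t x
  proof -
    have "norm (S t x) \<le> onorm (S t) * norm x" using onorm[OF blin] that by simp
    also have "\<dots> \<le> m t * norm x" using growth[OF that] by (rule mult_right_mono) simp
    finally show ?thesis .
  qed
  \<comment> \<open>The growth bound is assumed for \<open>t > 0\<close> only; at 0 it follows by
    continuity of both sides.\<close>
  have Sm: "norm (S t x) \<le> m t * norm x" if "0 \<le> t" for t x
  proof (cases "t = 0")
    case True
    have "0 \<le> m 0 * norm x - norm (S 0 x)"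
    proof (rule continuous_ge_on_closure[where f = "\<lambda>t. m t * norm x - norm (S t x)" and x = 0 and S = "{0<..<1}"])
      show "continuous_on (closure {0<..<1}) (\<lambda>t. m t * norm x - norm (S t x))"
        by (intro continuous_intros continuous_on_subset[OF m_cont] C0_semigroupD(4)[OF semigroup]) auto
    qed (use Sm_pos in auto)
    then show ?thesis using True by simp
  qed (use Sm_pos that in simp)
  \<comment> \<open>The local bound on the semigroup that \<open>energy_bounded_omega\<close> asks
    for is read off from the continuity of \<open>m\<close>.\<close>
  obtain C where C: "\<And>t. t \<in> {0..1} \<Longrightarrow> m t \<le> C"
  proof -
    have "continuous_on {0..1} m" by (intro continuous_on_subset[OF m_cont]) auto
    then obtain c where c: "\<And>t. t \<in> {0..1} \<Longrightarrow> norm (m t) \<le> c" using bounded_on_Icc by blast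
    have "m t \<le> c" if "t \<in> {0..1}" for t
      using c[of t] that by (simp add: abs_le_iff)
    then show ?thesis by (rule that)
  qed
  have "onorm (S t) \<le> C" if "t \<in> {0..1}" for t
  proof -
    have "onorm (S t) \<le> m t"
      using that m_pos[of t] by (intro onorm_bound Sm) (auto intro: less_imp_le)
    then show ?thesis using C[OF that] by linarith
  qed
  then have fe: "energy_bounded \<omega> v" for v by (rule energy_bounded_omega)
  define fa fb where "fa = exp (2 * r * a) * p a / u a" and "fb = exp (2 * r * b) * p b / u b"
  have P: "0 \<le> u s \<and> (n s)\<^sup>2 * u s \<le> p s" if "s \<in> {0..c}" "ereal c \<le> a_hat_star m \<omega> r" for s c
  proof (cases "s = 0")
    case False
    then have "0 < s" "ereal s \<le> a_hat_star m \<omega> r"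
      using that order_trans[of "ereal s" "ereal c"] by auto
    then show ?thesis using below_a_hat_star[of s] by auto
  qed simp
  have f: "0 \<le> fa" "0 \<le> fb" using bound_factor_nonneg[OF a] bound_factor_nonneg[OF b] by (simp_all add: fa_def fb_def)
  have bound: "semigroup_bound m \<omega> r t a b = exp ((\<omega> - r) * t) * sqrt fa * sqrt fb"
    unfolding fa_def fb_def by (rule semigroup_bound_eq[OF a b])
  show ?thesis
  proof (rule onorm_bound)
    show "0 \<le> semigroup_bound m \<omega> r t a b" using f by (simp add: bound)
    fix v
    have "(norm (S t v))\<^sup>2 \<le> exp (2 * \<omega> * t) * exp (- 2 * r * (t - (a + b))) * (p a / u a) * (p b / u b) * (norm v)\<^sup>2"
      by (rule semigroup_estimate[OF Sm n_pos n_cont n_hat_def u_cont p_cont deriv_interior u_0 a(1) _ P[OF _ a(2)]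
            b(1) _ P[OF _ b(2)] t fe])
        (use below_a_hat_star(1) a b in auto)
    also have "exp (2 * \<omega> * t) * exp (- 2 * r * (t - (a + b))) =
        exp (2 * ((\<omega> - r) * t)) * exp (2 * r * a) * exp (2 * r * b)"
      unfolding mult_exp_exp by (simp add: algebra_simps)
    also have "exp (2 * ((\<omega> - r) * t)) * exp (2 * r * a) * exp (2 * r * b) * (p a / u a) * (p b / u b) * (norm v)\<^sup>2 =
        exp (2 * ((\<omega> - r) * t)) * fa * fb * (norm v)\<^sup>2"
      by (simp add: fa_def fb_def)
    also have "\<dots> = (semigroup_bound m \<omega> r t a b * norm v)\<^sup>2"
      using f by (simp add: bound power_mult_distrib exp_double)
    finally show "norm (S t v) \<le> semigroup_bound m \<omega> r t a b * norm v"
      by (rule power2_le_imp_le) (use f in \<open>simp add: bound\<close>)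
  qed
qed

end

theorem theorem1p10:
  fixes S :: "real \<Rightarrow> 'h::complex_hilbert_space \<Rightarrow> 'h"
    and m :: "real \<Rightarrow> real" and \<omega> r :: real
  assumes "C0_semigroup S"
    and "{z. Re z \<ge> \<omega>} \<subseteq> resolvent_set (generator_dom S) (generator S)"
    and "bdd_above ((\<lambda>z. onorm (resolvent (generator_dom S) (generator S) z)) ` {z. Re z \<ge> \<omega>})"
    and "0 < r"
    and "1 / r = (SUP z\<in>{z. Re z > \<omega>}. onorm (resolvent (generator_dom S) (generator S) z))"
    and "C1_halfline m" and "\<forall>s\<ge>0. 0 < m s"
    and "\<forall>t>0. onorm (S t) \<le> m t"
  shows
    "(\<forall>a b t. 0 < a \<and> ereal a \<le> a_hat_star m \<omega> r \<and> 0 < b \<and> ereal b \<le> a_hat_star m \<omega> r \<and>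
        a + b < t \<longrightarrow> onorm (S t) \<le> semigroup_bound m \<omega> r t a b)
     \<and>
     (\<forall>A. a_hat_star m \<omega> r = ereal A \<longrightarrow>
        (\<forall>t>2 * A.
          (\<forall>a\<in>{0<..A}. \<forall>b\<in>{0<..A}. semigroup_bound m \<omega> r t A A \<le> semigroup_bound m \<omega> r t a b) \<and>
          semigroup_bound m \<omega> r t A A = exp ((\<omega> - r) * (t - 2 * A)) * (m A)\<^sup>2 \<and>
          onorm (S t) \<le> exp ((\<omega> - r) * (t - 2 * A)) * (m A)\<^sup>2))
     \<and>
     (let M = (\<lambda>s. exp (- \<omega> * s / r) * m (s / r)) in
        a_hat_star m \<omega> r = a_star M / ereal r \<and>
        (\<forall>s>0. ereal s \<le> a_hat_star m \<omega> r \<longrightarrow> psi_hat m \<omega> r s = psi0 M (r * s)))"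
proof -
  interpret half_line_weight m \<omega> r
    using assms by unfold_locales auto
  let ?D = "generator_dom S" and ?A = "generator S"
  have S: "resolvent_bounded S \<omega> r"
  proof
    fix z :: complex assume z: "\<omega> < Re z"
    show "z \<in> resolvent_set ?D ?A" using assms(2) z by auto
    \<comment> \<open>A real-valued \<open>SUP\<close> bounds its members only for a bounded family;
      the assumption on the closed half-plane supplies this.\<close>
    have "bdd_above ((\<lambda>z. onorm (resolvent ?D ?A z)) ` {z. \<omega> < Re z})"
      by (rule bdd_above_mono[OF assms(3)]) auto
    then show "onorm (resolvent ?D ?A z) \<le> 1 / r"
      unfolding assms(5) using z by (intro cSUP_upper) auto
  qed (use assms in auto)
  have growth: "\<And>t. 0 < t \<Longrightarrow> onorm (S t) \<le> m t" using assms(8) by blast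
  note bound = semigroup_norm_le[OF S growth]
  have M_eq: "(\<lambda>s. exp (- \<omega> * s / r) * m (s / r)) = M" by (simp add: M_def fun_eq_iff)
  show ?thesis
    unfolding M_eq Let_def
  proof (intro conjI allI impI)
    fix a b t assume "0 < a \<and> ereal a \<le> a_hat_star m \<omega> r \<and> 0 < b \<and> ereal b \<le> a_hat_star m \<omega> r \<and> a + b < t"
    then show "onorm (S t) \<le> semigroup_bound m \<omega> r t a b" by (intro bound) auto
  next
    fix A t assume A: "a_hat_star m \<omega> r = ereal A" and t: "2 * A < t"
    show "\<forall>a\<in>{0<..A}. \<forall>b\<in>{0<..A}. semigroup_bound m \<omega> r t A A \<le> semigroup_bound m \<omega> r t a b"
      using semigroup_bound_optimal(1)[OF A] by blast
    show eq: "semigroup_bound m \<omega> r t A A = exp ((\<omega> - r) * (t - 2 * A)) * (m A)\<^sup>2"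
      by (rule semigroup_bound_optimal(2)[OF A])
    show "onorm (S t) \<le> exp ((\<omega> - r) * (t - 2 * A)) * (m A)\<^sup>2"
      unfolding eq[symmetric] using at_a_hat_star(1)[OF A] A t by (intro bound) auto
  next
    show "a_hat_star m \<omega> r = a_star M / ereal r" by (rule a_hat_star_scale)
  next
    fix s :: real assume "0 < s"
    then show "psi_hat m \<omega> r s = psi0 M (r * s)" by (simp add: psi_hat_scale)
  qed
qed

end
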